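(* The operator $A$ defined below is closed, densely defined and has the following properties: (i) Any complex number $\lambda$ is an eigenvalue of $A$ if and only if it is a spectral value of $A$ if and only if the matrix \[ S(\lambda) := \begin{bmatrix} e^{-\lambda} - 2 & e^{-\lambda l} \\ e^{-\lambda} & e^{-\lambda l} - 2 \end{bmatrix} \] is singular. Moreover, for each eigenvalue $\lambda$ of $A$ the corresponding eigenspace is one-dimensional. (ii) $A$ is dissipative and generates a contractive $C_0$-semigroup on $E$. (iii) $A$ has compact resolvent. (iv) $(0,\mathbf{1}_{[0,1]}, \mathbf{1}_{[0,l]}) \in \ker(A)$ and, moreover, $(\tfrac{1}{3}\mathbf{1}_{[0,1]},\mathbf{1}_{[0,1]}, \mathbf{1}_{[0,l]}) \in \ker(A')$. (v) The spectral bound $\operatorname{s}(A)=\sup\{\operatorname{Re}\lambda : \lambda\in\sigma(A)\}$ equals $0$ and is a dominant spectral value of $A$ (i.e. $\sigma(A)\cap(\operatorname{s}(A)+i\mathbb{R})=\{\operatorname{s}(A)\}$). (vi) The semigroup $(e^{tA})_{t \ge 0}$ is individually asymptotically positive (i.e. it is bounded and for every $f\ge 0$ the distance of $e^{tA}f$ to the positive cone $E_+$ tends to $0$ as $t\to\infty$), but not positive.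
   Context: Let $l>0$ be an irrational number and let $E = L^1([0,1]) \oplus L^1([0,1]) \oplus L^1([0,l])$ (a complex Banach lattice), modelling a network flow on a graph with vertices $v_{-1},v_0$, an edge $e_1$ of length $1$ from $v_{-1}$ to $v_0$, and two loops $e_2$ (length $1$) and $e_3$ (length $l$) at $v_0$. Define the operator $A$ on $E$ by \[ D(A) = \Bigl\{(f_1,f_2,f_3) \in W^{1,1}([0,1]) \oplus W^{1,1}([0,1]) \oplus W^{1,1}([0,l])\colon f_2(0) = \tfrac{1}{2}f_2(1) + \tfrac{1}{2}f_3(1) - \tfrac{1}{3}f_1(1),\ f_3(0) = \tfrac{1}{2}f_2(1) + \tfrac{1}{2}f_3(1) + \tfrac{2}{3}f_1(1),\ f_1(0) = 0 \Bigr\}, \] (where for $f_3$ the evaluation "$f_3(1)$" is at the endpoint of $[0,l]$ as in the paper's boundary conditions), and $A(f_1,f_2,f_3) = -(f_1',f_2',f_3')$. Here $\mathbf{1}_{I}$ denotes the indicator function of the interval $I$ and $A'$ the adjoint of $A$. *)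

theory Defs
  imports "HOL-Analysis.Analysis"
begin

text \<open>Elements of E = L1[0,1] + L1[0,1] + L1[0,l] are represented by triples of
  complex-valued functions on the real line; only their values on the respective
  interval matter and they are identified when equal almost everywhere
  (i.e. when the L1-distance is 0).  All notions below are invariant under this
  identification.\<close>

type_synonym vec = "(real \<Rightarrow> complex) \<times> (real \<Rightarrow> complex) \<times> (real \<Rightarrow> complex)"

definition c1 :: "vec \<Rightarrow> real \<Rightarrow> complex" where "c1 f = fst f"
definition c2 :: "vec \<Rightarrow> real \<Rightarrow> complex" where "c2 f = fst (snd f)"
definition c3 :: "vec \<Rightarrow> real \<Rightarrow> complex" where "c3 f = snd (snd f)"

definition vlin :: "complex \<Rightarrow> vec \<Rightarrow> complex \<Rightarrow> vec \<Rightarrow> vec" where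
  "vlin a f b g = ((\<lambda>x. a * c1 f x + b * c1 g x), (\<lambda>x. a * c2 f x + b * c2 g x),
                   (\<lambda>x. a * c3 f x + b * c3 g x))"

definition vsub :: "vec \<Rightarrow> vec \<Rightarrow> vec" where "vsub f g = vlin 1 f (-1) g"
definition vscale :: "complex \<Rightarrow> vec \<Rightarrow> vec" where "vscale c f = vlin c f 0 f"
definition vzero :: vec where "vzero = ((\<lambda>_. 0), (\<lambda>_. 0), (\<lambda>_. 0))"

definition inE :: "real \<Rightarrow> vec \<Rightarrow> bool" where
  "inE l f \<longleftrightarrow> set_integrable lborel {0..1} (c1 f) \<and> set_integrable lborel {0..1} (c2 f)
               \<and> set_integrable lborel {0..l} (c3 f)"

definition nrm :: "real \<Rightarrow> vec \<Rightarrow> real" where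
  "nrm l f = (LINT x:{0..1}|lborel. cmod (c1 f x)) + (LINT x:{0..1}|lborel. cmod (c2 f x))
           + (LINT x:{0..l}|lborel. cmod (c3 f x))"

text \<open>f in W^{1,1}([a,b]) with absolutely continuous representative u and weak derivative g\<close>
definition ac_rep :: "real \<Rightarrow> real \<Rightarrow> (real \<Rightarrow> complex) \<Rightarrow> (real \<Rightarrow> complex) \<Rightarrow> (real \<Rightarrow> complex) \<Rightarrow> bool" where
  "ac_rep a b f u g \<longleftrightarrow> set_integrable lborel {a..b} g
     \<and> (\<forall>x\<in>{a..b}. u x = u a + (LINT t:{a..x}|lborel. g t))
     \<and> (AE x in lborel. x \<in> {a..b} \<longrightarrow> f x = u x)"

definition graphA :: "real \<Rightarrow> (vec \<times> vec) set" where
  "graphA l = {(f, h). inE l f \<and> inE l h \<and>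
     (\<exists>u1 u2 u3 g1 g2 g3.
        ac_rep 0 1 (c1 f) u1 g1 \<and> ac_rep 0 1 (c2 f) u2 g2 \<and> ac_rep 0 l (c3 f) u3 g3 \<and>
        u2 0 = 1/2 * u2 1 + 1/2 * u3 l - 1/3 * u1 1 \<and>
        u3 0 = 1/2 * u2 1 + 1/2 * u3 l + 2/3 * u1 1 \<and>
        u1 0 = 0 \<and>
        (AE x in lborel. x \<in> {0..1} \<longrightarrow> c1 h x = - g1 x) \<and>
        (AE x in lborel. x \<in> {0..1} \<longrightarrow> c2 h x = - g2 x) \<and>
        (AE x in lborel. x \<in> {0..l} \<longrightarrow> c3 h x = - g3 x))}"

definition domA :: "real \<Rightarrow> vec set" where "domA l = fst ` graphA l"

definition closed_op :: "real \<Rightarrow> bool" where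
  "closed_op l \<longleftrightarrow> (\<forall>fs gs f g. (\<forall>n. (fs n, gs n) \<in> graphA l) \<and> inE l f \<and> inE l g \<and>
      (\<lambda>n. nrm l (vsub (fs n) f)) \<longlonglongrightarrow> 0 \<and> (\<lambda>n. nrm l (vsub (gs n) g)) \<longlonglongrightarrow> 0
      \<longrightarrow> (f, g) \<in> graphA l)"

definition densely_defined :: "real \<Rightarrow> bool" where
  "densely_defined l \<longleftrightarrow> (\<forall>f. inE l f \<longrightarrow> (\<forall>\<epsilon>>0. \<exists>g\<in>domA l. nrm l (vsub f g) < \<epsilon>))"

definition eigenvalue :: "real \<Rightarrow> complex \<Rightarrow> bool" where
  "eigenvalue l z \<longleftrightarrow> (\<exists>f. (f, vscale z f) \<in> graphA l \<and> nrm l f \<noteq> 0)"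

definition eigenspace_dim1 :: "real \<Rightarrow> complex \<Rightarrow> bool" where
  "eigenspace_dim1 l z \<longleftrightarrow> (\<exists>f0. (f0, vscale z f0) \<in> graphA l \<and> nrm l f0 \<noteq> 0 \<and>
     (\<forall>f. (f, vscale z f) \<in> graphA l \<longrightarrow> (\<exists>c. nrm l (vsub f (vscale c f0)) = 0)))"

definition resolvent_set :: "real \<Rightarrow> complex set" where
  "resolvent_set l = {z.
     (\<forall>h. inE l h \<longrightarrow> (\<exists>f. (f, vsub (vscale z f) h) \<in> graphA l)) \<and>
     (\<forall>f. (f, vscale z f) \<in> graphA l \<longrightarrow> nrm l f = 0) \<and>
     (\<exists>C. \<forall>f g. (f, g) \<in> graphA l \<longrightarrow> nrm l f \<le> C * nrm l (vsub (vscale z f) g))}"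

definition spectrumA :: "real \<Rightarrow> complex set" where
  "spectrumA l = - resolvent_set l"

definition spectral_bound :: "real \<Rightarrow> real" where
  "spectral_bound l = (SUP z\<in>spectrumA l. Re z)"

definition Smat :: "real \<Rightarrow> complex \<Rightarrow> complex^2^2" where
  "Smat l z = vector [vector [exp (-z) - 2, exp (-z * of_real l)],
                      vector [exp (-z), exp (-z * of_real l) - 2]]"

definition dissipative :: "real \<Rightarrow> bool" where
  "dissipative l \<longleftrightarrow> (\<forall>f g (\<mu>::real). (f, g) \<in> graphA l \<and> \<mu> > 0 \<longrightarrow>
      nrm l (vsub (vscale (of_real \<mu>) f) g) \<ge> \<mu> * nrm l f)"

definition generated_semigroup :: "real \<Rightarrow> (real \<Rightarrow> vec \<Rightarrow> vec) \<Rightarrow> bool" where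
  "generated_semigroup l T \<longleftrightarrow>
     (\<forall>t\<ge>0. \<forall>f. inE l f \<longrightarrow> inE l (T t f)) \<and>
     (\<forall>t\<ge>0. \<forall>f g. inE l f \<and> inE l g \<and> nrm l (vsub f g) = 0 \<longrightarrow> nrm l (vsub (T t f) (T t g)) = 0) \<and>
     (\<forall>t\<ge>0. \<forall>a b f g. inE l f \<and> inE l g \<longrightarrow>
          nrm l (vsub (T t (vlin a f b g)) (vlin a (T t f) b (T t g))) = 0) \<and>
     (\<forall>t\<ge>0. \<exists>M. \<forall>f. inE l f \<longrightarrow> nrm l (T t f) \<le> M * nrm l f) \<and>
     (\<forall>f. inE l f \<longrightarrow> nrm l (vsub (T 0 f) f) = 0) \<and>
     (\<forall>t\<ge>0. \<forall>s\<ge>0. \<forall>f. inE l f \<longrightarrow> nrm l (vsub (T (t + s) f) (T t (T s f))) = 0) \<and>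
     (\<forall>f. inE l f \<longrightarrow> ((\<lambda>t. nrm l (vsub (T t f) f)) \<longlongrightarrow> 0) (at_right 0)) \<and>
     (\<forall>f g. (f, g) \<in> graphA l \<longleftrightarrow> (inE l f \<and> inE l g \<and>
         ((\<lambda>t. nrm l (vsub (vscale (of_real (1 / t)) (vsub (T t f) f)) g)) \<longlongrightarrow> 0) (at_right 0)))"

definition contractive :: "real \<Rightarrow> (real \<Rightarrow> vec \<Rightarrow> vec) \<Rightarrow> bool" where
  "contractive l T \<longleftrightarrow> (\<forall>t\<ge>0. \<forall>f. inE l f \<longrightarrow> nrm l (T t f) \<le> nrm l f)"

definition compact_resolvent :: "real \<Rightarrow> bool" where
  "compact_resolvent l \<longleftrightarrow> (\<exists>z\<in>resolvent_set l.
     (\<forall>hs fs. (\<forall>n::nat. inE l (hs n) \<and> nrm l (hs n) \<le> 1 \<and>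
                    (fs n, vsub (vscale z (fs n)) (hs n)) \<in> graphA l) \<longrightarrow>
        (\<exists>r f. strict_mono r \<and> inE l f \<and> (\<lambda>n. nrm l (vsub (fs (r n)) f)) \<longlonglongrightarrow> 0)))"

definition pairing :: "real \<Rightarrow> vec \<Rightarrow> vec \<Rightarrow> complex" where
  "pairing l g f = (LINT x:{0..1}|lborel. c1 g x * c1 f x) + (LINT x:{0..1}|lborel. c2 g x * c2 f x)
                 + (LINT x:{0..l}|lborel. c3 g x * c3 f x)"

definition in_ker_adjoint :: "real \<Rightarrow> (vec \<Rightarrow> complex) \<Rightarrow> bool" where
  "in_ker_adjoint l \<phi> \<longleftrightarrow>
     (\<forall>a b f g. inE l f \<and> inE l g \<longrightarrow> \<phi> (vlin a f b g) = a * \<phi> f + b * \<phi> g) \<and>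
     (\<exists>M. \<forall>f. inE l f \<longrightarrow> cmod (\<phi> f) \<le> M * nrm l f) \<and>
     (\<forall>f g. (f, g) \<in> graphA l \<longrightarrow> \<phi> g = 0)"

definition positive_vec :: "real \<Rightarrow> vec \<Rightarrow> bool" where
  "positive_vec l f \<longleftrightarrow> inE l f \<and>
     (AE x in lborel. x \<in> {0..1} \<longrightarrow> Im (c1 f x) = 0 \<and> Re (c1 f x) \<ge> 0) \<and>
     (AE x in lborel. x \<in> {0..1} \<longrightarrow> Im (c2 f x) = 0 \<and> Re (c2 f x) \<ge> 0) \<and>
     (AE x in lborel. x \<in> {0..l} \<longrightarrow> Im (c3 f x) = 0 \<and> Re (c3 f x) \<ge> 0)"

definition dist_pos_cone :: "real \<Rightarrow> vec \<Rightarrow> real" where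
  "dist_pos_cone l f = (INF g\<in>{g. positive_vec l g}. nrm l (vsub f g))"

definition indiv_asymp_positive :: "real \<Rightarrow> (real \<Rightarrow> vec \<Rightarrow> vec) \<Rightarrow> bool" where
  "indiv_asymp_positive l T \<longleftrightarrow>
     (\<exists>M. \<forall>t\<ge>0. \<forall>f. inE l f \<longrightarrow> nrm l (T t f) \<le> M * nrm l f) \<and>
     (\<forall>f. positive_vec l f \<longrightarrow> ((\<lambda>t. dist_pos_cone l (T t f)) \<longlongrightarrow> 0) at_top)"

definition positive_semigroup :: "real \<Rightarrow> (real \<Rightarrow> vec \<Rightarrow> vec) \<Rightarrow> bool" where
  "positive_semigroup l T \<longleftrightarrow> (\<forall>t\<ge>0. \<forall>f. positive_vec l f \<longrightarrow> positive_vec l (T t f))"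

end

theory Submission
  imports Defs "HOL-Probability.Helly_Selection"
begin

text \<open>The semigroup is explicit: extend the flow profile on each edge to negative arguments, \<open>e1\<close> by 0
  and \<open>e2\<close>, \<open>e3\<close> by reading the boundary condition as a recursion; time evolution is then translation
  of the extended profile. Absolute column sums 1 of the boundary matrix make it contractive, and
  solvability of the resolvent equation (a \<open>2 \<times> 2\<close> linear system with determinant proportional to
  that of the matrix in (i)) identifies its generator with the operator. Once the first edge has
  been drained, the inflow into both loops is a solution of \<open>V t = (V (t - 1) + V (t - l)) / 2\<close>. For
  irrational \<open>l\<close> continuous solutions converge to a constant, because the numbers \<open>m + n l\<close> become
  arbitrarily dense; conservation of mass identifies the limit, which is nonnegative for nonnegative
  initial data. Since the statement quantifies over all semigroups generated by the operator,
  uniqueness is needed, and for it local boundedness, which comes from a gliding hump argument.\<close>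

section \<open>Integrals over intervals\<close>

text \<open>The column of the boundary matrix belonging to the first edge is (-1/3, 2/3). Its
  negative entry destroys positivity, but acts only until that edge is empty; afterwards the loops
  merely average, and the conserved mass decides the limit.

  Vectors are functions modulo null sets, so identities hold pointwise for the explicit construction
  and almost everywhere for all that concerns the operator or an arbitrary semigroup.

  The inflow of a general initial vector is only integrable, while the argument for the delay
  equation needs continuity. Averaging the extended profiles over short windows commutes with the
  flow, makes them continuous and changes the vector little in norm; contractivity then transfers
  the limit to all data. The same averages lie in the domain and prove its density.

  A generated semigroup comes with a bound for each single time and with continuity at time 0 from
  the right. Bounds uniform in time are therefore derived first; they give invariance of the domain
  and continuity of orbits, on which the comparison of two semigroups rests.\<close>

abbreviation itg :: "real \<Rightarrow> real \<Rightarrow> (real \<Rightarrow> 'a::{banach, second_countable_topology}) \<Rightarrow> 'a" where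
  "itg a b G \<equiv> set_lebesgue_integral lborel {a..b} G"

abbreviation iable :: "real \<Rightarrow> real \<Rightarrow> (real \<Rightarrow> 'a::{banach, second_countable_topology}) \<Rightarrow> bool" where
  "iable a b G \<equiv> set_integrable lborel {a..b} G"

lemma iable_sub: "iable a b G \<Longrightarrow> a \<le> a' \<Longrightarrow> b' \<le> b \<Longrightarrow> iable a' b' G"
  by (rule set_integrable_subset) auto

lemma iable_norm: "iable a b G \<Longrightarrow> iable a b (\<lambda>x. norm (G x))"
  by (rule set_integrable_norm)

lemma iable_combine: "iable a b G \<Longrightarrow> iable b c G \<Longrightarrow> iable a c G"
proof -
  assume 1: "iable a b G" "iable b c G"
  have "set_integrable lborel ({a..b} \<union> {b..c}) G" by (rule set_integrable_Un[OF 1]) auto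
  then show ?thesis by (rule set_integrable_subset) auto
qed

lemma itg_combine:
  assumes "a \<le> b" "b \<le> c" "iable a c G"
  shows "itg a c G = itg a b G + itg b c G"
proof -
  have eq: "{a..c} = {a..b} \<union> {b..c}" using assms by auto
  have "itg a c G = set_lebesgue_integral lborel ({a..b} \<union> {b..c}) G" using eq by simp
  also have "\<dots> = itg a b G + itg b c G"
  proof (rule set_integral_Un_AE)
    show "AE x in lborel. \<not> (x \<in> {a..b} \<and> x \<in> {b..c})"
      using AE_lborel_singleton[of b] by eventually_elim auto
    show "iable a b G" "iable b c G" using assms by (auto intro: iable_sub)
  qed auto
  finally show ?thesis .
qed

lemma iable_shift: "iable a b (\<lambda>x. G (x + c)) \<longleftrightarrow> iable (a + c) (b + c) G"
proof -
  have "integrable lborel (\<lambda>x. indicator {a+c..b+c} x *\<^sub>R G x)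
     \<longleftrightarrow> integrable lborel (\<lambda>x. indicator {a+c..b+c} (c + 1 * x) *\<^sub>R G (c + 1 * x))"
    by (rule lborel_integrable_real_affine_iff[symmetric]) simp
  also have "(\<lambda>x. indicator {a+c..b+c} (c + 1 * x) *\<^sub>R G (c + 1 * x)) = (\<lambda>x. indicator {a..b} x *\<^sub>R G (x + c))"
    by (auto simp: indicator_def add.commute)
  finally show ?thesis by (simp add: set_integrable_def)
qed

lemma itg_shift: "itg a b (\<lambda>x. G (x + c)) = itg (a + c) (b + c) G"
proof -
  have "(\<integral>x. indicator {a+c..b+c} x *\<^sub>R G x \<partial>lborel)
     = \<bar>1\<bar> *\<^sub>R (\<integral>x. indicator {a+c..b+c} (c + 1 * x) *\<^sub>R G (c + 1 * x) \<partial>lborel)"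
    by (rule lborel_integral_real_affine) simp
  also have "(\<lambda>x. indicator {a+c..b+c} (c + 1 * x) *\<^sub>R G (c + 1 * x)) = (\<lambda>x. indicator {a..b} x *\<^sub>R G (x + c))"
    by (auto simp: indicator_def add.commute)
  finally show ?thesis by (simp add: set_lebesgue_integral_def)
qed

lemma itg_point [simp]: "itg a a G = 0"
proof -
  have "itg a a G = (LINT x:{}|lborel. G x)"
    unfolding set_lebesgue_integral_def
    by (rule integral_discrete_difference[where X="{a}"]) auto
  then show ?thesis by (simp add: set_lebesgue_integral_def)
qed

lemma itg_cong: "(\<And>x. a \<le> x \<Longrightarrow> x \<le> b \<Longrightarrow> G x = H x) \<Longrightarrow> itg a b G = itg a b H"
  by (rule set_lebesgue_integral_cong) auto

lemma iable_cong: "(\<And>x. a \<le> x \<Longrightarrow> x \<le> b \<Longrightarrow> G x = H x) \<Longrightarrow> iable a b G \<longleftrightarrow> iable a b H"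
  by (rule set_integrable_cong) auto

lemma itg_cong_AE':
  assumes "iable a b G" "iable a b H" "AE x in lborel. x \<in> {a..b} \<longrightarrow> G x = H x"
  shows "itg a b G = itg a b H"
  unfolding set_lebesgue_integral_def
  by (rule integral_cong_AE)
     (use assms in \<open>auto simp: set_integrable_def indicator_def intro: borel_measurable_integrable elim!: eventually_mono\<close>)

lemma itg_mono:
  fixes G H :: "real \<Rightarrow> real"
  shows "iable a b G \<Longrightarrow> iable a b H \<Longrightarrow> (\<And>x. a \<le> x \<Longrightarrow> x \<le> b \<Longrightarrow> G x \<le> H x) \<Longrightarrow> itg a b G \<le> itg a b H"
  by (rule set_integral_mono) auto

lemma itg_nonneg: "(\<And>x. a \<le> x \<Longrightarrow> x \<le> b \<Longrightarrow> 0 \<le> (G x :: real)) \<Longrightarrow> 0 \<le> itg a b G"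
  unfolding set_lebesgue_integral_def by (rule integral_nonneg_AE) (auto simp: indicator_def)

lemma itg_norm_le: "iable a b G \<Longrightarrow> norm (itg a b G) \<le> itg a b (\<lambda>x. norm (G x))"
  by (rule set_integral_norm_bound)

lemma iable_continuous: "continuous_on {a..b} G \<Longrightarrow> iable a b (G :: real \<Rightarrow> 'a::{banach, second_countable_topology})"
  by (simp add: set_integrable_def borel_integrable_compact)

lemma itg_mono_sub:
  fixes G :: "real \<Rightarrow> real"
  assumes "iable a b G" "a \<le> a'" "b' \<le> b" "\<And>x. a \<le> x \<Longrightarrow> x \<le> b \<Longrightarrow> 0 \<le> G x"
  shows "itg a' b' G \<le> itg a b G"
  unfolding set_lebesgue_integral_def
  by (rule integral_mono) (use assms iable_sub[OF assms(1-3)] in \<open>auto simp: set_integrable_def indicator_def\<close>)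

lemma itg_const: "a \<le> b \<Longrightarrow> itg a b (\<lambda>_. c) = (b - a) *\<^sub>R (c::'a::{banach, second_countable_topology})"
  by (simp add: set_integral_const)

lemma iable_const [simp]: "iable a b (\<lambda>_. c)"
  by (rule iable_continuous) auto

lemma itg_le_const:
  fixes G :: "real \<Rightarrow> 'a::{banach, second_countable_topology}"
  assumes "a \<le> b" "iable a b G" "\<And>x. a \<le> x \<Longrightarrow> x \<le> b \<Longrightarrow> norm (G x) \<le> C"
  shows "norm (itg a b G) \<le> (b - a) * C"
proof -
  have "norm (itg a b G) \<le> itg a b (\<lambda>x. norm (G x))" by (rule itg_norm_le) fact
  also have "\<dots> \<le> itg a b (\<lambda>x. C)"
    using assms by (intro itg_mono iable_norm) auto
  also have "\<dots> = (b - a) * C" using assms by (simp add: itg_const)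
  finally show ?thesis .
qed

lemma itg_norm_triangle:
  fixes G H K :: "real \<Rightarrow> 'a::{banach, second_countable_topology}"
  assumes "iable a b (\<lambda>x. G x - H x)" "iable a b (\<lambda>x. H x - K x)"
  shows "itg a b (\<lambda>x. norm (G x - K x)) \<le> itg a b (\<lambda>x. norm (G x - H x)) + itg a b (\<lambda>x. norm (H x - K x))"
proof -
  have "iable a b (\<lambda>x. (G x - H x) + (H x - K x))" using assms by (rule set_integral_add)
  then have 1: "iable a b (\<lambda>x. G x - K x)" by simp
  have "itg a b (\<lambda>x. norm (G x - K x)) \<le> itg a b (\<lambda>x. norm (G x - H x) + norm (H x - K x))"
  proof (rule itg_mono)
    show "iable a b (\<lambda>x. norm (G x - K x))" by (rule iable_norm[OF 1])
    show "iable a b (\<lambda>x. norm (G x - H x) + norm (H x - K x))" by (intro set_integral_add iable_norm assms)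
    show "norm (G x - K x) \<le> norm (G x - H x) + norm (H x - K x)" for x
      using norm_triangle_ineq[of "G x - H x" "H x - K x"] by simp
  qed
  also have "\<dots> = itg a b (\<lambda>x. norm (G x - H x)) + itg a b (\<lambda>x. norm (H x - K x))"
    by (intro set_integral_add iable_norm assms)
  finally show ?thesis .
qed

lemma itg_norm_eq_0:
  fixes G :: "real \<Rightarrow> 'a::{banach, second_countable_topology}"
  assumes "iable a b G"
  shows "itg a b (\<lambda>x. norm (G x)) = 0 \<longleftrightarrow> (AE x in lborel. x \<in> {a..b} \<longrightarrow> G x = 0)"
proof -
  have "integrable lborel (\<lambda>x. norm (indicator {a..b} x *\<^sub>R G x))"
    using assms by (simp add: set_integrable_def del: norm_scaleR)
  then have "(\<integral>x. norm (indicator {a..b} x *\<^sub>R G x) \<partial>lborel) = 0 \<longleftrightarrow> (AE x in lborel. norm (indicator {a..b} x *\<^sub>R G x) = 0)"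
    by (intro integral_nonneg_eq_0_iff_AE) auto
  moreover have "(\<lambda>x. norm (indicator {a..b} x *\<^sub>R G x)) = (\<lambda>x. indicator {a..b} x *\<^sub>R norm (G x))" by auto
  moreover have "norm (indicator {a..b} x *\<^sub>R G x) = 0 \<longleftrightarrow> (x \<in> {a..b} \<longrightarrow> G x = 0)" for x
    by (auto simp: indicator_def)
  ultimately show ?thesis by (simp add: set_lebesgue_integral_def)
qed

section \<open>Primitives, approximation by continuous functions, translations and averages in
  L1\<close>

lemma itg_continuous_on:
  fixes G :: "real \<Rightarrow> 'a::euclidean_space"
  assumes "iable a b G"
  shows "continuous_on {a..b} (\<lambda>x. itg a x G)"
proof -
  have 1: "G integrable_on {a..b}" using assms by (rule set_borel_integral_eq_integral)
  have "continuous_on {a..b} (\<lambda>x. integral {a..x} G)" by (rule indefinite_integral_continuous_1[OF 1])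
  moreover have "itg a x G = integral {a..x} G" if "x \<in> {a..b}" for x
    by (rule set_borel_integral_eq_integral, rule iable_sub[OF assms]) (use that in auto)
  ultimately show ?thesis using continuous_on_eq[of "{a..b}" "\<lambda>x. integral {a..x} G" "\<lambda>x. itg a x G"] by simp
qed

text \<open>A measurable function is a limit almost everywhere of continuous functions, but without
  an integrable majorant. Composing with a continuous truncation supplies one. Dominated convergence
  is used twice: once to let the truncation height grow, once to approximate at fixed
  height.\<close>

lemma itg_approx_continuous:
  fixes G :: "real \<Rightarrow> complex"
  assumes G: "iable a b G" and e: "0 < e"
  obtains g where "continuous_on UNIV g" "itg a b (\<lambda>x. norm (G x - g x)) < e"
proof -
  \<comment> \<open>Radial retraction onto the closed disc of radius \<open>K\<close>; the
    denominator stays away from 0, which makes it continuous for positive \<open>K\<close>.\<close>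
  define pr where "pr K v = (K / max K (norm v)) *\<^sub>R v" for K :: real and v :: complex
  have pr_cont: "continuous_on UNIV (pr K)" if "K > 0" for K
    unfolding pr_def using that by (intro continuous_intros) (auto simp: max_def)
  have pr_tendsto: "((\<lambda>n. pr K (f n)) \<longlongrightarrow> pr K v) F" if "K > 0" "(f \<longlongrightarrow> v) F" for K f v and F :: "nat filter"
    using continuous_on_tendsto_compose[OF pr_cont[OF that(1)] that(2)] by auto
  have pr_le: "norm (pr K v) \<le> K" if "K > 0" for K v
    using that by (auto simp: pr_def divide_simps max_def)
  have pr_le2: "norm (v - pr K v) \<le> norm v" if "K > 0" for K v
  proof -
    have "v - pr K v = (1 - K / max K (norm v)) *\<^sub>R v" by (simp add: pr_def scaleR_left_diff_distrib)
    moreover have "\<bar>1 - K / max K (norm v)\<bar> \<le> 1" using that by (auto simp: max_def divide_simps)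
    ultimately show ?thesis using mult_right_mono[of "\<bar>1 - K / max K (norm v)\<bar>" 1 "norm v"] by simp
  qed
  have pr_meas [measurable]: "pr K \<in> borel_measurable borel" if "K > 0" for K
    using pr_cont[OF that] by (rule borel_measurable_continuous_onI)
  define H where "H = (\<lambda>x. indicator {a..b} x *\<^sub>R G x)"
  have Hi: "integrable lborel H" using G by (simp add: set_integrable_def H_def)
  then have Hm [measurable]: "H \<in> borel_measurable borel" by (auto dest: borel_measurable_integrable)
  have "(\<lambda>n. \<integral>x. norm (H x - pr (real (Suc n)) (H x)) \<partial>lborel) \<longlonglongrightarrow> integral\<^sup>L lborel (\<lambda>x::real. 0::real)"
  proof (rule integral_dominated_convergence[where w="\<lambda>x. norm (H x)"])
    show "AE x in lborel. (\<lambda>n. norm (H x - pr (real (Suc n)) (H x))) \<longlonglongrightarrow> 0"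
    proof (rule AE_I2)
      fix x
      obtain N :: nat where N: "norm (H x) \<le> real N" using real_arch_simple by blast
      have "norm (H x - pr (real (Suc n)) (H x)) = 0" if "n \<ge> N" for n
        using that N by (auto simp: pr_def max_def)
      then show "(\<lambda>n. norm (H x - pr (real (Suc n)) (H x))) \<longlonglongrightarrow> 0"
        by (intro tendsto_eventually) (auto simp: eventually_sequentially)
    qed
    show "AE x in lborel. norm (norm (H x - pr (real (Suc n)) (H x))) \<le> norm (H x)" for n
      using pr_le2 by auto
  qed (use Hi in auto)
  then have "\<forall>\<^sub>F n in sequentially. (\<integral>x. norm (H x - pr (real (Suc n)) (H x)) \<partial>lborel) < e/2"
    using e by (intro order_tendstoD) auto
  then obtain n where n: "(\<integral>x. norm (H x - pr (real (Suc n)) (H x)) \<partial>lborel) < e/2"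
    by (auto simp: eventually_sequentially)
  define K where "K = real (Suc n)"
  have K: "K > 0" by (simp add: K_def)
  have "H measurable_on UNIV"
    by (rule lebesgue_measurable_imp_measurable_on) (auto intro: measurable_completion)
  then obtain N g where N: "negligible N" and g: "\<And>n. continuous_on UNIV (g n)"
    and lim: "\<And>x. x \<notin> N \<Longrightarrow> (\<lambda>n. g n x) \<longlonglongrightarrow> H x"
    unfolding measurable_on_def by auto
  have aeN: "AE x in lborel. (\<lambda>n. g n x) \<longlonglongrightarrow> H x"
  proof -
    have "AE x in lebesgue. x \<notin> N" using N by (simp add: negligible_iff_null_sets AE_not_in)
    then have "AE x in lebesgue. (\<lambda>n. g n x) \<longlonglongrightarrow> H x" by (rule eventually_mono) (use lim in auto)
    then show ?thesis by (simp add: AE_completion_iff)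
  qed
  have gm [measurable]: "g n \<in> borel_measurable borel" for n using g by (rule borel_measurable_continuous_onI)
  have ind: "integrable lborel (\<lambda>x. indicator {a..b} x *\<^sub>R (2*K))"
    using iable_const[of a b "2*K"] by (simp add: set_integrable_def)
  \<comment> \<open>Truncating the approximants along with the limit bounds the integrand by
    \<open>2*K\<close> on the interval.\<close>
  have "(\<lambda>n. \<integral>x. indicator {a..b} x *\<^sub>R norm (pr K (H x) - pr K (g n x)) \<partial>lborel) \<longlonglongrightarrow> integral\<^sup>L lborel (\<lambda>x::real. 0::real)"
  proof (rule integral_dominated_convergence[where w="\<lambda>x. indicator {a..b} x *\<^sub>R (2*K)"])
    show "AE x in lborel. (\<lambda>n. indicator {a..b} x *\<^sub>R norm (pr K (H x) - pr K (g n x))) \<longlonglongrightarrow> 0"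
      using aeN
    proof eventually_elim
      case (elim x)
      have "(\<lambda>n. pr K (H x) - pr K (g n x)) \<longlonglongrightarrow> pr K (H x) - pr K (H x)"
        by (intro tendsto_intros pr_tendsto K elim)
      then have "(\<lambda>n. indicator {a..b} x *\<^sub>R norm (pr K (H x) - pr K (g n x))) \<longlonglongrightarrow> indicator {a..b} x *\<^sub>R norm (0::complex)"
        by (intro tendsto_intros) simp
      then show ?case by simp
    qed
    show "AE x in lborel. norm (indicator {a..b} x *\<^sub>R norm (pr K (H x) - pr K (g n x))) \<le> indicator {a..b} x *\<^sub>R (2*K)" for n
    proof (rule AE_I2)
      fix x
      have "norm (pr K (H x) - pr K (g n x)) \<le> K + K"
        using norm_triangle_ineq4[of "pr K (H x)" "pr K (g n x)"] pr_le[OF K, of "H x"] pr_le[OF K, of "g n x"] by linarith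
      then show "norm (indicator {a..b} x *\<^sub>R norm (pr K (H x) - pr K (g n x))) \<le> indicator {a..b} x *\<^sub>R (2*K)"
        by (auto simp: indicator_def)
    qed
  qed (use K ind in \<open>auto intro!: borel_measurable_scaleR borel_measurable_norm borel_measurable_diff measurable_compose[OF Hm pr_meas] measurable_compose[OF gm pr_meas]\<close>)
  then have "\<forall>\<^sub>F n in sequentially. (\<integral>x. indicator {a..b} x *\<^sub>R norm (pr K (H x) - pr K (g n x)) \<partial>lborel) < e/2"
    using e by (intro order_tendstoD) auto
  then obtain m where m: "(\<integral>x. indicator {a..b} x *\<^sub>R norm (pr K (H x) - pr K (g m x)) \<partial>lborel) < e/2"
    by (auto simp: eventually_sequentially)
  define f where "f x = pr K (g m x)" for x
  have fc: "continuous_on UNIV f"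
    unfolding f_def using continuous_on_compose2[OF pr_cont[OF K] g[of m]] by auto
  have fi: "iable a b f" using fc by (auto intro: iable_continuous continuous_on_subset)
  have GH: "H x = G x" if "x \<in> {a..b}" for x using that by (simp add: H_def)
  have Hab: "iable a b H" using iable_cong[of a b H G] G GH by auto
  have pri: "iable a b (\<lambda>x. pr K (H x))"
    unfolding set_integrable_def
    by (rule Bochner_Integration.integrable_bound[OF ind])
       (use K in \<open>auto simp: indicator_def intro!: measurable_compose[OF Hm pr_meas] pr_le order_trans[OF pr_le] borel_measurable_scaleR\<close>)
  have "itg a b (\<lambda>x. norm (H x - f x)) \<le> itg a b (\<lambda>x. norm (H x - pr K (H x))) + itg a b (\<lambda>x. norm (pr K (H x) - f x))"
    by (rule itg_norm_triangle) (intro set_integral_diff Hab pri fi)+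
  also have "itg a b (\<lambda>x. norm (H x - pr K (H x))) < e/2"
  proof -
    have "(\<lambda>x. indicator {a..b} x *\<^sub>R norm (H x - pr K (H x))) = (\<lambda>x. norm (H x - pr K (H x)))"
      by (auto simp: indicator_def H_def pr_def)
    then show ?thesis using n by (simp add: set_lebesgue_integral_def K_def)
  qed
  also have "itg a b (\<lambda>x. norm (pr K (H x) - f x)) < e/2"
    using m by (simp add: set_lebesgue_integral_def f_def)
  finally have "itg a b (\<lambda>x. norm (H x - f x)) < e" by simp
  moreover have "itg a b (\<lambda>x. norm (H x - f x)) = itg a b (\<lambda>x. norm (G x - f x))"
    by (rule itg_cong) (use GH in auto)
  ultimately show ?thesis using that[OF fc] by simp
qed

text \<open>Integrating over a sliding window costs no more than one window, so both statements below reduce to uniformly continuous functions.\<close>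

lemma itg_window_le:
  fixes G :: "real \<Rightarrow> real"
  assumes G: "iable (-1) b G" and b: "0 \<le> b" and t: "0 < t" "t \<le> 1" and nn: "\<And>x. 0 \<le> G x"
  shows "itg 0 b (\<lambda>x. itg (x - t) x G) \<le> t * itg (-1) b G"
proof -
  \<comment> \<open>Through a primitive the window integral is the difference
    \<open>\<Phi> x - \<Phi> (x - t)\<close>. Its integral telescopes to two end strips of width
    \<open>t\<close>, so no exchange of integrals is needed; monotonicity of \<open>\<Phi>\<close>
    bounds the right strip and the left one has the good sign.\<close>
  define \<Phi> where "\<Phi> x = itg (-1) x G" for x
  have \<Phi>c: "continuous_on {-1..b} \<Phi>" unfolding \<Phi>_def by (rule itg_continuous_on[OF G])
  have \<Phi>i: "iable (-1) b \<Phi>" by (rule iable_continuous[OF \<Phi>c])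
  have mono: "\<Phi> x \<le> \<Phi> b" "0 \<le> \<Phi> x" if "-1 \<le> x" "x \<le> b" for x
    unfolding \<Phi>_def using that nn by (auto intro!: itg_mono_sub[OF G] itg_nonneg)
  have sh: "iable 0 b (\<lambda>x. \<Phi> (x - t))"
    using iable_shift[of 0 b \<Phi> "-t"] iable_sub[OF \<Phi>i, of "-t" "b - t"] t by simp
  have "itg 0 b (\<lambda>x. itg (x - t) x G) = itg 0 b (\<lambda>x. \<Phi> x - \<Phi> (x - t))"
  proof (rule itg_cong)
    fix x assume x: "0 \<le> x" "x \<le> b"
    have "itg (-1) x G = itg (-1) (x - t) G + itg (x - t) x G"
      by (rule itg_combine) (use x t in \<open>auto intro: iable_sub[OF G]\<close>)
    then show "itg (x - t) x G = \<Phi> x - \<Phi> (x - t)" by (simp add: \<Phi>_def)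
  qed
  also have "\<dots> = itg 0 b \<Phi> - itg 0 b (\<lambda>x. \<Phi> (x - t))"
    by (rule set_integral_diff(2)) (auto intro: iable_sub[OF \<Phi>i] sh)
  also have "itg 0 b (\<lambda>x. \<Phi> (x - t)) = itg (-t) (b - t) \<Phi>"
    using itg_shift[of 0 b \<Phi> "-t"] by simp
  also have "itg 0 b \<Phi> - itg (-t) (b - t) \<Phi> \<le> t * \<Phi> b"
  proof -
    have 1: "itg (-t) b \<Phi> = itg (-t) 0 \<Phi> + itg 0 b \<Phi>"
      by (rule itg_combine) (use b t in \<open>auto intro: iable_sub[OF \<Phi>i]\<close>)
    have 2: "itg (-t) b \<Phi> = itg (-t) (b - t) \<Phi> + itg (b - t) b \<Phi>"
      by (rule itg_combine) (use b t in \<open>auto intro: iable_sub[OF \<Phi>i]\<close>)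
    have 3: "itg (b - t) b \<Phi> \<le> itg (b - t) b (\<lambda>_. \<Phi> b)"
      by (rule itg_mono) (use b t mono in \<open>auto intro: iable_sub[OF \<Phi>i]\<close>)
    have 4: "0 \<le> itg (-t) 0 \<Phi>" by (rule itg_nonneg) (use b t mono in auto)
    show ?thesis using 1 2 3 4 t by (simp add: itg_const)
  qed
  finally show ?thesis by (simp add: \<Phi>_def)
qed

lemma uniform_modulus:
  fixes g :: "real \<Rightarrow> complex"
  assumes "continuous_on UNIV g" "e > 0"
  obtains d where "d > 0" "d \<le> 1" "\<And>x y. a \<le> x \<Longrightarrow> x \<le> b \<Longrightarrow> a \<le> y \<Longrightarrow> y \<le> b \<Longrightarrow> \<bar>x - y\<bar> < d \<Longrightarrow> norm (g x - g y) < e"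
proof -
  have "uniformly_continuous_on {a..b} g"
    by (rule compact_uniformly_continuous) (use assms in \<open>auto intro: continuous_on_subset\<close>)
  then obtain d where "d > 0" "\<And>x y. x \<in> {a..b} \<Longrightarrow> y \<in> {a..b} \<Longrightarrow> dist y x < d \<Longrightarrow> dist (g y) (g x) < e"
    using assms(2) unfolding uniformly_continuous_on_def by metis
  then show ?thesis by (intro that[of "min d 1"]) (auto simp: dist_norm)
qed

lemma L1_translation:
  fixes G :: "real \<Rightarrow> complex"
  assumes G: "iable (-1) b G" and b: "0 \<le> b"
  shows "((\<lambda>t. itg 0 b (\<lambda>x. norm (G (x - t) - G x))) \<longlongrightarrow> 0) (at_right 0)"
proof (rule tendstoI)
  fix e :: real assume e: "e > 0"
  \<comment> \<open>The errors are \<open>e'\<close> for the shifted approximation,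
    \<open>b * e'\<close> for the modulus of continuity of \<open>g\<close> and \<open>e'\<close>
    for the approximation itself. Starting the interval at -1 leaves room for shifts up to
    \<open>d \<le> 1\<close>.\<close>
  define e' where "e' = e / (3 + b)"
  have e': "e' > 0" using e b by (simp add: e'_def)
  obtain g where g: "continuous_on UNIV g" "itg (-1) b (\<lambda>x. norm (G x - g x)) < e'"
    using itg_approx_continuous[OF G e'] .
  obtain d where d: "d > 0" "d \<le> 1" "\<And>x y. -1 \<le> x \<Longrightarrow> x \<le> b \<Longrightarrow> -1 \<le> y \<Longrightarrow> y \<le> b \<Longrightarrow> \<bar>x - y\<bar> < d \<Longrightarrow> norm (g x - g y) < e'"
    using uniform_modulus[OF g(1) e'] by metis
  have gi: "iable (-1) b g" using g(1) by (auto intro: iable_continuous continuous_on_subset)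
  have Gg: "iable (-1) b (\<lambda>x. G x - g x)" by (intro set_integral_diff G gi)
  have "dist (itg 0 b (\<lambda>x. norm (G (x - t) - G x))) 0 < e" if t: "0 < t" "t < d" for t
  proof -
    have 1: "iable 0 b (\<lambda>x. G (x - t) - g (x - t))"
      using iable_shift[of 0 b "\<lambda>x. G x - g x" "-t"] iable_sub[OF Gg, of "-t" "b - t"] t d by simp
    have gt: "iable 0 b (\<lambda>x. g (x - t))"
      using iable_shift[of 0 b g "-t"] iable_sub[OF gi, of "-t" "b - t"] t d by simp
    have g0: "iable 0 b g" and G0: "iable 0 b G" using G gi by (auto intro: iable_sub)
    have 2: "iable 0 b (\<lambda>x. g (x - t) - g x)" by (intro set_integral_diff gt g0)
    have 3: "iable 0 b (\<lambda>x. g x - G x)" by (intro set_integral_diff G0 g0)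
    have 4: "iable 0 b (\<lambda>x. g (x - t) - G x)" by (intro set_integral_diff G0 gt)
    have "itg 0 b (\<lambda>x. norm (G (x - t) - G x)) \<le> itg 0 b (\<lambda>x. norm (G (x - t) - g (x - t))) + itg 0 b (\<lambda>x. norm (g (x - t) - G x))"
      by (rule itg_norm_triangle[OF 1 4])
    also have "itg 0 b (\<lambda>x. norm (g (x - t) - G x)) \<le> itg 0 b (\<lambda>x. norm (g (x - t) - g x)) + itg 0 b (\<lambda>x. norm (g x - G x))"
      by (rule itg_norm_triangle[OF 2 3])
    also have "itg 0 b (\<lambda>x. norm (g (x - t) - g x)) \<le> itg 0 b (\<lambda>x. e')"
      by (intro itg_mono iable_norm 2 iable_const, rule less_imp_le, rule d(3)) (use t d in auto)
    also have "itg 0 b (\<lambda>x. norm (G (x - t) - g (x - t))) = itg (0-t) (b - t) (\<lambda>x. norm (G x - g x))"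
      using itg_shift[of 0 b "\<lambda>x. norm (G x - g x)" "-t"] by simp
    also have "\<dots> \<le> itg (-1) b (\<lambda>x. norm (G x - g x))"
      by (rule itg_mono_sub) (use t d in \<open>auto intro: iable_norm Gg\<close>)
    also have "itg 0 b (\<lambda>x. norm (g x - G x)) \<le> itg (-1) b (\<lambda>x. norm (G x - g x))"
      using itg_mono_sub[OF iable_norm[OF Gg], of 0 b] by (simp add: norm_minus_commute)
    finally have "itg 0 b (\<lambda>x. norm (G (x - t) - G x)) < 3 * e' + b * e'"
      using g(2) e' b by (simp add: itg_const)
    also have "\<dots> = e' * (3 + b)" by (simp add: algebra_simps)
    also have "\<dots> = e" using b by (simp add: e'_def)
    finally show ?thesis using itg_nonneg[of 0 b "\<lambda>x. norm (G (x - t) - G x)"] by (simp add: dist_norm)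
  qed
  then show "\<forall>\<^sub>F t in at_right 0. dist (itg 0 b (\<lambda>x. norm (G (x - t) - G x))) 0 < e"
    using d(1) unfolding eventually_at_right_field by auto
qed

lemma iable_average:
  fixes G :: "real \<Rightarrow> 'a::euclidean_space"
  assumes G: "iable (c - t) b G" and t: "0 \<le> t"
  shows "continuous_on {c..b} (\<lambda>x. itg (x - t) x G)"
proof -
  define \<Phi> where "\<Phi> x = itg (c - t) x G" for x
  have \<Phi>c: "continuous_on {c - t..b} \<Phi>" unfolding \<Phi>_def by (rule itg_continuous_on[OF G])
  have "continuous_on {c..b} (\<lambda>x. \<Phi> x - \<Phi> (x - t))"
  proof (intro continuous_intros)
    show "continuous_on {c..b} \<Phi>" by (rule continuous_on_subset[OF \<Phi>c]) (use t in auto)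
    show "continuous_on {c..b} (\<lambda>x. \<Phi> (x - t))"
      by (rule continuous_on_compose2[OF \<Phi>c]) (use t in \<open>auto intro!: continuous_intros\<close>)
  qed
  moreover have "\<Phi> x - \<Phi> (x - t) = itg (x - t) x G" if "x \<in> {c..b}" for x
    unfolding \<Phi>_def using itg_combine[of "c - t" "x - t" x G] that t iable_sub[OF G, of "c - t" x] by simp
  ultimately show ?thesis by (rule continuous_on_eq)
qed

text \<open>The same three-term estimate as for translations. The average of \<open>G - g\<close> is
  controlled by \<open>itg_window_le\<close>, whose factor \<open>t\<close> cancels the
  normalization \<open>1/t\<close>.\<close>

lemma L1_average:
  fixes G :: "real \<Rightarrow> complex"
  assumes G: "iable (-1) b G" and b: "0 \<le> b"
  shows "((\<lambda>t. itg 0 b (\<lambda>x. norm ((1/t) *\<^sub>R itg (x - t) x G - G x))) \<longlongrightarrow> 0) (at_right 0)"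
proof (rule tendstoI)
  fix e :: real assume e: "e > 0"
  define e' where "e' = e / (3 + b)"
  have e': "e' > 0" using e b by (simp add: e'_def)
  obtain g where g: "continuous_on UNIV g" "itg (-1) b (\<lambda>x. norm (G x - g x)) < e'"
    using itg_approx_continuous[OF G e'] .
  obtain d where d: "d > 0" "d \<le> 1" "\<And>x y. -1 \<le> x \<Longrightarrow> x \<le> b \<Longrightarrow> -1 \<le> y \<Longrightarrow> y \<le> b \<Longrightarrow> \<bar>x - y\<bar> < d \<Longrightarrow> norm (g x - g y) < e'"
    using uniform_modulus[OF g(1) e'] by metis
  have gi: "iable (-1) b g" using g(1) by (auto intro: iable_continuous continuous_on_subset)
  have Gg: "iable (-1) b (\<lambda>x. G x - g x)" by (intro set_integral_diff G gi)
  have "dist (itg 0 b (\<lambda>x. norm ((1/t) *\<^sub>R itg (x - t) x G - G x))) 0 < e" if t: "0 < t" "t < d" for t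
  proof -
    have av: "iable 0 b (\<lambda>x. (1/t) *\<^sub>R itg (x - t) x F)" if "iable (-1) b F" for F :: "real \<Rightarrow> complex"
      by (rule set_integrable_scaleR_right, rule iable_continuous, rule iable_average)
         (use t d iable_sub[OF that, of "0 - t" b] in auto)
    have g0: "iable 0 b g" and G0: "iable 0 b G" using G gi by (auto intro: iable_sub)
    have 1: "iable 0 b (\<lambda>x. (1/t) *\<^sub>R itg (x - t) x G - (1/t) *\<^sub>R itg (x - t) x g)"
      by (intro set_integral_diff av G gi)
    have 2: "iable 0 b (\<lambda>x. (1/t) *\<^sub>R itg (x - t) x g - g x)" by (intro set_integral_diff av gi g0)
    have 3: "iable 0 b (\<lambda>x. g x - G x)" by (intro set_integral_diff G0 g0)
    have 4: "iable 0 b (\<lambda>x. (1/t) *\<^sub>R itg (x - t) x g - G x)" by (intro set_integral_diff av gi G0)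
    have "itg 0 b (\<lambda>x. norm ((1/t) *\<^sub>R itg (x - t) x G - G x))
       \<le> itg 0 b (\<lambda>x. norm ((1/t) *\<^sub>R itg (x - t) x G - (1/t) *\<^sub>R itg (x - t) x g)) + itg 0 b (\<lambda>x. norm ((1/t) *\<^sub>R itg (x - t) x g - G x))"
      by (rule itg_norm_triangle[OF 1 4])
    also have "itg 0 b (\<lambda>x. norm ((1/t) *\<^sub>R itg (x - t) x g - G x))
       \<le> itg 0 b (\<lambda>x. norm ((1/t) *\<^sub>R itg (x - t) x g - g x)) + itg 0 b (\<lambda>x. norm (g x - G x))"
      by (rule itg_norm_triangle[OF 2 3])
    also have "itg 0 b (\<lambda>x. norm ((1/t) *\<^sub>R itg (x - t) x g - g x)) \<le> itg 0 b (\<lambda>x. e')"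
    proof (intro itg_mono iable_norm 2 iable_const)
      fix x assume x: "0 \<le> x" "x \<le> b"
      have ii: "iable (x - t) x g" by (rule iable_sub[OF gi]) (use x t d in auto)
      have "(1/t) *\<^sub>R itg (x - t) x g - g x = (1/t) *\<^sub>R (itg (x - t) x g - itg (x - t) x (\<lambda>_. g x))"
        using t by (simp add: itg_const scaleR_diff_right)
      also have "itg (x - t) x g - itg (x - t) x (\<lambda>_. g x) = itg (x - t) x (\<lambda>s. g s - g x)"
        by (rule set_integral_diff(2)[symmetric]) (auto intro: ii)
      finally have "norm ((1/t) *\<^sub>R itg (x - t) x g - g x) = (1/t) * norm (itg (x - t) x (\<lambda>s. g s - g x))"
        using t by simp
      also have "\<dots> \<le> (1/t) * ((x - (x - t)) * e')"
        by (rule mult_left_mono, rule itg_le_const) (use x t d less_imp_le[OF d(3)] in \<open>auto intro!: set_integral_diff(1) ii\<close>)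
      finally show "norm ((1/t) *\<^sub>R itg (x - t) x g - g x) \<le> e'" using t by simp
    qed
    also have "itg 0 b (\<lambda>x. norm ((1/t) *\<^sub>R itg (x - t) x G - (1/t) *\<^sub>R itg (x - t) x g))
        \<le> itg 0 b (\<lambda>x. (1/t) *\<^sub>R itg (x - t) x (\<lambda>s. norm (G s - g s)))"
    proof (intro itg_mono iable_norm 1)
      show "iable 0 b (\<lambda>x. (1/t) *\<^sub>R itg (x - t) x (\<lambda>s. norm (G s - g s)))"
        by (rule set_integrable_scaleR_right, rule iable_continuous, rule iable_average)
           (use t d iable_sub[OF iable_norm[OF Gg], of "0 - t" b] in auto)
      fix x assume x: "0 \<le> x" "x \<le> b"
      have "(1/t) *\<^sub>R itg (x - t) x G - (1/t) *\<^sub>R itg (x - t) x g = (1/t) *\<^sub>R itg (x - t) x (\<lambda>s. G s - g s)"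
        unfolding scaleR_diff_right[symmetric]
        by (subst set_integral_diff(2)) (use x t d in \<open>auto intro: iable_sub[OF gi] iable_sub[OF G]\<close>)
      then show "norm ((1/t) *\<^sub>R itg (x - t) x G - (1/t) *\<^sub>R itg (x - t) x g) \<le> (1/t) *\<^sub>R itg (x - t) x (\<lambda>s. norm (G s - g s))"
        using t x d itg_norm_le[OF iable_sub[OF Gg], of "x - t" x] by (simp add: divide_simps)
    qed
    also have "\<dots> = (1/t) * itg 0 b (\<lambda>x. itg (x - t) x (\<lambda>s. norm (G s - g s)))" by simp
    also have "\<dots> \<le> (1/t) * (t * itg (-1) b (\<lambda>s. norm (G s - g s)))"
      using t d by (intro mult_left_mono itg_window_le iable_norm Gg b) auto
    also have "\<dots> = itg (-1) b (\<lambda>s. norm (G s - g s))" using t by simp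
    also have "itg 0 b (\<lambda>x. norm (g x - G x)) \<le> itg (-1) b (\<lambda>x. norm (G x - g x))"
      using itg_mono_sub[OF iable_norm[OF Gg], of 0 b] by (simp add: norm_minus_commute)
    finally have "itg 0 b (\<lambda>x. norm ((1/t) *\<^sub>R itg (x - t) x G - G x)) < 3 * e' + b * e'"
      using g(2) e' b by (simp add: itg_const)
    also have "\<dots> = e' * (3 + b)" by (simp add: algebra_simps)
    also have "\<dots> = e" using b by (simp add: e'_def)
    finally show ?thesis using itg_nonneg[of 0 b "\<lambda>x. norm ((1/t) *\<^sub>R itg (x - t) x G - G x)"] by (simp add: dist_norm)
  qed
  then show "\<forall>\<^sub>F t in at_right 0. dist (itg 0 b (\<lambda>x. norm ((1/t) *\<^sub>R itg (x - t) x G - G x))) 0 < e"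
    using d(1) unfolding eventually_at_right_field by auto
qed

text \<open>Integration by parts for primitives. The right-hand side is an integral over the square
  of side \<open>x\<close>; the two terms on the left are its integrals over the triangles on either
  side of the diagonal.\<close>

lemma itg_triangle_swap:
  fixes p q :: "real \<Rightarrow> complex"
  assumes p: "iable 0 x p" and q: "iable 0 x q"
  shows "itg 0 x (\<lambda>t. p t * itg 0 t q) + itg 0 x (\<lambda>t. itg 0 t p * q t) = itg 0 x p * itg 0 x q"
proof -
  define P Q where "P = (\<lambda>t. indicator {0..x} t *\<^sub>R p t)" and "Q = (\<lambda>t. indicator {0..x} t *\<^sub>R q t)"
  have Pi: "integrable lborel P" and Qi: "integrable lborel Q"
    using p q by (simp_all add: P_def Q_def set_integrable_def)
  have [measurable]: "P \<in> borel_measurable borel" "Q \<in> borel_measurable borel"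
    using Pi Qi by (auto dest: borel_measurable_integrable)
  have PQ: "integrable (lborel \<Otimes>\<^sub>M lborel) (\<lambda>(t, s). P t * Q s)"
  proof (rule lborel_pair.Fubini_integrable)
    show "integrable lborel (\<lambda>t. \<integral>s. norm (case (t, s) of (t, s) \<Rightarrow> P t * Q s) \<partial>lborel)"
      using Pi by (simp add: norm_mult)
    show "AE t in lborel. integrable lborel (\<lambda>s. case (t, s) of (t, s) \<Rightarrow> P t * Q s)"
      using Qi by simp
  qed simp
  define R where "R t s = indicator {s..} t *\<^sub>R (P t * Q s)" for t s
  have Rm: "(\<lambda>(t, s). R t s) \<in> borel_measurable (lborel \<Otimes>\<^sub>M lborel)"
    unfolding R_def indicator_def atLeast_iff by measurable
  have Ri: "integrable (lborel \<Otimes>\<^sub>M lborel) (case_prod R)"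
    by (rule Bochner_Integration.integrable_bound[OF PQ Rm]) (auto simp: R_def indicator_def)
  define R' where "R' t s = indicator {t..} s *\<^sub>R (P t * Q s)" for t s
  have Rm': "(\<lambda>(t, s). R' t s) \<in> borel_measurable (lborel \<Otimes>\<^sub>M lborel)"
    unfolding R'_def indicator_def atLeast_iff by measurable
  have Ri': "integrable (lborel \<Otimes>\<^sub>M lborel) (case_prod R')"
    by (rule Bochner_Integration.integrable_bound[OF PQ Rm']) (auto simp: R'_def indicator_def)
  have 1: "itg 0 x (\<lambda>t. p t * itg 0 t q) = (\<integral>t. (\<integral>s. R t s \<partial>lborel) \<partial>lborel)"
  proof -
    have "indicator {0..x} t *\<^sub>R (p t * itg 0 t q) = (\<integral>s. R t s \<partial>lborel)" for t
    proof -
      have "(\<lambda>s. R t s) = (\<lambda>s. P t * (indicator {0..t} s *\<^sub>R q s))"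
        by (auto simp: R_def P_def Q_def indicator_def fun_eq_iff)
      then have "(\<integral>s. R t s \<partial>lborel) = P t * itg 0 t q"
        unfolding set_lebesgue_integral_def by (simp only: integral_mult_right_zero)
      then show ?thesis by (simp add: P_def)
    qed
    then show ?thesis by (subst set_lebesgue_integral_def) simp
  qed
  have 2: "itg 0 x (\<lambda>t. itg 0 t p * q t) = (\<integral>s. (\<integral>t. R' t s \<partial>lborel) \<partial>lborel)"
  proof -
    have "indicator {0..x} s *\<^sub>R (itg 0 s p * q s) = (\<integral>t. R' t s \<partial>lborel)" for s
    proof -
      have "(\<lambda>t. R' t s) = (\<lambda>t. (indicator {0..s} t *\<^sub>R p t) * Q s)"
        by (auto simp: R'_def P_def Q_def indicator_def fun_eq_iff)
      then have "(\<integral>t. R' t s \<partial>lborel) = itg 0 s p * Q s"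
        unfolding set_lebesgue_integral_def by (simp only: integral_mult_left_zero)
      then show ?thesis by (simp add: Q_def)
    qed
    then show ?thesis by (subst set_lebesgue_integral_def) simp
  qed
  have 3: "(\<integral>s. (\<integral>t. R' t s \<partial>lborel) \<partial>lborel) = (\<integral>t. (\<integral>s. R' t s \<partial>lborel) \<partial>lborel)"
    by (rule lborel_pair.Fubini_integral[OF Ri'])
  have "(\<integral>t. (\<integral>s. R t s \<partial>lborel) \<partial>lborel) + (\<integral>t. (\<integral>s. R' t s \<partial>lborel) \<partial>lborel)
      = (\<integral>z. case_prod R z \<partial>(lborel \<Otimes>\<^sub>M lborel)) + (\<integral>z. case_prod R' z \<partial>(lborel \<Otimes>\<^sub>M lborel))"
    using lborel_pair.integral_fst[OF Ri] lborel_pair.integral_fst[OF Ri'] by simp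
  also have "\<dots> = (\<integral>z. case_prod R z + case_prod R' z \<partial>(lborel \<Otimes>\<^sub>M lborel))"
    by (rule Bochner_Integration.integral_add[symmetric, OF Ri Ri'])
  also have "\<dots> = (\<integral>z. (case z of (t, s) \<Rightarrow> R t s + R' t s) \<partial>(lborel \<Otimes>\<^sub>M lborel))"
    by (intro Bochner_Integration.integral_cong refl) auto
  also have "\<dots> = (\<integral>t. (\<integral>s. R t s + R' t s \<partial>lborel) \<partial>lborel)"
  proof (rule lborel_pair.integral_fst[symmetric])
    have "case_prod (\<lambda>t s. R t s + R' t s) = (\<lambda>z. case_prod R z + case_prod R' z)" by auto
    then show "integrable (lborel \<Otimes>\<^sub>M lborel) (case_prod (\<lambda>t s. R t s + R' t s))"
      using Bochner_Integration.integrable_add[OF Ri Ri'] by simp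
  qed
  also have "\<dots> = (\<integral>t. P t * (\<integral>s. Q s \<partial>lborel) \<partial>lborel)"
  proof (intro Bochner_Integration.integral_cong refl)
    fix t
    \<comment> \<open>For fixed \<open>t\<close> the two triangles overlap only at
      \<open>s = t\<close>, a single point.\<close>
    have "(\<integral>s. R t s + R' t s \<partial>lborel) = (\<integral>s. P t * Q s \<partial>lborel)"
    proof (rule integral_discrete_difference[where X="{t}"])
      show "R t s + R' t s = P t * Q s" if "s \<in> space lborel" "s \<notin> {t}" for s
        using that by (auto simp: R_def R'_def indicator_def)
    qed auto
    then show "(\<integral>s. R t s + R' t s \<partial>lborel) = P t * (\<integral>s. Q s \<partial>lborel)" by simp
  qed
  also have "\<dots> = (\<integral>t. P t \<partial>lborel) * (\<integral>s. Q s \<partial>lborel)" by simp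
  also have "\<dots> = itg 0 x p * itg 0 x q" by (simp only: set_lebesgue_integral_def P_def Q_def)
  finally have fin: "(\<integral>t. (\<integral>s. R t s \<partial>lborel) \<partial>lborel) + (\<integral>t. (\<integral>s. R' t s \<partial>lborel) \<partial>lborel) = itg 0 x p * itg 0 x q" .
  show ?thesis unfolding 1 2 3 by (rule fin)
qed

lemma iable_mult_continuous:
  fixes p V :: "real \<Rightarrow> complex"
  assumes p: "iable a b p" and V: "continuous_on {a..b} V"
  shows "iable a b (\<lambda>t. p t * V t)"
proof -
  obtain C where C: "\<And>x. x \<in> {a..b} \<Longrightarrow> norm (V x) \<le> C"
    using compact_imp_bounded[OF compact_continuous_image[OF V compact_Icc]] unfolding bounded_iff by (meson imageI)
  have 1: "integrable lborel (\<lambda>x. C *\<^sub>R (indicator {a..b} x *\<^sub>R p x))"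
    using p unfolding set_integrable_def by (rule integrable_scaleR_right)
  have pm: "(\<lambda>x. indicator {a..b} x *\<^sub>R p x) \<in> borel_measurable lborel"
    using p by (auto simp: set_integrable_def dest: borel_measurable_integrable)
  have vm: "(\<lambda>x. indicator {a..b} x *\<^sub>R V x) \<in> borel_measurable lborel"
    using iable_continuous[OF V] by (auto simp: set_integrable_def dest: borel_measurable_integrable)
  have eq: "(\<lambda>x. indicator {a..b} x *\<^sub>R (p x * V x)) = (\<lambda>x. (indicator {a..b} x *\<^sub>R p x) * (indicator {a..b} x *\<^sub>R V x))"
    by (auto simp: indicator_def)
  show ?thesis
    unfolding set_integrable_def
  proof (rule Bochner_Integration.integrable_bound[OF 1])
    show "(\<lambda>x. indicator {a..b} x *\<^sub>R (p x * V x)) \<in> borel_measurable lborel"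
      unfolding eq using pm vm by (rule borel_measurable_times)
    show "AE x in lborel. norm (indicator {a..b} x *\<^sub>R (p x * V x)) \<le> norm (C *\<^sub>R (indicator {a..b} x *\<^sub>R p x))"
    proof (rule AE_I2)
      fix x
      show "norm (indicator {a..b} x *\<^sub>R (p x * V x)) \<le> norm (C *\<^sub>R (indicator {a..b} x *\<^sub>R p x))"
        using C[of x] norm_ge_zero[of "V x"]
        by (auto simp: indicator_def norm_mult mult.commute[of "norm (p x)"] intro!: mult_right_mono)
    qed
  qed
qed

text \<open>Product rule for absolutely continuous functions: after expansion around the initial
  values, the linear terms integrate directly and the other two are the triangles of
  \<open>itg_triangle_swap\<close>.\<close>

lemma AC_mult:
  fixes p q U V :: "real \<Rightarrow> complex"
  assumes p: "iable 0 b p" and q: "iable 0 b q"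
    and U: "\<And>x. x \<in> {0..b} \<Longrightarrow> U x = U 0 + itg 0 x p"
    and V: "\<And>x. x \<in> {0..b} \<Longrightarrow> V x = V 0 + itg 0 x q"
    and x: "x \<in> {0..b}"
  shows "U x * V x = U 0 * V 0 + itg 0 x (\<lambda>t. p t * V t + U t * q t)"
proof -
  have p': "iable 0 x p" and q': "iable 0 x q" using x p q by (auto intro: iable_sub)
  have i1: "iable 0 x (\<lambda>t. p t * itg 0 t q)"
    by (rule iable_mult_continuous[OF p' itg_continuous_on[OF q']])
  have i2: "iable 0 x (\<lambda>t. itg 0 t p * q t)"
    using iable_mult_continuous[OF q' itg_continuous_on[OF p']] by (simp add: mult.commute)
  have "itg 0 x (\<lambda>t. p t * V t + U t * q t) = itg 0 x (\<lambda>t. (V 0 * p t + U 0 * q t) + (p t * itg 0 t q + itg 0 t p * q t))"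
  proof (rule itg_cong)
    fix t assume "0 \<le> t" "t \<le> x"
    then have t: "t \<in> {0..b}" using x by auto
    show "p t * V t + U t * q t = (V 0 * p t + U 0 * q t) + (p t * itg 0 t q + itg 0 t p * q t)"
      unfolding U[OF t] V[OF t] by (simp add: algebra_simps)
  qed
  also have "\<dots> = (V 0 * itg 0 x p + U 0 * itg 0 x q) + (itg 0 x (\<lambda>t. p t * itg 0 t q) + itg 0 x (\<lambda>t. itg 0 t p * q t))"
    using p' q' i1 i2 by (simp add: set_integral_add)
  also have "\<dots> = (V 0 * itg 0 x p + U 0 * itg 0 x q) + itg 0 x p * itg 0 x q"
    by (simp add: itg_triangle_swap[OF p' q'])
  finally show ?thesis unfolding U[OF x] V[OF x] by (simp add: algebra_simps)
qed

section \<open>The space and the graph of the operator\<close>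

text \<open>The boundary condition describes the extended profiles only at negative arguments,
  whereas the intervals of integration are closed. This removes the exceptional endpoint 0.\<close>

lemma iable_spike:
  assumes "\<And>x. a \<le> x \<Longrightarrow> x \<le> b \<Longrightarrow> x \<noteq> c \<Longrightarrow> G x = H x"
  shows "iable a b G \<longleftrightarrow> iable a b H"
  unfolding set_integrable_def
  by (rule integrable_discrete_difference[where X="{c}"]) (use assms in \<open>auto simp: indicator_def\<close>)

lemma itg_spike:
  assumes "\<And>x. a \<le> x \<Longrightarrow> x \<le> b \<Longrightarrow> x \<noteq> c \<Longrightarrow> G x = H x"
  shows "itg a b G = itg a b H"
  unfolding set_lebesgue_integral_def
  by (rule integral_discrete_difference[where X="{c}"]) (use assms in \<open>auto simp: indicator_def\<close>)

lemma iable_cut: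
  assumes "iable 0 m G"
  shows "iable a b (\<lambda>y. if 0 \<le> y \<and> y \<le> m then G y else 0)"
proof -
  have "(\<lambda>y. indicator {0..m} y *\<^sub>R G y) = (\<lambda>y. if 0 \<le> y \<and> y \<le> m then G y else 0)"
    by (auto simp: indicator_def)
  with assms have "integrable lborel (\<lambda>y. if 0 \<le> y \<and> y \<le> m then G y else 0)"
    by (simp add: set_integrable_def)
  then show ?thesis unfolding set_integrable_def by (rule integrable_mult_indicator[rotated]) simp
qed

lemma c_vlin [simp]:
  "c1 (vlin a f b g) x = a * c1 f x + b * c1 g x"
  "c2 (vlin a f b g) x = a * c2 f x + b * c2 g x"
  "c3 (vlin a f b g) x = a * c3 f x + b * c3 g x"
  by (simp_all add: vlin_def c1_def c2_def c3_def)

lemma c_vlin_fun: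
  "c1 (vlin a f b g) = (\<lambda>x. a * c1 f x + b * c1 g x)"
  "c2 (vlin a f b g) = (\<lambda>x. a * c2 f x + b * c2 g x)"
  "c3 (vlin a f b g) = (\<lambda>x. a * c3 f x + b * c3 g x)"
  by auto

lemma c_vsub [simp]:
  "c1 (vsub f g) x = c1 f x - c1 g x"
  "c2 (vsub f g) x = c2 f x - c2 g x"
  "c3 (vsub f g) x = c3 f x - c3 g x"
  by (simp_all add: vsub_def)

lemma c_vscale [simp]:
  "c1 (vscale c f) x = c * c1 f x"
  "c2 (vscale c f) x = c * c2 f x"
  "c3 (vscale c f) x = c * c3 f x"
  by (simp_all add: vscale_def)

lemma c_triple [simp]: "c1 (f, g, h) = f" "c2 (f, g, h) = g" "c3 (f, g, h) = h"
  by (simp_all add: c1_def c2_def c3_def)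

lemma vec_eqI:
  "(\<And>x. c1 f x = c1 g x) \<Longrightarrow> (\<And>x. c2 f x = c2 g x) \<Longrightarrow> (\<And>x. c3 f x = c3 g x) \<Longrightarrow> f = g"
  unfolding c1_def c2_def c3_def by (intro prod_eqI ext)

lemma inE_vlin: "inE l f \<Longrightarrow> inE l g \<Longrightarrow> inE l (vlin a f b g)"
proof -
  assume *: "inE l f" "inE l g"
  show ?thesis
    using * unfolding inE_def c_vlin_fun by (intro conjI set_integral_add set_integrable_mult_right; simp)
qed

lemma inE_vsub [intro]: "inE l f \<Longrightarrow> inE l g \<Longrightarrow> inE l (vsub f g)"
  unfolding vsub_def by (rule inE_vlin)

lemma inE_vscale [intro]: "inE l f \<Longrightarrow> inE l (vscale c f)"
  unfolding vscale_def by (rule inE_vlin)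

lemma nrm_nonneg: "0 \<le> nrm l f"
  unfolding nrm_def by (intro add_nonneg_nonneg itg_nonneg) auto

lemma nrm_vscale: "nrm l (vscale c f) = cmod c * nrm l f"
  unfolding nrm_def by (simp add: norm_mult algebra_simps)

lemma nrm_vsub_commute: "nrm l (vsub f g) = nrm l (vsub g f)"
  unfolding nrm_def by (simp add: norm_minus_commute)

lemma nrm_triangle:
  assumes "inE l f" "inE l g" "inE l h"
  shows "nrm l (vsub f h) \<le> nrm l (vsub f g) + nrm l (vsub g h)"
proof -
  have "itg 0 1 (\<lambda>x. cmod (c1 f x - c1 h x)) \<le> itg 0 1 (\<lambda>x. cmod (c1 f x - c1 g x)) + itg 0 1 (\<lambda>x. cmod (c1 g x - c1 h x))"
    using assms by (intro itg_norm_triangle set_integral_diff) (auto simp: inE_def)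
  moreover have "itg 0 1 (\<lambda>x. cmod (c2 f x - c2 h x)) \<le> itg 0 1 (\<lambda>x. cmod (c2 f x - c2 g x)) + itg 0 1 (\<lambda>x. cmod (c2 g x - c2 h x))"
    using assms by (intro itg_norm_triangle set_integral_diff) (auto simp: inE_def)
  moreover have "itg 0 l (\<lambda>x. cmod (c3 f x - c3 h x)) \<le> itg 0 l (\<lambda>x. cmod (c3 f x - c3 g x)) + itg 0 l (\<lambda>x. cmod (c3 g x - c3 h x))"
    using assms by (intro itg_norm_triangle set_integral_diff) (auto simp: inE_def)
  ultimately show ?thesis by (simp add: nrm_def)
qed

lemma inE_vzero [simp]: "inE l vzero"
  by (simp add: inE_def vzero_def)

lemma nrm_vzero [simp]: "nrm l vzero = 0"
  by (simp add: nrm_def vzero_def)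

lemma vsub_vzero [simp]: "vsub f vzero = f"
  by (rule vec_eqI) (simp_all add: vzero_def)

lemma nrm_triangle2:
  assumes "inE l f" "inE l g"
  shows "nrm l f \<le> nrm l (vsub f g) + nrm l g"
  using nrm_triangle[OF assms inE_vzero] by simp

lemma nrm_cong:
  assumes "\<And>x. 0 \<le> x \<Longrightarrow> x \<le> 1 \<Longrightarrow> c1 f x = c1 g x" "\<And>x. 0 \<le> x \<Longrightarrow> x \<le> 1 \<Longrightarrow> c2 f x = c2 g x"
    "\<And>x. 0 \<le> x \<Longrightarrow> x \<le> l \<Longrightarrow> c3 f x = c3 g x"
  shows "nrm l f = nrm l g"
  unfolding nrm_def
  by (intro arg_cong2[where f="(+)"] itg_cong) (use assms in auto)

lemma inE_cong:
  assumes "\<And>x. 0 \<le> x \<Longrightarrow> x \<le> 1 \<Longrightarrow> c1 f x = c1 g x" "\<And>x. 0 \<le> x \<Longrightarrow> x \<le> 1 \<Longrightarrow> c2 f x = c2 g x"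
    "\<And>x. 0 \<le> x \<Longrightarrow> x \<le> l \<Longrightarrow> c3 f x = c3 g x"
  shows "inE l f \<longleftrightarrow> inE l g"
  unfolding inE_def
  by (intro arg_cong2[where f="(\<and>)"] iable_cong) (use assms in auto)

text \<open>Equality in the space. For integrable vectors it amounts to distance 0, but it can be
  composed edgewise without integrability assumptions.\<close>

definition aeq :: "real \<Rightarrow> vec \<Rightarrow> vec \<Rightarrow> bool" where
  "aeq l f g \<longleftrightarrow> (AE x in lborel. x \<in> {0..1} \<longrightarrow> c1 f x = c1 g x) \<and>
     (AE x in lborel. x \<in> {0..1} \<longrightarrow> c2 f x = c2 g x) \<and> (AE x in lborel. x \<in> {0..l} \<longrightarrow> c3 f x = c3 g x)"

lemma aeq_refl [simp]: "aeq l f f"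
  by (simp add: aeq_def)

lemma aeq_sym: "aeq l f g \<Longrightarrow> aeq l g f"
  by (simp add: aeq_def eq_commute[of "c1 f _"] eq_commute[of "c2 f _"] eq_commute[of "c3 f _"])

lemma aeq_trans:
  assumes "aeq l f g" "aeq l g h"
  shows "aeq l f h"
proof -
  have 1: "AE x in lborel. x \<in> {0..1} \<longrightarrow> c1 f x = c1 g x" "AE x in lborel. x \<in> {0..1} \<longrightarrow> c1 g x = c1 h x"
   and 2: "AE x in lborel. x \<in> {0..1} \<longrightarrow> c2 f x = c2 g x" "AE x in lborel. x \<in> {0..1} \<longrightarrow> c2 g x = c2 h x"
   and 3: "AE x in lborel. x \<in> {0..l} \<longrightarrow> c3 f x = c3 g x" "AE x in lborel. x \<in> {0..l} \<longrightarrow> c3 g x = c3 h x"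
    using assms by (simp_all only: aeq_def)
  show ?thesis
    unfolding aeq_def using eventually_elim2[OF 1] eventually_elim2[OF 2] eventually_elim2[OF 3] by simp
qed

lemma aeq_vlin:
  assumes "aeq l f f'" "aeq l g g'"
  shows "aeq l (vlin a f b g) (vlin a f' b g')"
proof -
  have 1: "AE x in lborel. x \<in> {0..1} \<longrightarrow> c1 f x = c1 f' x" "AE x in lborel. x \<in> {0..1} \<longrightarrow> c1 g x = c1 g' x"
   and 2: "AE x in lborel. x \<in> {0..1} \<longrightarrow> c2 f x = c2 f' x" "AE x in lborel. x \<in> {0..1} \<longrightarrow> c2 g x = c2 g' x"
   and 3: "AE x in lborel. x \<in> {0..l} \<longrightarrow> c3 f x = c3 f' x" "AE x in lborel. x \<in> {0..l} \<longrightarrow> c3 g x = c3 g' x"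
    using assms by (simp_all only: aeq_def)
  show ?thesis
    unfolding aeq_def using eventually_elim2[OF 1] eventually_elim2[OF 2] eventually_elim2[OF 3] by simp
qed

lemma nrm_vsub_eq_0: "inE l f \<Longrightarrow> inE l g \<Longrightarrow> nrm l (vsub f g) = 0 \<longleftrightarrow> aeq l f g"
proof -
  assume *: "inE l f" "inE l g"
  have 1: "itg 0 1 (\<lambda>x. cmod (c1 f x - c1 g x)) = 0 \<longleftrightarrow> (AE x in lborel. x \<in> {0..1} \<longrightarrow> c1 f x - c1 g x = 0)"
    by (rule itg_norm_eq_0) (use * in \<open>auto simp: inE_def intro!: set_integral_diff\<close>)
  have 2: "itg 0 1 (\<lambda>x. cmod (c2 f x - c2 g x)) = 0 \<longleftrightarrow> (AE x in lborel. x \<in> {0..1} \<longrightarrow> c2 f x - c2 g x = 0)"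
    by (rule itg_norm_eq_0) (use * in \<open>auto simp: inE_def intro!: set_integral_diff\<close>)
  have 3: "itg 0 l (\<lambda>x. cmod (c3 f x - c3 g x)) = 0 \<longleftrightarrow> (AE x in lborel. x \<in> {0..l} \<longrightarrow> c3 f x - c3 g x = 0)"
    by (rule itg_norm_eq_0) (use * in \<open>auto simp: inE_def intro!: set_integral_diff\<close>)
  have nn: "0 \<le> itg 0 1 (\<lambda>x. cmod (c1 f x - c1 g x))" "0 \<le> itg 0 1 (\<lambda>x. cmod (c2 f x - c2 g x))"
    "0 \<le> itg 0 l (\<lambda>x. cmod (c3 f x - c3 g x))" by (intro itg_nonneg; simp)+
  have "nrm l (vsub f g) = 0 \<longleftrightarrow> itg 0 1 (\<lambda>x. cmod (c1 f x - c1 g x)) = 0 \<and> itg 0 1 (\<lambda>x. cmod (c2 f x - c2 g x)) = 0 \<and> itg 0 l (\<lambda>x. cmod (c3 f x - c3 g x)) = 0"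
    using nn by (auto simp: nrm_def)
  also have "\<dots> \<longleftrightarrow> aeq l f g" unfolding 1 2 3 aeq_def by simp
  finally show ?thesis .
qed

lemma nrm_aeq: "inE l f \<Longrightarrow> inE l g \<Longrightarrow> aeq l f g \<Longrightarrow> nrm l f = nrm l g"
  using nrm_vsub_eq_0[of l f g] nrm_triangle2[of l f g] nrm_triangle2[of l g f] nrm_vsub_commute[of l f g] by linarith

lemma nrm_vsub_aeq:
  assumes "inE l f" "inE l f'" "inE l g" "inE l g'" "aeq l f f'" "aeq l g g'"
  shows "nrm l (vsub f g) = nrm l (vsub f' g')"
  by (rule nrm_aeq) (use assms in \<open>auto simp: vsub_def intro!: aeq_vlin inE_vlin\<close>)

text \<open>The graph of the operator, with the derivative eliminated: the continuous representatives are
  antiderivatives of the negatives of the components of the image.\<close>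

definition AC :: "real \<Rightarrow> (real \<Rightarrow> complex) \<Rightarrow> (real \<Rightarrow> complex) \<Rightarrow> bool" where
  "AC b u h \<longleftrightarrow> (\<forall>x\<in>{0..b}. u x = u 0 - itg 0 x h)"

lemma ACD: "AC b u h \<Longrightarrow> 0 \<le> x \<Longrightarrow> x \<le> b \<Longrightarrow> u x = u 0 - itg 0 x h"
  unfolding AC_def by (metis atLeastAtMost_iff)

definition bc :: "real \<Rightarrow> vec \<Rightarrow> bool" where
  "bc l u \<longleftrightarrow> c2 u 0 = 1/2 * c2 u 1 + 1/2 * c3 u l - 1/3 * c1 u 1 \<and>
     c3 u 0 = 1/2 * c2 u 1 + 1/2 * c3 u l + 2/3 * c1 u 1 \<and> c1 u 0 = 0"

definition regular :: "real \<Rightarrow> vec \<Rightarrow> vec \<Rightarrow> bool" where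
  "regular l u h \<longleftrightarrow> AC 1 (c1 u) (c1 h) \<and> AC 1 (c2 u) (c2 h) \<and> AC l (c3 u) (c3 h) \<and> bc l u"

lemma AC_continuous: "AC b u h \<Longrightarrow> iable 0 b h \<Longrightarrow> continuous_on {0..b} u"
proof -
  assume *: "AC b u h" "iable 0 b h"
  have "continuous_on {0..b} (\<lambda>x. u 0 - itg 0 x h)"
    by (intro continuous_intros itg_continuous_on *)
  then show ?thesis
  proof (rule continuous_on_eq)
    fix x assume "x \<in> {0..b}"
    then show "u 0 - itg 0 x h = u x" using ACD[OF *(1), of x] by (simp only: atLeastAtMost_iff)
  qed
qed

lemma regular_inE: "regular l u h \<Longrightarrow> inE l h \<Longrightarrow> inE l u"
  unfolding regular_def inE_def
  by (elim conjE, intro conjI; rule iable_continuous, rule AC_continuous; assumption)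

text \<open>Almost everywhere \<open>h\<close> is the negative of the weak derivative, so
  \<open>-h\<close> can serve as the derivative itself, and the three continuous representatives are
  collected in one vector \<open>u\<close>.\<close>

lemma graphA_iff: "(f, h) \<in> graphA l \<longleftrightarrow> inE l f \<and> inE l h \<and> (\<exists>u. regular l u h \<and> aeq l f u)"
proof safe
  assume "(f, h) \<in> graphA l"
  then obtain u1 u2 u3 g1 g2 g3 where E: "inE l f" "inE l h" and
    r: "ac_rep 0 1 (c1 f) u1 g1" "ac_rep 0 1 (c2 f) u2 g2" "ac_rep 0 l (c3 f) u3 g3" and
    bcs: "u2 0 = 1/2 * u2 1 + 1/2 * u3 l - 1/3 * u1 1"
        "u3 0 = 1/2 * u2 1 + 1/2 * u3 l + 2/3 * u1 1" "u1 0 = 0" and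
    ae: "AE x in lborel. x \<in> {0..1} \<longrightarrow> c1 h x = - g1 x" "AE x in lborel. x \<in> {0..1} \<longrightarrow> c2 h x = - g2 x"
        "AE x in lborel. x \<in> {0..l} \<longrightarrow> c3 h x = - g3 x"
    unfolding graphA_def mem_Collect_eq case_prod_conv by (elim conjE exE) (rule that)
  show "inE l f" "inE l h" by (rule E)+
  have ac: "AC b u k" if "ac_rep 0 b q u g" "AE x in lborel. x \<in> {0..b} \<longrightarrow> k x = - g x" "iable 0 b k" for b q u g k
    unfolding AC_def
  proof
    fix x assume x: "x \<in> {0..b}"
    have "itg 0 x k = itg 0 x (\<lambda>x. - g x)"
    proof (rule itg_cong_AE')
      show "iable 0 x k" by (rule iable_sub[OF that(3)]) (use x in auto)
      have "iable 0 b g" using that(1) by (simp add: ac_rep_def)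
      then have "iable 0 x g" by (rule iable_sub) (use x in auto)
      then show "iable 0 x (\<lambda>x. - g x)" using set_integrable_mult_right[of "-1" lborel "{0..x}" g] by simp
      show "AE y in lborel. y \<in> {0..x} \<longrightarrow> k y = - g y" using that(2) by eventually_elim (use x in auto)
    qed
    also have "\<dots> = - itg 0 x g" using set_integral_mult_right[of lborel "{0..x}" "-1" g] by simp
    finally have k: "itg 0 x k = - itg 0 x g" .
    have "u x = u 0 + itg 0 x g" using that(1) x unfolding ac_rep_def by blast
    then show "u x = u 0 - itg 0 x k" unfolding k by simp
  qed
  show "\<exists>u. regular l u h \<and> aeq l f u"
    using ac[OF r(1) ae(1)] ac[OF r(2) ae(2)] ac[OF r(3) ae(3)] E r bcs
    by (intro exI[of _ "(u1, u2, u3)"]) (auto simp only: regular_def bc_def aeq_def inE_def ac_rep_def c_triple)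
next
  fix u assume E: "inE l f" "inE l h" and u: "regular l u h" "aeq l f u"
  have rep: "ac_rep 0 b q v (\<lambda>x. - k x)" if "AC b v k" "iable 0 b k" "AE x in lborel. x \<in> {0..b} \<longrightarrow> q x = v x" for b q v k
    unfolding ac_rep_def
  proof (intro conjI ballI)
    show "iable 0 b (\<lambda>x. - k x)" using set_integrable_mult_right[of "-1" lborel "{0..b}" k] that by simp
    show "v x = v 0 + itg 0 x (\<lambda>t. - k t)" if "x \<in> {0..b}" for x
      using ACD[OF \<open>AC b v k\<close>, of x] that set_integral_mult_right[of lborel "{0..x}" "-1" k] by simp
  qed fact
  show "(f, h) \<in> graphA l"
    unfolding graphA_def mem_Collect_eq case_prod_conv
  proof (intro conjI E exI)
    show "ac_rep 0 1 (c1 f) (c1 u) (\<lambda>x. - c1 h x)" by (rule rep) (use E u in \<open>auto simp: regular_def inE_def aeq_def\<close>)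
    show "ac_rep 0 1 (c2 f) (c2 u) (\<lambda>x. - c2 h x)" by (rule rep) (use E u in \<open>auto simp: regular_def inE_def aeq_def\<close>)
    show "ac_rep 0 l (c3 f) (c3 u) (\<lambda>x. - c3 h x)" by (rule rep) (use E u in \<open>auto simp: regular_def inE_def aeq_def\<close>)
  qed (use u in \<open>auto simp: regular_def bc_def\<close>)
qed

lemma AC_lin:
  assumes "AC r u h" "AC r v k" "iable 0 r h" "iable 0 r k"
  shows "AC r (\<lambda>x. a * u x + b * v x) (\<lambda>x. a * h x + b * k x)"
  unfolding AC_def
proof
  fix x assume x: "x \<in> {0..r}"
  have "iable 0 x h" "iable 0 x k" using assms x by (auto intro: iable_sub)
  then have 1: "itg 0 x (\<lambda>x. a * h x + b * k x) = a * itg 0 x h + b * itg 0 x k" by (simp add: set_integral_add)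
  have 2: "u x = u 0 - itg 0 x h" "v x = v 0 - itg 0 x k" using ACD[OF assms(1), of x] ACD[OF assms(2), of x] x by auto
  show "a * u x + b * v x = a * u 0 + b * v 0 - itg 0 x (\<lambda>x. a * h x + b * k x)"
    unfolding 1 2 by (simp add: algebra_simps)
qed

lemma regular_lin:
  assumes "regular l u h" "regular l v k" "inE l h" "inE l k"
  shows "regular l (vlin a u b v) (vlin a h b k)"
proof -
  have "bc l (vlin a u b v)"
  proof -
    have u: "c2 u 0 = 1/2 * c2 u 1 + 1/2 * c3 u l - 1/3 * c1 u 1" "c3 u 0 = 1/2 * c2 u 1 + 1/2 * c3 u l + 2/3 * c1 u 1" "c1 u 0 = 0"
      and v: "c2 v 0 = 1/2 * c2 v 1 + 1/2 * c3 v l - 1/3 * c1 v 1" "c3 v 0 = 1/2 * c2 v 1 + 1/2 * c3 v l + 2/3 * c1 v 1" "c1 v 0 = 0"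
      using assms by (simp_all only: regular_def bc_def)
    show ?thesis unfolding bc_def c_vlin by (simp only: u v) (simp add: algebra_simps)
  qed
  moreover have "AC 1 (c1 (vlin a u b v)) (c1 (vlin a h b k))"
    using AC_lin[of 1 "c1 u" "c1 h" "c1 v" "c1 k" a b] assms
    unfolding regular_def inE_def c_vlin_fun by blast
  moreover have "AC 1 (c2 (vlin a u b v)) (c2 (vlin a h b k))"
    using AC_lin[of 1 "c2 u" "c2 h" "c2 v" "c2 k" a b] assms
    unfolding regular_def inE_def c_vlin_fun by blast
  moreover have "AC l (c3 (vlin a u b v)) (c3 (vlin a h b k))"
    using AC_lin[of l "c3 u" "c3 h" "c3 v" "c3 k" a b] assms
    unfolding regular_def inE_def c_vlin_fun by blast
  ultimately show ?thesis unfolding regular_def by blast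
qed

lemma graphA_lin:
  assumes "(f, h) \<in> graphA l" "(g, k) \<in> graphA l"
  shows "(vlin a f b g, vlin a h b k) \<in> graphA l"
proof -
  obtain u v where u: "regular l u h" "aeq l f u" "inE l f" "inE l h" and v: "regular l v k" "aeq l g v" "inE l g" "inE l k"
    using assms unfolding graphA_iff by blast
  show ?thesis
    unfolding graphA_iff using regular_lin[OF u(1) v(1) u(4) v(4)] aeq_vlin[OF u(2) v(2)] u v by (blast intro: inE_vlin)
qed

lemma AC_aeq:
  assumes "AC r u h" "iable 0 r h" "iable 0 r k" "AE x in lborel. x \<in> {0..r} \<longrightarrow> h x = k x"
  shows "AC r u k"
  unfolding AC_def
proof
  fix x assume x: "x \<in> {0..r}"
  have "itg 0 x h = itg 0 x k"
  proof (rule itg_cong_AE')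
    show "iable 0 x h" "iable 0 x k" using assms x by (auto intro: iable_sub)
    show "AE y in lborel. y \<in> {0..x} \<longrightarrow> h y = k y" using assms(4) by eventually_elim (use x in auto)
  qed
  then show "u x = u 0 - itg 0 x k" using ACD[OF assms(1), of x] x by simp
qed

lemma regular_aeq: "regular l u h \<Longrightarrow> aeq l h k \<Longrightarrow> inE l h \<Longrightarrow> inE l k \<Longrightarrow> regular l u k"
  unfolding regular_def inE_def aeq_def by (elim conjE, intro conjI; (rule AC_aeq; assumption)?) assumption

lemma graphA_aeq:
  assumes "(f, h) \<in> graphA l" "aeq l f f'" "aeq l h h'" "inE l f'" "inE l h'"
  shows "(f', h') \<in> graphA l"
proof -
  obtain u where u: "regular l u h" "aeq l f u" "inE l h"
    using assms unfolding graphA_iff by blast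
  show ?thesis
    unfolding graphA_iff using regular_aeq[OF u(1) assms(3) u(3) assms(5)] aeq_trans[OF aeq_sym[OF assms(2)] u(2)] assms by blast
qed

lemma graphA_inE: "(f, h) \<in> graphA l \<Longrightarrow> inE l f" "(f, h) \<in> graphA l \<Longrightarrow> inE l h"
  by (auto simp: graphA_iff)

lemma graphA_eq_arg:
  assumes "(f, h) \<in> graphA l" "nrm l (vsub f f') = 0" "nrm l (vsub h h') = 0" "inE l f'" "inE l h'"
  shows "(f', h') \<in> graphA l"
proof (rule graphA_aeq[OF assms(1) _ _ assms(4,5)])
  note E = graphA_inE[OF assms(1)]
  show "aeq l f f'" using nrm_vsub_eq_0[OF E(1) assms(4)] assms(2) by blast
  show "aeq l h h'" using nrm_vsub_eq_0[OF E(2) assms(5)] assms(3) by blast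
qed

section \<open>The semigroup\<close>

text \<open>The boundary condition at the initial vertex is 0, so nothing enters this edge. The
  value 0 beyond the end makes the profile integrable over every interval.\<close>

definition e1 :: "vec \<Rightarrow> real \<Rightarrow> complex" where
  "e1 f y = (if 0 \<le> y \<and> y \<le> 1 then c1 f y else 0)"

text \<open>A joint recursion, since each loop is fed by both. The value at \<open>y < 0\<close> is
  what enters the loops at time \<open>-y\<close>; at that time the data from \<open>y + 1\<close>
  and \<open>y + l\<close> arrive at the ends of the edges. The test \<open>l \<le> 0\<close>
  secures termination for every \<open>l\<close>, and the zeros beyond the ends keep the profiles
  integrable everywhere.\<close>

function ext :: "real \<Rightarrow> vec \<Rightarrow> real \<Rightarrow> complex \<times> complex" where
  "ext l f y = (if 0 \<le> y \<or> l \<le> 0 then (if y \<le> 1 then c2 f y else 0, if y \<le> l then c3 f y else 0)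
     else let s = 1/2 * fst (ext l f (y + 1)) + 1/2 * snd (ext l f (y + l))
          in (s - 1/3 * e1 f (y + 1), s + 2/3 * e1 f (y + 1)))"
  by auto

text \<open>The termination measure counts the steps of length \<open>min 1 l\<close> that separate
  the argument from 0; each call moves right by at least one such step.\<close>

lemma level_less:
  fixes y l r :: real
  assumes "y < 0" "l > 0" "min 1 l \<le> r"
  shows "nat \<lceil>- (y + r) / min 1 l\<rceil> < nat \<lceil>- y / min 1 l\<rceil>"
proof -
  have d: "min 1 l > 0" using assms by auto
  have "- (y + r) / min 1 l \<le> - y / min 1 l - 1"
    using assms d by (simp add: field_simps)
  then have "\<lceil>- (y + r) / min 1 l\<rceil> \<le> \<lceil>- y / min 1 l - 1\<rceil>" by (rule ceiling_mono)
  moreover have "- y / min 1 l > 0" using assms d by (simp add: divide_neg_pos)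
  ultimately show ?thesis by linarith
qed

termination ext
  by (relation "Wellfounded.measure (\<lambda>(l, f, y). nat \<lceil>- y / min 1 l\<rceil>)")
     (simp only: in_measure case_prod_conv wf_measure, (rule level_less; simp; fail)?)+

declare ext.simps [simp del]

locale network =
  fixes l :: real
  assumes l_pos: "l > 0"
begin

abbreviation dst :: "vec \<Rightarrow> vec \<Rightarrow> real" where
  "dst f g \<equiv> nrm l (vsub f g)"

abbreviation dquot :: "real \<Rightarrow> vec \<Rightarrow> vec \<Rightarrow> vec" where
  "dquot t g f \<equiv> vscale (of_real (1 / t)) (vsub g f)"

definition "e2 f y = fst (ext l f y)"
definition "e3 f y = snd (ext l f y)"

lemma e1_base: "0 \<le> y \<Longrightarrow> y \<le> 1 \<Longrightarrow> e1 f y = c1 f y" by (simp add: e1_def)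
lemma e2_base: "0 \<le> y \<Longrightarrow> y \<le> 1 \<Longrightarrow> e2 f y = c2 f y" by (simp add: e2_def ext.simps)
lemma e3_base: "0 \<le> y \<Longrightarrow> y \<le> l \<Longrightarrow> e3 f y = c3 f y" by (simp add: e3_def ext.simps)
lemma e1_neg: "y < 0 \<Longrightarrow> e1 f y = 0" by (simp add: e1_def)

lemma e2_neg: "y < 0 \<Longrightarrow> e2 f y = 1/2 * e2 f (y + 1) + 1/2 * e3 f (y + l) - 1/3 * e1 f (y + 1)"
  using l_pos unfolding e2_def e3_def by (subst ext.simps) (simp add: Let_def)

lemma e3_neg: "y < 0 \<Longrightarrow> e3 f y = 1/2 * e2 f (y + 1) + 1/2 * e3 f (y + l) + 2/3 * e1 f (y + 1)"
  using l_pos unfolding e2_def e3_def by (subst ext.simps) (simp add: Let_def)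

lemma back_induct:
  assumes "\<And>y. 0 \<le> y \<Longrightarrow> P y" "\<And>y. y < 0 \<Longrightarrow> P (y + 1) \<Longrightarrow> P (y + l) \<Longrightarrow> P y"
  shows "P (y::real)"
proof (induction "nat \<lceil>- y / min 1 l\<rceil>" arbitrary: y rule: less_induct)
  case less
  show ?case
  proof (cases "0 \<le> y")
    case False
    then have y: "y < 0" by simp
    show ?thesis
      by (rule assms(2)[OF y]) (rule less, rule level_less, use y l_pos in auto)+
  qed (rule assms(1))
qed

text \<open>The source of all identities for extended profiles: a candidate only has to carry the
  data and obey the recursion. The conclusions stop at the ends of the edges because
  \<open>ext\<close> is 0 beyond them, while candidates such as translates are not.\<close>

lemma ext_unique:
  assumes 1: "\<And>y. 0 \<le> y \<Longrightarrow> y \<le> 1 \<Longrightarrow> G1 y = c1 f y" "\<And>y. y < 0 \<Longrightarrow> G1 y = 0"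
    and 2: "\<And>y. 0 \<le> y \<Longrightarrow> y \<le> 1 \<Longrightarrow> G2 y = c2 f y"
      "\<And>y. y < 0 \<Longrightarrow> G2 y = 1/2 * G2 (y + 1) + 1/2 * G3 (y + l) - 1/3 * G1 (y + 1)"
    and 3: "\<And>y. 0 \<le> y \<Longrightarrow> y \<le> l \<Longrightarrow> G3 y = c3 f y"
      "\<And>y. y < 0 \<Longrightarrow> G3 y = 1/2 * G2 (y + 1) + 1/2 * G3 (y + l) + 2/3 * G1 (y + 1)"
  shows "y \<le> 1 \<Longrightarrow> e1 f y = G1 y" "y \<le> 1 \<Longrightarrow> e2 f y = G2 y" "y \<le> l \<Longrightarrow> e3 f y = G3 y"
proof -
  show A: "e1 f y = G1 y" if "y \<le> 1" for y
    using that 1 by (cases "0 \<le> y") (auto simp: e1_def)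
  have "(y \<le> 1 \<longrightarrow> e2 f y = G2 y) \<and> (y \<le> l \<longrightarrow> e3 f y = G3 y)" for y
  proof (induction y rule: back_induct)
    case (1 y)
    then show ?case using 2 3 by (auto simp: e2_base e3_base)
  next
    case (2 y)
    have "e2 f (y + 1) = G2 (y + 1)" "e3 f (y + l) = G3 (y + l)" "e1 f (y + 1) = G1 (y + 1)"
      using 2 A by auto
    then show ?case using 2(1) assms(4,6) by (auto simp: e2_neg e3_neg)
  qed
  then show "y \<le> 1 \<Longrightarrow> e2 f y = G2 y" "y \<le> l \<Longrightarrow> e3 f y = G3 y" by auto
qed

lemma iable_e1: "inE l f \<Longrightarrow> iable a b (e1 f)"
  unfolding e1_def[abs_def] by (rule iable_cut) (simp add: inE_def)

lemma iable_e23: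
  assumes f: "inE l f"
  shows "iable a b (e2 f)" "iable a b (e3 f)"
proof -
  define d where "d = min 1 l"
  have d: "d > 0" "d \<le> 1" "d \<le> l" using l_pos by (auto simp: d_def)
  \<comment> \<open>Each recursion step gains a strip of width \<open>d\<close> on the left. The
    right end stays arbitrary because the shifts by 1 and \<open>l\<close> reach beyond it.\<close>
  have n: "iable (- real n * d) b (e2 f) \<and> iable (- real n * d) b (e3 f)" for n b
  proof (induction n arbitrary: b)
    case 0
    have "iable 0 b (e2 f) \<longleftrightarrow> iable 0 b (\<lambda>y. if 0 \<le> y \<and> y \<le> 1 then c2 f y else 0)"
      by (rule iable_cong) (simp add: e2_def ext.simps)
    moreover have "iable 0 b (e3 f) \<longleftrightarrow> iable 0 b (\<lambda>y. if 0 \<le> y \<and> y \<le> l then c3 f y else 0)"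
      by (rule iable_cong) (simp add: e3_def ext.simps)
    ultimately show ?case using f by (simp add: iable_cut inE_def)
  next
    case (Suc n)
    let ?a = "- real (Suc n) * d"
    have sh2: "iable ?a 0 (\<lambda>y. e2 f (y + 1))"
      unfolding iable_shift by (rule iable_sub[OF conjunct1[OF Suc, of 1]]) (use d in \<open>auto simp: algebra_simps\<close>)
    have sh3: "iable ?a 0 (\<lambda>y. e3 f (y + l))"
      unfolding iable_shift by (rule iable_sub[OF conjunct2[OF Suc, of l]]) (use d in \<open>auto simp: algebra_simps\<close>)
    have sh1: "iable ?a 0 (\<lambda>y. e1 f (y + 1))"
      unfolding iable_shift by (rule iable_e1[OF f])
    have "iable ?a 0 (e2 f) \<longleftrightarrow> iable ?a 0 (\<lambda>y. 1/2 * e2 f (y + 1) + 1/2 * e3 f (y + l) - 1/3 * e1 f (y + 1))"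
      by (rule iable_spike[of _ _ 0]) (simp add: e2_neg)
    then have "iable ?a 0 (e2 f)"
      by (simp only:) (intro set_integral_add set_integral_diff set_integrable_mult_right sh1 sh2 sh3)
    moreover have "iable ?a 0 (e3 f) \<longleftrightarrow> iable ?a 0 (\<lambda>y. 1/2 * e2 f (y + 1) + 1/2 * e3 f (y + l) + 2/3 * e1 f (y + 1))"
      by (rule iable_spike[of _ _ 0]) (simp add: e3_neg)
    then have "iable ?a 0 (e3 f)"
      by (simp only:) (intro set_integral_add set_integral_diff set_integrable_mult_right sh1 sh2 sh3)
    moreover have "iable 0 b (e2 f)" "iable 0 b (e3 f)"
      using Suc[of b] d by (auto elim: iable_sub)
    ultimately show ?case by (auto intro: iable_combine)
  qed
  obtain n :: nat where "- a / d \<le> real n" using real_arch_simple by blast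
  then have "- real n * d \<le> a" using d by (simp add: field_simps)
  then show "iable a b (e2 f)" "iable a b (e3 f)" using n[of n b] by (auto elim: iable_sub)
qed

lemmas iable_e = iable_e1 iable_e23

definition S :: "real \<Rightarrow> vec \<Rightarrow> vec" where
  "S t f = ((\<lambda>x. e1 f (x - t)), (\<lambda>x. e2 f (x - t)), (\<lambda>x. e3 f (x - t)))"

lemma c_S [simp]: "c1 (S t f) x = e1 f (x - t)" "c2 (S t f) x = e2 f (x - t)" "c3 (S t f) x = e3 f (x - t)"
  by (simp_all add: S_def)

lemma inE_S: "inE l f \<Longrightarrow> inE l (S t f)"
proof -
  assume f: "inE l f"
  have sh: "iable a b (\<lambda>x. G (x - t))" if "\<And>a b. iable a b G" for G :: "real \<Rightarrow> complex" and a b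
    using that iable_shift[of a b G "-t"] by simp
  show ?thesis unfolding inE_def S_def c_triple by (intro conjI sh iable_e f)
qed

text \<open>If \<open>y\<close> is negative then so is \<open>y - s\<close>, so translated profiles
  obey the recursion again. This is the semigroup law.\<close>

lemma e_S:
  assumes "0 \<le> s"
  shows "y \<le> 1 \<Longrightarrow> e1 (S s f) y = e1 f (y - s)" "y \<le> 1 \<Longrightarrow> e2 (S s f) y = e2 f (y - s)" "y \<le> l \<Longrightarrow> e3 (S s f) y = e3 f (y - s)"
proof -
  have "y + 1 - s = y - s + 1" "y + l - s = y - s + l" for y by auto
  note * = this
  show "y \<le> 1 \<Longrightarrow> e1 (S s f) y = e1 f (y - s)" "y \<le> 1 \<Longrightarrow> e2 (S s f) y = e2 f (y - s)" "y \<le> l \<Longrightarrow> e3 (S s f) y = e3 f (y - s)"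
    by (rule ext_unique[where ?G1.0="\<lambda>y. e1 f (y - s)" and ?G2.0="\<lambda>y. e2 f (y - s)" and ?G3.0="\<lambda>y. e3 f (y - s)"];
      use assms in \<open>simp add: e1_neg e2_neg e3_neg *\<close>)+
qed

lemma S_add:
  assumes "0 \<le> t" "0 \<le> s"
  shows "dst (S (t + s) f) (S t (S s f)) = 0"
proof -
  have "dst (S (t + s) f) (S t (S s f)) = nrm l vzero"
    by (rule nrm_cong) (use assms in \<open>auto simp: e_S vzero_def algebra_simps\<close>)
  then show ?thesis by simp
qed

lemma S_0: "dst (S 0 f) f = 0"
proof -
  have "dst (S 0 f) f = nrm l vzero"
    by (rule nrm_cong) (auto simp: e1_base e2_base e3_base vzero_def)
  then show ?thesis by simp
qed

lemma e_lin:
  shows "y \<le> 1 \<Longrightarrow> e1 (vlin a f b g) y = a * e1 f y + b * e1 g y"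
    "y \<le> 1 \<Longrightarrow> e2 (vlin a f b g) y = a * e2 f y + b * e2 g y" "y \<le> l \<Longrightarrow> e3 (vlin a f b g) y = a * e3 f y + b * e3 g y"
  by (rule ext_unique[where ?G1.0="\<lambda>y. a * e1 f y + b * e1 g y" and ?G2.0="\<lambda>y. a * e2 f y + b * e2 g y"
    and ?G3.0="\<lambda>y. a * e3 f y + b * e3 g y"];
    (simp add: e1_base e2_base e3_base e1_neg e2_neg e3_neg; fail | simp add: e2_neg e3_neg algebra_simps))+

lemma S_lin:
  assumes "0 \<le> t"
  shows "dst (S t (vlin a f b g)) (vlin a (S t f) b (S t g)) = 0"
proof -
  have "dst (S t (vlin a f b g)) (vlin a (S t f) b (S t g)) = nrm l vzero"
    by (rule nrm_cong) (use assms in \<open>auto simp: e_lin vzero_def\<close>)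
  then show ?thesis by simp
qed

lemma S_sub_nrm:
  assumes "0 \<le> t"
  shows "nrm l (S t (vsub f g)) = dst (S t f) (S t g)"
  unfolding vsub_def by (rule nrm_cong) (use assms in \<open>auto simp: e_lin\<close>)

text \<open>The integral over the interval from \<open>-t\<close> to \<open>b\<close> is split at 0
  and at \<open>b - t\<close>. Read as a balance on an edge of length \<open>b\<close>: inflow plus
  initial content minus outflow.\<close>

lemma itg_slide:
  fixes G :: "real \<Rightarrow> 'a::{banach, second_countable_topology}"
  assumes "\<And>a b. iable a b G" "0 \<le> t" "0 \<le> b"
  shows "itg 0 b (\<lambda>x. G (x - t)) = itg (-t) 0 G + itg 0 b G - itg (-t) 0 (\<lambda>x. G (x + b))"
proof -
  have "itg 0 b (\<lambda>x. G (x - t)) = itg (-t) (b - t) G" using itg_shift[of 0 b G "-t"] by simp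
  moreover have "itg (-t) 0 (\<lambda>x. G (x + b)) = itg (b - t) b G" using itg_shift[of "-t" 0 G b] by simp
  moreover have "itg (-t) b G = itg (-t) 0 G + itg 0 b G" by (rule itg_combine) (use assms in auto)
  moreover have "itg (-t) b G = itg (-t) (b - t) G + itg (b - t) b G" by (rule itg_combine) (use assms in auto)
  ultimately show ?thesis by (simp add: algebra_simps)
qed

text \<open>What leaves the edges through their endpoints during a time span re-enters through the
  boundary condition: in modulus at most as much (the columns of the boundary matrix have
  absolute sums 1), and with weights 1/3, 1, 1 exactly as much.\<close>

lemma S_contractive:
  assumes f: "inE l f" and t: "0 \<le> t"
  shows "nrm l (S t f) \<le> nrm l f"
proof -
  note ii = iable_norm[OF iable_e1[OF f]] iable_norm[OF iable_e23(1)[OF f]] iable_norm[OF iable_e23(2)[OF f]]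
  let ?N = "\<lambda>b G. itg (-t) 0 (\<lambda>x. cmod (G (x + b)))"
  have sh: "iable (-t) 0 (\<lambda>x. cmod (e1 f (x + 1)))" "iable (-t) 0 (\<lambda>x. cmod (e2 f (x + 1)))" "iable (-t) 0 (\<lambda>x. cmod (e3 f (x + l)))"
    unfolding iable_shift[of _ _ "\<lambda>x. cmod (_ x)"] by (rule ii)+
  have "itg (-t) 0 (\<lambda>x. cmod (e1 f x)) = itg (-t) 0 (\<lambda>x. 0)"
    by (rule itg_spike[of _ _ 0]) (simp add: e1_neg)
  then have z: "itg (-t) 0 (\<lambda>x. cmod (e1 f x)) = 0" by simp
  have "itg (-t) 0 (\<lambda>x. cmod (e2 f x)) + itg (-t) 0 (\<lambda>x. cmod (e3 f x)) = itg (-t) 0 (\<lambda>x. cmod (e2 f x) + cmod (e3 f x))"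
    by (rule set_integral_add(2)[symmetric]) (rule ii)+
  \<comment> \<open>At 0 the profiles show the initial data instead of the boundary condition, so
    the pointwise estimate may fail there.\<close>
  also have "\<dots> = itg (-t) 0 (\<lambda>x. if x = 0 then 0 else cmod (e2 f x) + cmod (e3 f x))"
    by (rule itg_spike[of _ _ 0]) simp
  also have "\<dots> \<le> itg (-t) 0 (\<lambda>x. cmod (e1 f (x + 1)) + cmod (e2 f (x + 1)) + cmod (e3 f (x + l)))"
  proof (rule itg_mono)
    have "iable (-t) 0 (\<lambda>x. cmod (e2 f x) + cmod (e3 f x))" by (intro set_integral_add ii)
    then show "iable (-t) 0 (\<lambda>x. if x = 0 then 0 else cmod (e2 f x) + cmod (e3 f x))"
      by (subst iable_spike[of _ _ 0, where H="\<lambda>x. cmod (e2 f x) + cmod (e3 f x)"]) auto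
    show "iable (-t) 0 (\<lambda>x. cmod (e1 f (x + 1)) + cmod (e2 f (x + 1)) + cmod (e3 f (x + l)))"
      by (intro set_integral_add sh)
    fix x assume x: "- t \<le> x" "x \<le> 0"
    show "(if x = 0 then 0 else cmod (e2 f x) + cmod (e3 f x)) \<le> cmod (e1 f (x + 1)) + cmod (e2 f (x + 1)) + cmod (e3 f (x + l))"
    proof (cases "x = 0")
      case False
      then have "x < 0" using x by simp
      let ?s = "1/2 * e2 f (x + 1) + 1/2 * e3 f (x + l)"
      have "cmod ?s \<le> cmod (1/2 * e2 f (x + 1)) + cmod (1/2 * e3 f (x + l))" by (rule norm_triangle_ineq)
      then have s: "cmod ?s \<le> 1/2 * cmod (e2 f (x + 1)) + 1/2 * cmod (e3 f (x + l))" by (simp only: norm_mult) simp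
      have "cmod (e2 f x) \<le> cmod ?s + cmod (1/3 * e1 f (x + 1))" unfolding e2_neg[OF \<open>x < 0\<close>] by (rule norm_triangle_ineq4)
      moreover have "cmod (e3 f x) \<le> cmod ?s + cmod (2/3 * e1 f (x + 1))" unfolding e3_neg[OF \<open>x < 0\<close>] by (rule norm_triangle_ineq)
      ultimately show ?thesis using s False by (simp only: norm_mult) simp
    qed simp
  qed
  also have "\<dots> = ?N 1 (e1 f) + ?N 1 (e2 f) + ?N l (e3 f)"
    by (subst set_integral_add(2), (intro set_integral_add sh)+)+ simp
  finally have key: "itg (-t) 0 (\<lambda>x. cmod (e2 f x)) + itg (-t) 0 (\<lambda>x. cmod (e3 f x)) \<le> ?N 1 (e1 f) + ?N 1 (e2 f) + ?N l (e3 f)" .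
  have "nrm l (S t f) = itg 0 1 (\<lambda>x. cmod (e1 f (x - t))) + itg 0 1 (\<lambda>x. cmod (e2 f (x - t))) + itg 0 l (\<lambda>x. cmod (e3 f (x - t)))"
    by (simp add: nrm_def)
  also have "\<dots> \<le> itg 0 1 (\<lambda>x. cmod (e1 f x)) + itg 0 1 (\<lambda>x. cmod (e2 f x)) + itg 0 l (\<lambda>x. cmod (e3 f x))"
    using itg_slide[OF ii(1) t, of 1] itg_slide[OF ii(2) t, of 1] itg_slide[OF ii(3) t, of l] z key l_pos by simp
  also have "\<dots> = nrm l f"
    unfolding nrm_def by (intro arg_cong2[where f="(+)"] itg_cong) (auto simp: e1_base e2_base e3_base)
  finally show ?thesis .
qed

text \<open>The weights are the column sums of the boundary matrix: -1/3 + 2/3 for the first edge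
  and 1/2 + 1/2 for each loop.\<close>

definition mass :: "vec \<Rightarrow> complex" where
  "mass f = 1/3 * itg 0 1 (c1 f) + itg 0 1 (c2 f) + itg 0 l (c3 f)"

lemma mass_S:
  assumes f: "inE l f" and t: "0 \<le> t"
  shows "mass (S t f) = mass f"
proof -
  note ii = iable_e1[OF f] iable_e23(1)[OF f] iable_e23(2)[OF f]
  let ?N = "\<lambda>b G. itg (-t) 0 (\<lambda>x. G (x + b))"
  have sh: "iable (-t) 0 (\<lambda>x. e1 f (x + 1))" "iable (-t) 0 (\<lambda>x. e2 f (x + 1))" "iable (-t) 0 (\<lambda>x. e3 f (x + l))"
    unfolding iable_shift by (rule ii)+
  have "itg (-t) 0 (e1 f) = itg (-t) 0 (\<lambda>x. 0)"
    by (rule itg_spike[of _ _ 0]) (simp add: e1_neg)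
  then have z: "itg (-t) 0 (e1 f) = 0" by simp
  have "itg (-t) 0 (e2 f) + itg (-t) 0 (e3 f) = itg (-t) 0 (\<lambda>x. e2 f x + e3 f x)"
    by (rule set_integral_add(2)[symmetric]) (rule ii)+
  also have "\<dots> = itg (-t) 0 (\<lambda>x. 1/3 * e1 f (x + 1) + e2 f (x + 1) + e3 f (x + l))"
    by (rule itg_spike[of _ _ 0]) (simp add: e2_neg e3_neg algebra_simps)
  also have "\<dots> = 1/3 * ?N 1 (e1 f) + ?N 1 (e2 f) + ?N l (e3 f)"
    by (subst set_integral_add(2), (intro set_integral_add set_integrable_mult_right sh)+)+ simp
  finally have key: "itg (-t) 0 (e2 f) + itg (-t) 0 (e3 f) = 1/3 * ?N 1 (e1 f) + ?N 1 (e2 f) + ?N l (e3 f)" .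
  have "mass (S t f) = 1/3 * itg 0 1 (\<lambda>x. e1 f (x - t)) + itg 0 1 (\<lambda>x. e2 f (x - t)) + itg 0 l (\<lambda>x. e3 f (x - t))"
    by (simp add: mass_def S_def)
  also have "\<dots> = 1/3 * itg 0 1 (e1 f) + itg 0 1 (e2 f) + itg 0 l (e3 f) + (itg (-t) 0 (e2 f) + itg (-t) 0 (e3 f) - (1/3 * ?N 1 (e1 f) + ?N 1 (e2 f) + ?N l (e3 f)))"
    using itg_slide[OF ii(1) t, of 1] itg_slide[OF ii(2) t, of 1] itg_slide[OF ii(3) t, of l] z l_pos
    by (simp only: order_less_imp_le zero_le_one simp_thms) (simp add: algebra_simps)
  also have "\<dots> = 1/3 * itg 0 1 (e1 f) + itg 0 1 (e2 f) + itg 0 l (e3 f)" unfolding key by simp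
  also have "\<dots> = mass f"
    unfolding mass_def by (intro arg_cong2[where f="(+)"] arg_cong2[where f="(*)"] refl itg_cong) (auto simp: e1_base e2_base e3_base)
  finally show ?thesis .
qed

lemma S_continuous:
  assumes f: "inE l f"
  shows "((\<lambda>t. dst (S t f) f) \<longlongrightarrow> 0) (at_right 0)"
proof -
  have "((\<lambda>t. itg 0 1 (\<lambda>x. cmod (e1 f (x - t) - e1 f x)) + itg 0 1 (\<lambda>x. cmod (e2 f (x - t) - e2 f x))
     + itg 0 l (\<lambda>x. cmod (e3 f (x - t) - e3 f x))) \<longlongrightarrow> 0 + 0 + 0) (at_right 0)"
    using l_pos by (intro tendsto_add L1_translation iable_e f) auto
  moreover have "dst (S t f) f = itg 0 1 (\<lambda>x. cmod (e1 f (x - t) - e1 f x)) + itg 0 1 (\<lambda>x. cmod (e2 f (x - t) - e2 f x))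
     + itg 0 l (\<lambda>x. cmod (e3 f (x - t) - e3 f x))" for t
    unfolding nrm_def by (intro arg_cong2[where f="(+)"] itg_cong) (auto simp: e1_base e2_base e3_base)
  ultimately show ?thesis by simp
qed

text \<open>For a vector in the domain the boundary condition is exactly continuity of the extended
  profiles at 0 (with value 0 on the first edge), and the recursion is linear, so it passes to the
  derivatives. The restriction on \<open>y\<close> keeps \<open>y + 1\<close> and
  \<open>y + l\<close> on the edges, so a single recursion step suffices.\<close>

lemma regular_ext:
  assumes u: "regular l u g" and g: "inE l g" and y: "y < 0" "- min 1 l \<le> y"
  shows "e1 u y = c1 u 0 + itg y 0 (e1 g)" "e2 u y = c2 u 0 + itg y 0 (e2 g)" "e3 u y = c3 u 0 + itg y 0 (e3 g)"
proof -
  have y': "0 \<le> y + 1" "0 \<le> y + l" "y + 1 \<le> 1" "y + l \<le> l" using y by auto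
  note ii = iable_e1[OF g] iable_e23(1)[OF g] iable_e23(2)[OF g]
  \<comment> \<open>Integrates backwards from the end of an edge, whose value enters the boundary
    condition.\<close>
  have end_rep: "v (y + b) = v b + itg y 0 (\<lambda>s. E (s + b))" if "AC b v h" "0 \<le> y + b" "\<And>x. 0 \<le> x \<Longrightarrow> x \<le> b \<Longrightarrow> E x = h x" "iable 0 b h" for v h E b
  proof -
    have "itg 0 b h = itg 0 (y + b) h + itg (y + b) b h"
      by (rule itg_combine) (use that y in auto)
    moreover have "itg y 0 (\<lambda>s. E (s + b)) = itg (y + b) b h"
      unfolding itg_shift using that y by (auto intro!: itg_cong)
    moreover have "v (y + b) = v 0 - itg 0 (y + b) h" "v b = v 0 - itg 0 b h"
      using ACD[OF that(1), of "y + b"] ACD[OF that(1), of b] that y by auto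
    ultimately show ?thesis by simp
  qed
  have r1: "c1 u (y + 1) = c1 u 1 + itg y 0 (\<lambda>s. e1 g (s + 1))"
    by (rule end_rep[of 1 _ "c1 g"]) (use u g y' in \<open>auto simp: regular_def inE_def e1_base\<close>)
  have r2: "c2 u (y + 1) = c2 u 1 + itg y 0 (\<lambda>s. e2 g (s + 1))"
    by (rule end_rep[of 1 _ "c2 g"]) (use u g y' in \<open>auto simp: regular_def inE_def e2_base\<close>)
  have r3: "c3 u (y + l) = c3 u l + itg y 0 (\<lambda>s. e3 g (s + l))"
    by (rule end_rep[of l _ "c3 g"]) (use u g y' in \<open>auto simp: regular_def inE_def e3_base\<close>)
  have "itg y 0 (e1 g) = itg y 0 (\<lambda>x. 0)"
    by (rule itg_spike[of _ _ 0]) (simp add: e1_neg)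
  then show "e1 u y = c1 u 0 + itg y 0 (e1 g)" using u y by (simp add: e1_neg regular_def bc_def)
  have sh: "iable y 0 (\<lambda>x. e1 g (x + 1))" "iable y 0 (\<lambda>x. e2 g (x + 1))" "iable y 0 (\<lambda>x. e3 g (x + l))"
    unfolding iable_shift by (rule ii)+
  have "itg y 0 (e2 g) = itg y 0 (\<lambda>x. 1/2 * e2 g (x + 1) + 1/2 * e3 g (x + l) - 1/3 * e1 g (x + 1))"
    by (rule itg_spike[of _ _ 0]) (simp add: e2_neg)
  also have "\<dots> = 1/2 * itg y 0 (\<lambda>s. e2 g (s + 1)) + 1/2 * itg y 0 (\<lambda>s. e3 g (s + l)) - 1/3 * itg y 0 (\<lambda>s. e1 g (s + 1))"
    by (subst set_integral_diff(2), (intro set_integral_add set_integrable_mult_right sh)+, subst set_integral_add(2), (intro set_integrable_mult_right sh)+) simp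
  finally have i2: "itg y 0 (e2 g) = 1/2 * itg y 0 (\<lambda>s. e2 g (s + 1)) + 1/2 * itg y 0 (\<lambda>s. e3 g (s + l)) - 1/3 * itg y 0 (\<lambda>s. e1 g (s + 1))" .
  have "itg y 0 (e3 g) = itg y 0 (\<lambda>x. 1/2 * e2 g (x + 1) + 1/2 * e3 g (x + l) + 2/3 * e1 g (x + 1))"
    by (rule itg_spike[of _ _ 0]) (simp add: e3_neg)
  also have "\<dots> = 1/2 * itg y 0 (\<lambda>s. e2 g (s + 1)) + 1/2 * itg y 0 (\<lambda>s. e3 g (s + l)) + 2/3 * itg y 0 (\<lambda>s. e1 g (s + 1))"
    by (subst set_integral_add(2), (intro set_integral_add set_integrable_mult_right sh)+, subst set_integral_add(2), (intro set_integrable_mult_right sh)+) simp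
  finally have i3: "itg y 0 (e3 g) = 1/2 * itg y 0 (\<lambda>s. e2 g (s + 1)) + 1/2 * itg y 0 (\<lambda>s. e3 g (s + l)) + 2/3 * itg y 0 (\<lambda>s. e1 g (s + 1))" .
  have b: "c2 u 0 = 1/2 * c2 u 1 + 1/2 * c3 u l - 1/3 * c1 u 1" "c3 u 0 = 1/2 * c2 u 1 + 1/2 * c3 u l + 2/3 * c1 u 1"
    using u by (auto simp: regular_def bc_def)
  show "e2 u y = c2 u 0 + itg y 0 (e2 g)"
    unfolding i2 b e2_neg[OF y(1)] e1_base[OF y'(1,3)] e2_base[OF y'(1,3)] e3_base[OF y'(2,4)] r1 r2 r3 by (simp add: algebra_simps)
  show "e3 u y = c3 u 0 + itg y 0 (e3 g)"
    unfolding i3 b e3_neg[OF y(1)] e1_base[OF y'(1,3)] e2_base[OF y'(1,3)] e3_base[OF y'(2,4)] r1 r2 r3 by (simp add: algebra_simps)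
qed

text \<open>Since \<open>H\<close> extends the negative derivative, moving back by \<open>t\<close>
  adds the integral of \<open>H\<close> over the window. If the window crosses 0, the representation
  left of 0 is joined to the one on the edge.\<close>

lemma increment_ext:
  assumes "AC b u h" "iable 0 b h" "\<And>a b. iable a b H" "\<And>x. 0 \<le> x \<Longrightarrow> x \<le> b \<Longrightarrow> H x = h x" "\<And>x. 0 \<le> x \<Longrightarrow> x \<le> b \<Longrightarrow> U x = u x"
    and neg: "\<And>y. y < 0 \<Longrightarrow> - min 1 l \<le> y \<Longrightarrow> U y = u 0 + itg y 0 H"
    and x: "0 \<le> x" "x \<le> b" and t: "0 \<le> t" "t \<le> min 1 l"
  shows "U (x - t) - u x = itg (x - t) x (H :: real \<Rightarrow> complex)"
proof -
  have A: "u z = u 0 - itg 0 z H" if "0 \<le> z" "z \<le> b" for z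
  proof -
    have "itg 0 z H = itg 0 z h" by (rule itg_cong) (use that assms(4) in auto)
    then show ?thesis using ACD[OF assms(1), of z] that by simp
  qed
  show ?thesis
  proof (cases "x - t < 0")
    case True
    have "U (x - t) = u 0 + itg (x - t) 0 H" by (rule neg) (use True x t in auto)
    moreover have "itg (x - t) x H = itg (x - t) 0 H + itg 0 x H" by (rule itg_combine) (use True x assms(3) in auto)
    ultimately show ?thesis using A[of x] x by simp
  next
    case False
    have "itg 0 x H = itg 0 (x - t) H + itg (x - t) x H" by (rule itg_combine) (use False t assms(3) in auto)
    then show ?thesis using A[of x] A[of "x - t"] assms(5)[of "x - t"] x t False by simp
  qed
qed

lemma generator_if:
  assumes "(f, g) \<in> graphA l"
  shows "((\<lambda>t. dst (dquot t (S t f) f) g) \<longlongrightarrow> 0) (at_right 0)"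
proof -
  obtain u where E: "inE l f" "inE l g" and u: "regular l u g" "aeq l f u"
    using assms by (auto simp: graphA_iff)
  have uE: "inE l u" using u(1) E(2) by (rule regular_inE)
  have lim: "((\<lambda>t. itg 0 1 (\<lambda>x. cmod ((1/t) *\<^sub>R itg (x - t) x (e1 g) - e1 g x)) + itg 0 1 (\<lambda>x. cmod ((1/t) *\<^sub>R itg (x - t) x (e2 g) - e2 g x))
     + itg 0 l (\<lambda>x. cmod ((1/t) *\<^sub>R itg (x - t) x (e3 g) - e3 g x))) \<longlongrightarrow> 0 + 0 + 0) (at_right 0)"
    using l_pos by (intro tendsto_add L1_average iable_e E) auto
  \<comment> \<open>For small \<open>t\<close> the difference quotient is exactly the backward
    average of the extension of \<open>g\<close>, so \<open>L1_average\<close> gives the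
    limit.\<close>
  have eq: "dst (dquot t (S t f) f) g = itg 0 1 (\<lambda>x. cmod ((1/t) *\<^sub>R itg (x - t) x (e1 g) - e1 g x))
      + itg 0 1 (\<lambda>x. cmod ((1/t) *\<^sub>R itg (x - t) x (e2 g) - e2 g x)) + itg 0 l (\<lambda>x. cmod ((1/t) *\<^sub>R itg (x - t) x (e3 g) - e3 g x))"
    if t: "0 < t" "t < min 1 l" for t
  proof -
    \<comment> \<open>\<open>increment_ext\<close> needs the continuous representative;
      contractivity shows that replacing \<open>f\<close> by \<open>u\<close> changes
      \<open>S t f\<close> only on a null set.\<close>
    have "dst (S t f) (S t u) = nrm l (S t (vsub f u))" using t by (simp add: S_sub_nrm)
    also have "\<dots> \<le> dst f u" by (rule S_contractive) (use t E uE in auto)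
    also have "\<dots> = 0" using u(2) E uE by (simp add: nrm_vsub_eq_0)
    finally have "aeq l (S t f) (S t u)"
      using nrm_nonneg[of l "vsub (S t f) (S t u)"] nrm_vsub_eq_0[of l "S t f" "S t u"] inE_S E uE by auto
    then have "aeq l (vsub (dquot t (S t f) f) g) (vsub (dquot t (S t u) u) g)"
      unfolding vsub_def vscale_def using u(2) by (intro aeq_vlin) auto
    then have "dst (dquot t (S t f) f) g = dst (dquot t (S t u) u) g"
      by (rule nrm_aeq[rotated 2]) (intro inE_vsub inE_vscale inE_S E uE)+
    also have "\<dots> = itg 0 1 (\<lambda>x. cmod ((1/t) *\<^sub>R itg (x - t) x (e1 g) - e1 g x))
      + itg 0 1 (\<lambda>x. cmod ((1/t) *\<^sub>R itg (x - t) x (e2 g) - e2 g x)) + itg 0 l (\<lambda>x. cmod ((1/t) *\<^sub>R itg (x - t) x (e3 g) - e3 g x))"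
      unfolding nrm_def
    proof (intro arg_cong2[where f="(+)"] itg_cong)
      fix x :: real assume x: "0 \<le> x" "x \<le> 1"
      have "e1 u (x - t) - c1 u x = itg (x - t) x (e1 g)"
        by (rule increment_ext[of 1 _ "c1 g"]) (use u E x t in \<open>auto simp: regular_def inE_def e1_base iable_e regular_ext(1)[OF u(1) E(2)]\<close>)
      then show "cmod (c1 (vsub (dquot t (S t u) u) g) x) = cmod ((1/t) *\<^sub>R itg (x - t) x (e1 g) - e1 g x)"
        using x by (simp add: e1_base scaleR_conv_of_real)
      have "e2 u (x - t) - c2 u x = itg (x - t) x (e2 g)"
        by (rule increment_ext[of 1 _ "c2 g"]) (use u E x t in \<open>auto simp: regular_def inE_def e2_base iable_e regular_ext(2)[OF u(1) E(2)]\<close>)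
      then show "cmod (c2 (vsub (dquot t (S t u) u) g) x) = cmod ((1/t) *\<^sub>R itg (x - t) x (e2 g) - e2 g x)"
        using x by (simp add: e2_base scaleR_conv_of_real)
    next
      fix x :: real assume x: "0 \<le> x" "x \<le> l"
      have "e3 u (x - t) - c3 u x = itg (x - t) x (e3 g)"
        by (rule increment_ext[of l _ "c3 g"]) (use u E x t in \<open>auto simp: regular_def inE_def e3_base iable_e regular_ext(3)[OF u(1) E(2)]\<close>)
      then show "cmod (c3 (vsub (dquot t (S t u) u) g) x) = cmod ((1/t) *\<^sub>R itg (x - t) x (e3 g) - e3 g x)"
        using x by (simp add: e3_base scaleR_conv_of_real)
    qed
    finally show ?thesis .
  qed
  have "\<forall>\<^sub>F t in at_right 0. itg 0 1 (\<lambda>x. cmod ((1/t) *\<^sub>R itg (x - t) x (e1 g) - e1 g x))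
      + itg 0 1 (\<lambda>x. cmod ((1/t) *\<^sub>R itg (x - t) x (e2 g) - e2 g x)) + itg 0 l (\<lambda>x. cmod ((1/t) *\<^sub>R itg (x - t) x (e3 g) - e3 g x))
      = dst (dquot t (S t f) f) g"
    unfolding eventually_at_right_field using l_pos eq by (intro exI[of _ "min 1 l"]) auto
  then show ?thesis using lim by (simp add: tendsto_cong)
qed

end

section \<open>Resolvent, spectrum and generator\<close>

lemma exp_antiderivative:
  fixes w :: complex
  assumes "0 \<le> x"
  shows "exp (w * of_real x) = exp (w * of_real 0) + itg 0 x (\<lambda>t. w * exp (w * of_real t))"
proof -
  have "((\<lambda>t. w * exp (w * of_real t)) has_integral (exp (w * of_real x) - exp (w * of_real 0))) {0..x}"
    by (rule fundamental_theorem_of_calculus[OF assms])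
       (auto intro!: derivative_eq_intros has_vector_derivative_real_field simp: )
  then have 1: "integral {0..x} (\<lambda>t. w * exp (w * of_real t)) = exp (w * of_real x) - exp (w * of_real 0)"
    by (rule integral_unique)
  have 2: "itg 0 x (\<lambda>t. w * exp (w * of_real t)) = integral {0..x} (\<lambda>t. w * exp (w * of_real t))"
    by (rule set_borel_integral_eq_integral, rule iable_continuous) (intro continuous_intros)
  show ?thesis unfolding 2 1 by simp
qed

definition mexp :: "complex \<Rightarrow> (real \<Rightarrow> complex) \<Rightarrow> real \<Rightarrow> complex" where
  "mexp z h x = itg 0 x (\<lambda>s. exp (z * of_real s) * h s)"

text \<open>Variation of constants for \<open>u' = h - z * u\<close> with initial value
  \<open>a\<close>.\<close>

definition sol :: "complex \<Rightarrow> complex \<Rightarrow> (real \<Rightarrow> complex) \<Rightarrow> real \<Rightarrow> complex" where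
  "sol z a h x = exp (- z * of_real x) * (a + mexp z h x)"

lemma iable_exp_mult: "iable 0 b (h :: real \<Rightarrow> complex) \<Longrightarrow> iable 0 b (\<lambda>s. exp (z * of_real s) * h s)"
proof -
  assume h: "iable 0 b h"
  have "iable 0 b (\<lambda>s. h s * exp (z * of_real s))"
    by (rule iable_mult_continuous[OF h]) (intro continuous_intros)
  then show ?thesis by (simp add: mult.commute)
qed

lemma mexp_0 [simp]: "mexp z h 0 = 0" by (simp only: mexp_def itg_point)

lemma sol_0 [simp]: "sol z a h 0 = a" by (simp add: sol_def)

lemma AC_sol:
  assumes h: "iable 0 b h"
  shows "AC b (sol z a h) (\<lambda>x. z * sol z a h x - h x)"
  unfolding AC_def
proof
  fix x assume x: "x \<in> {0..b}"
  have "exp (- z * of_real x) * (a + mexp z h x) = exp (- z * of_real 0) * (a + mexp z h 0)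
    + itg 0 x (\<lambda>t. (- z * exp (- z * of_real t)) * (a + mexp z h t) + exp (- z * of_real t) * (exp (z * of_real t) * h t))"
  proof (rule AC_mult[OF _ _ _ _ x])
    show "iable 0 b (\<lambda>t. - z * exp (- z * of_real t))" by (rule iable_continuous) (intro continuous_intros)
    show "iable 0 b (\<lambda>t. exp (z * of_real t) * h t)" by (rule iable_exp_mult[OF h])
    show "exp (- z * of_real x) = exp (- z * of_real 0) + itg 0 x (\<lambda>t. - z * exp (- z * of_real t))" if "x \<in> {0..b}" for x
      by (rule exp_antiderivative) (use that in simp)
    show "a + mexp z h x = a + mexp z h 0 + itg 0 x (\<lambda>t. exp (z * of_real t) * h t)" for x
      by (simp add: mexp_def[of z h x])
  qed
  also have "(\<lambda>t. (- z * exp (- z * of_real t)) * (a + mexp z h t) + exp (- z * of_real t) * (exp (z * of_real t) * h t))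
      = (\<lambda>t. - 1 * (z * sol z a h t - h t))"
    by (rule ext) (simp add: sol_def algebra_simps exp_minus)
  also have "itg 0 x (\<lambda>t. - 1 * (z * sol z a h t - h t)) = - 1 * itg 0 x (\<lambda>t. z * sol z a h t - h t)"
    by (rule set_integral_mult_right)
  finally show "sol z a h x = sol z a h 0 - itg 0 x (\<lambda>x. z * sol z a h x - h x)"
    by (simp only: sol_def[of z a h x] sol_0) simp
qed

text \<open>Multiplying by the integrating factor \<open>exp (z * x)\<close> leaves a function whose
  derivative is \<open>exp (z * x) * h x\<close>, by the product rule.\<close>

lemma AC_unique:
  assumes h: "iable 0 b h" and u: "AC b u (\<lambda>x. z * u x - h x)" "iable 0 b u" and x: "0 \<le> x" "x \<le> b"
  shows "u x = sol z (u 0) h x"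
proof -
  have x': "x \<in> {0..b}" using x by simp
  have q: "iable 0 b (\<lambda>t. - 1 * (z * u t - h t))"
    by (intro set_integrable_mult_right set_integral_diff h u)
  have "exp (z * of_real x) * u x = exp (z * of_real 0) * u 0
    + itg 0 x (\<lambda>t. (z * exp (z * of_real t)) * u t + exp (z * of_real t) * (- 1 * (z * u t - h t)))"
  proof (rule AC_mult[OF _ q _ _ x'])
    show "iable 0 b (\<lambda>t. z * exp (z * of_real t))" by (rule iable_continuous) (intro continuous_intros)
    show "exp (z * of_real x) = exp (z * of_real 0) + itg 0 x (\<lambda>t. z * exp (z * of_real t))" if "x \<in> {0..b}" for x
      by (rule exp_antiderivative) (use that in simp)
    show "u y = u 0 + itg 0 y (\<lambda>t. - 1 * (z * u t - h t))" if "y \<in> {0..b}" for y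
    proof -
      have "itg 0 y (\<lambda>t. - 1 * (z * u t - h t)) = - 1 * itg 0 y (\<lambda>t. z * u t - h t)" by (rule set_integral_mult_right)
      moreover have "u y = u 0 - itg 0 y (\<lambda>t. z * u t - h t)" using ACD[OF u(1), of y] that by (simp only: atLeastAtMost_iff)
      ultimately show ?thesis by (simp only:) simp
    qed
  qed
  also have "(\<lambda>t. (z * exp (z * of_real t)) * u t + exp (z * of_real t) * (- 1 * (z * u t - h t))) = (\<lambda>t. exp (z * of_real t) * h t)"
    by (rule ext) (simp add: algebra_simps)
  finally have "exp (z * of_real x) * u x = u 0 + mexp z h x" by (simp add: mexp_def)
  then have "exp (- z * of_real x) * (exp (z * of_real x) * u x) = sol z (u 0) h x" by (simp add: sol_def)
  moreover have "exp (- z * of_real x) * (exp (z * of_real x) * u x) = u x" by (simp add: exp_minus)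
  ultimately show ?thesis by simp
qed

lemma mexp_bound:
  assumes "iable 0 b h" "0 \<le> x" "x \<le> b"
  shows "cmod (mexp z h x) \<le> exp (cmod z * b) * itg 0 b (\<lambda>s. cmod (h s))"
proof -
  have i: "iable 0 b (\<lambda>s. exp (z * of_real s) * h s)" by (rule iable_exp_mult) fact
  have "cmod (mexp z h x) \<le> itg 0 x (\<lambda>s. cmod (exp (z * of_real s) * h s))"
    unfolding mexp_def by (rule itg_norm_le) (use assms in \<open>auto intro: iable_sub[OF i]\<close>)
  also have "\<dots> \<le> itg 0 b (\<lambda>s. cmod (exp (z * of_real s) * h s))"
    by (rule itg_mono_sub[OF iable_norm[OF i]]) (use assms in auto)
  also have "\<dots> \<le> itg 0 b (\<lambda>s. exp (cmod z * b) * cmod (h s))"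
  proof (rule itg_mono[OF iable_norm[OF i]])
    show "iable 0 b (\<lambda>s. exp (cmod z * b) * cmod (h s))" by (intro set_integrable_mult_right iable_norm assms)
    fix s assume s: "0 \<le> s" "s \<le> b"
    have "cmod (exp (z * of_real s)) \<le> exp (cmod (z * of_real s))" by (rule norm_exp)
    also have "\<dots> \<le> exp (cmod z * b)" using s by (simp add: norm_mult mult_left_mono)
    finally show "cmod (exp (z * of_real s) * h s) \<le> exp (cmod z * b) * cmod (h s)"
      unfolding norm_mult by (rule mult_right_mono) simp
  qed
  finally show ?thesis by simp
qed

lemma sol_bound:
  assumes "iable 0 b h" "0 \<le> x" "x \<le> b"
  shows "cmod (sol z a h x) \<le> exp (cmod z * b) * (cmod a + exp (cmod z * b) * itg 0 b (\<lambda>s. cmod (h s)))"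
proof -
  have "cmod (exp (- z * of_real x)) \<le> exp (cmod (- z * of_real x))" by (rule norm_exp)
  also have "\<dots> \<le> exp (cmod z * b)" using assms by (simp add: norm_mult mult_left_mono)
  finally have 1: "cmod (exp (- z * of_real x)) \<le> exp (cmod z * b)" .
  have "cmod (a + mexp z h x) \<le> cmod a + cmod (mexp z h x)" by (rule norm_triangle_ineq)
  also have "\<dots> \<le> cmod a + exp (cmod z * b) * itg 0 b (\<lambda>s. cmod (h s))" using mexp_bound[OF assms] by simp
  finally have 2: "cmod (a + mexp z h x) \<le> cmod a + exp (cmod z * b) * itg 0 b (\<lambda>s. cmod (h s))" .
  show ?thesis unfolding sol_def norm_mult by (rule mult_mono[OF 1 2]) auto
qed

section \<open>The explicit resolvent and the eigenfunctions\<close>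

context network
begin

text \<open>The characteristic function: a quarter of the determinant of \<open>Smat l z\<close>,
  see \<open>invertible_Smat\<close>.\<close>

definition K :: "complex \<Rightarrow> complex" where
  "K z = 1 - (exp (- z) + exp (- z * of_real l)) / 2"

text \<open>The unknown is the half-sum of the loop outflows, common to both boundary conditions;
  the two inflows differ from it by -1/3 and 2/3 of the outflow of the first edge. Substituting them
  leaves one scalar equation with factor \<open>K z\<close>. Taking the three end integrals as
  arguments allows a passage to the limit in the compactness proof.\<close>

definition rcoef :: "complex \<Rightarrow> complex \<Rightarrow> complex \<Rightarrow> complex \<Rightarrow> complex" where
  "rcoef z H1 H2 H3 = (exp (- z) * (exp (- z * of_real l) / 3 - exp (- z) / 6) * H1 + (exp (- z) * H2 + exp (- z * of_real l) * H3) / 2) / K z"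

definition acoef :: "complex \<Rightarrow> vec \<Rightarrow> complex" where
  "acoef z h = rcoef z (mexp z (c1 h) 1) (mexp z (c2 h) 1) (mexp z (c3 h) l)"

definition R :: "complex \<Rightarrow> vec \<Rightarrow> vec" where
  "R z h = (sol z 0 (c1 h), sol z (acoef z h - exp (- z) * mexp z (c1 h) 1 / 3) (c2 h),
            sol z (acoef z h + 2 * exp (- z) * mexp z (c1 h) 1 / 3) (c3 h))"

text \<open>The boundary conditions for solutions of the resolvent equation form a linear system with determinant \<open>K z\<close>.\<close>

lemma boundary_system:
  fixes E E' H1 H2 H3 a2 a3 :: complex
  assumes "a2 = 1/2 * (E * (a2 + H2)) + 1/2 * (E' * (a3 + H3)) - 1/3 * (E * H1)"
    "a3 = 1/2 * (E * (a2 + H2)) + 1/2 * (E' * (a3 + H3)) + 2/3 * (E * H1)"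
  shows "(a2 + E * H1 / 3) * (1 - (E + E') / 2) = E * (E' / 3 - E / 6) * H1 + (E * H2 + E' * H3) / 2"
proof -
  have "a3 - a2 = (1/2 * (E * (a2 + H2)) + 1/2 * (E' * (a3 + H3)) + 2/3 * (E * H1)) - (1/2 * (E * (a2 + H2)) + 1/2 * (E' * (a3 + H3)) - 1/3 * (E * H1))"
    by (rule arg_cong2[where f=minus, OF assms(2) assms(1)])
  also have "\<dots> = E * H1" by (simp add: field_simps)
  finally have a3: "a3 = a2 + E * H1" by (simp add: algebra_simps)
  have "(a2 + E * H1 / 3) * (1 - (E + E') / 2) = E * (E' / 3 - E / 6) * H1 + (E * H2 + E' * H3) / 2
      + (a2 - (1/2 * (E * (a2 + H2)) + 1/2 * (E' * (a3 + H3)) - 1/3 * (E * H1)))"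
    unfolding a3 by (simp add: field_simps)
  also have "a2 - (1/2 * (E * (a2 + H2)) + 1/2 * (E' * (a3 + H3)) - 1/3 * (E * H1)) = 0"
    using assms(1) by simp
  finally show ?thesis by simp
qed

lemma boundary_system_solve:
  fixes E E' H1 H2 H3 r :: complex
  assumes "r * (1 - (E + E') / 2) = E * (E' / 3 - E / 6) * H1 + (E * H2 + E' * H3) / 2"
  shows "r - E * H1 / 3 = 1/2 * (E * ((r - E * H1 / 3) + H2)) + 1/2 * (E' * ((r + 2 * E * H1 / 3) + H3)) - 1/3 * (E * H1)"
    "r + 2 * E * H1 / 3 = 1/2 * (E * ((r - E * H1 / 3) + H2)) + 1/2 * (E' * ((r + 2 * E * H1 / 3) + H3)) + 2/3 * (E * H1)"
proof -
  have "r - (1/2 * (E * ((r - E * H1 / 3) + H2)) + 1/2 * (E' * ((r + 2 * E * H1 / 3) + H3)))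
     = r * (1 - (E + E') / 2) - (E * (E' / 3 - E / 6) * H1 + (E * H2 + E' * H3) / 2)"
    by (simp add: field_simps)
  also have "\<dots> = 0" using assms by simp
  finally have "r = 1/2 * (E * ((r - E * H1 / 3) + H2)) + 1/2 * (E' * ((r + 2 * E * H1 / 3) + H3))" by simp
  note * = arg_cong[OF this, of "\<lambda>x. x - 1/3 * (E * H1)"] arg_cong[OF this, of "\<lambda>x. x + 2/3 * (E * H1)"]
  show "r - E * H1 / 3 = 1/2 * (E * ((r - E * H1 / 3) + H2)) + 1/2 * (E' * ((r + 2 * E * H1 / 3) + H3)) - 1/3 * (E * H1)"
    "r + 2 * E * H1 / 3 = 1/2 * (E * ((r - E * H1 / 3) + H2)) + 1/2 * (E' * ((r + 2 * E * H1 / 3) + H3)) + 2/3 * (E * H1)"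
    by (rule trans[OF _ *(1)], simp, rule trans[OF _ *(2)], simp)
qed

lemma regular_R:
  assumes h: "inE l h" and K: "K z \<noteq> 0"
  shows "regular l (R z h) (vsub (vscale z (R z h)) h)"
proof -
  have "acoef z h * (1 - (exp (- z) + exp (- z * of_real l)) / 2)
      = exp (- z) * (exp (- z * of_real l) / 3 - exp (- z) / 6) * mexp z (c1 h) 1 + (exp (- z) * mexp z (c2 h) 1 + exp (- z * of_real l) * mexp z (c3 h) l) / 2"
    using K unfolding acoef_def rcoef_def K_def by simp
  note * = boundary_system_solve[OF this]
  have "bc l (R z h)"
    unfolding bc_def R_def c_triple sol_0
    by (intro conjI *[THEN trans]) (simp_all only: sol_def of_real_1 mult_1_right add_0)
  moreover have "c1 (vsub (vscale z (R z h)) h) = (\<lambda>x. z * c1 (R z h) x - c1 h x)"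
    "c2 (vsub (vscale z (R z h)) h) = (\<lambda>x. z * c2 (R z h) x - c2 h x)"
    "c3 (vsub (vscale z (R z h)) h) = (\<lambda>x. z * c3 (R z h) x - c3 h x)" by auto
  ultimately show ?thesis
    using h unfolding regular_def inE_def by (simp only: R_def c_triple) (intro conjI AC_sol; simp)
qed

lemma R_graph:
  assumes h: "inE l h" and K: "K z \<noteq> 0"
  shows "inE l (R z h)" "(R z h, vsub (vscale z (R z h)) h) \<in> graphA l"
proof -
  have AC: "AC 1 (c1 (R z h)) (\<lambda>x. z * c1 (R z h) x - c1 h x)"
    "AC 1 (c2 (R z h)) (\<lambda>x. z * c2 (R z h) x - c2 h x)"
    "AC l (c3 (R z h)) (\<lambda>x. z * c3 (R z h) x - c3 h x)"
    using h unfolding inE_def by (simp_all only: R_def c_triple AC_sol)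
  have cont: "continuous_on {0..b} (sol z a q)" if "iable 0 b q" for b a q
  proof -
    have "continuous_on {0..b} (\<lambda>x. exp (- z * of_real x) * (a + mexp z q x))"
      unfolding mexp_def by (intro continuous_intros itg_continuous_on iable_exp_mult that)
    then show ?thesis by (simp add: sol_def[abs_def])
  qed
  show 1: "inE l (R z h)"
    using h unfolding inE_def by (simp only: R_def c_triple) (intro conjI; rule iable_continuous, rule cont, simp)
  show "(R z h, vsub (vscale z (R z h)) h) \<in> graphA l"
    unfolding graphA_iff using 1 h regular_R[OF assms] aeq_refl by blast
qed

text \<open>On each edge \<open>AC_unique\<close> forces the variation-of-constants formula, so only
  the inflows \<open>a2\<close> and \<open>a3\<close> remain unknown. As \<open>K z\<close> may
  vanish here, the lemma serves both the resolvent and the eigenvalues.\<close>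

lemma graph_solution:
  assumes g: "(f, vsub (vscale z f) h) \<in> graphA l" and h: "inE l h"
  obtains a2 a3 where "aeq l f (sol z 0 (c1 h), sol z a2 (c2 h), sol z a3 (c3 h))"
    "bc l (sol z 0 (c1 h), sol z a2 (c2 h), sol z a3 (c3 h))"
proof -
  obtain u where u: "regular l u (vsub (vscale z f) h)" "aeq l f u" and E: "inE l f"
    using g unfolding graphA_iff by blast
  have uE: "inE l u" by (rule regular_inE[OF u(1)]) (intro inE_vsub inE_vscale E h)
  have "aeq l (vsub (vscale z f) h) (vsub (vscale z u) h)"
    unfolding vsub_def vscale_def by (intro aeq_vlin aeq_refl u)
  then have r: "regular l u (vsub (vscale z u) h)"
    by (rule regular_aeq[OF u(1)]) (intro inE_vsub inE_vscale E h uE)+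
  have eq: "c1 (vsub (vscale z u) h) = (\<lambda>x. z * c1 u x - c1 h x)"
    "c2 (vsub (vscale z u) h) = (\<lambda>x. z * c2 u x - c2 h x)"
    "c3 (vsub (vscale z u) h) = (\<lambda>x. z * c3 u x - c3 h x)" by auto
  have ac: "AC 1 (c1 u) (\<lambda>x. z * c1 u x - c1 h x)" "AC 1 (c2 u) (\<lambda>x. z * c2 u x - c2 h x)" "AC l (c3 u) (\<lambda>x. z * c3 u x - c3 h x)"
    and b: "bc l u" using r unfolding regular_def eq by blast+
  have i: "iable 0 1 (c1 u)" "iable 0 1 (c2 u)" "iable 0 l (c3 u)" "iable 0 1 (c1 h)" "iable 0 1 (c2 h)" "iable 0 l (c3 h)"
    using uE h unfolding inE_def by blast+
  have u0: "c1 u 0 = 0" using b unfolding bc_def by blast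
  have s: "c1 u x = sol z 0 (c1 h) x" if "0 \<le> x" "x \<le> 1" for x
    using AC_unique[OF i(4) ac(1) i(1) that] u0 by simp
  have s2: "c2 u x = sol z (c2 u 0) (c2 h) x" if "0 \<le> x" "x \<le> 1" for x
    by (rule AC_unique[OF i(5) ac(2) i(2) that])
  have s3: "c3 u x = sol z (c3 u 0) (c3 h) x" if "0 \<le> x" "x \<le> l" for x
    by (rule AC_unique[OF i(6) ac(3) i(3) that])
  show ?thesis
  proof (rule that)
    have "aeq l u (sol z 0 (c1 h), sol z (c2 u 0) (c2 h), sol z (c3 u 0) (c3 h))"
      unfolding aeq_def c_triple by (intro conjI AE_I2 impI s s2 s3) auto
    then show "aeq l f (sol z 0 (c1 h), sol z (c2 u 0) (c2 h), sol z (c3 u 0) (c3 h))"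
      by (rule aeq_trans[OF u(2)])
    have e: "c1 u 1 = sol z 0 (c1 h) 1" "c2 u 1 = sol z (c2 u 0) (c2 h) 1" "c3 u l = sol z (c3 u 0) (c3 h) l"
      by (rule s s2 s3; use l_pos in simp)+
    show "bc l (sol z 0 (c1 h), sol z (c2 u 0) (c2 h), sol z (c3 u 0) (c3 h))"
      using b unfolding bc_def c_triple sol_0 e[symmetric] by blast
  qed
qed

lemma R_unique:
  assumes g: "(f, vsub (vscale z f) h) \<in> graphA l" and h: "inE l h" and K: "K z \<noteq> 0"
  shows "aeq l f (R z h)"
proof -
  obtain a2 a3 where a: "aeq l f (sol z 0 (c1 h), sol z a2 (c2 h), sol z a3 (c3 h))"
    "bc l (sol z 0 (c1 h), sol z a2 (c2 h), sol z a3 (c3 h))" by (rule graph_solution[OF g h])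
  let ?E = "exp (- z)" and ?E' = "exp (- z * of_real l)"
  let ?H1 = "mexp z (c1 h) 1" and ?H2 = "mexp z (c2 h) 1" and ?H3 = "mexp z (c3 h) l"
  have b: "a2 = 1/2 * (?E * (a2 + ?H2)) + 1/2 * (?E' * (a3 + ?H3)) - 1/3 * (?E * ?H1)"
    "a3 = 1/2 * (?E * (a2 + ?H2)) + 1/2 * (?E' * (a3 + ?H3)) + 2/3 * (?E * ?H1)"
    using a(2) unfolding bc_def c_triple sol_0 by (simp_all only: sol_def of_real_1 mult_1_right add_0)
  have "(a2 + ?E * ?H1 / 3) * K z = acoef z h * K z"
    using boundary_system[OF b] K unfolding K_def acoef_def rcoef_def by simp
  then have "a2 + ?E * ?H1 / 3 = acoef z h" using K mult_right_cancel by blast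
  then have a2: "a2 = acoef z h - ?E * ?H1 / 3" by (rule eq_diff_eq[THEN iffD2])
  have "a3 = a2 - (1/2 * (?E * (a2 + ?H2)) + 1/2 * (?E' * (a3 + ?H3)) - 1/3 * (?E * ?H1)) + (1/2 * (?E * (a2 + ?H2)) + 1/2 * (?E' * (a3 + ?H3)) + 2/3 * (?E * ?H1))"
    unfolding b(1)[symmetric] b(2)[symmetric] by simp
  then have "a3 = a2 + ?E * ?H1" by (simp add: algebra_simps)
  then have a3: "a3 = acoef z h + 2 * ?E * ?H1 / 3" unfolding a2 by (simp add: algebra_simps)
  show ?thesis using a(1) unfolding R_def a2[symmetric] a3[symmetric] .
qed

lemma R_bound:
  assumes K: "K z \<noteq> 0"
  obtains C where "\<And>h. inE l h \<Longrightarrow> nrm l (R z h) \<le> C * nrm l h"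
proof -
  \<comment> \<open>A common bound for all exponentials that occur, as no edge is longer than
    \<open>max 1 l\<close>.\<close>
  define M where "M = exp (cmod z * max 1 l)"
  have M_le: "exp (cmod z * b) \<le> M" if "b \<le> max 1 l" for b
    unfolding M_def using that by (simp add: mult_left_mono)
  have M: "1 \<le> M" "exp (cmod z * 1) \<le> M" "exp (cmod z * l) \<le> M"
    using l_pos M_le[of 1] M_le[of l] by (simp_all add: M_def)
  define E E' where "E = exp (- z)" and "E' = exp (- z * of_real l)"
  define D where "D = cmod (E * (E' / 3 - E / 6) / K z) + cmod (E / 2 / K z) + cmod (E' / 2 / K z)"
  have D0: "0 \<le> D" by (simp add: D_def)
  define C where "C = M * (M * 1) + M * ((D * M + cmod E * M) + M * 1) + l * (M * ((D * M + cmod E * M) + M * 1))"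
  have "nrm l (R z h) \<le> C * nrm l h" if h: "inE l h" for h
  proof -
    let ?n = "nrm l h"
    have i: "iable 0 1 (c1 h)" "iable 0 1 (c2 h)" "iable 0 l (c3 h)" using h unfolding inE_def by blast+
    have n: "itg 0 1 (\<lambda>s. cmod (c1 h s)) \<le> ?n" "itg 0 1 (\<lambda>s. cmod (c2 h s)) \<le> ?n" "itg 0 l (\<lambda>s. cmod (c3 h s)) \<le> ?n"
      and n0: "0 \<le> itg 0 1 (\<lambda>s. cmod (c1 h s))" "0 \<le> itg 0 1 (\<lambda>s. cmod (c2 h s))" "0 \<le> itg 0 l (\<lambda>s. cmod (c3 h s))"
      using itg_nonneg[of 0 1 "\<lambda>s. cmod (c1 h s)"] itg_nonneg[of 0 1 "\<lambda>s. cmod (c2 h s)"] itg_nonneg[of 0 l "\<lambda>s. cmod (c3 h s)"]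
      by (simp_all add: nrm_def)
    have H: "cmod (mexp z (c1 h) 1) \<le> M * ?n" "cmod (mexp z (c2 h) 1) \<le> M * ?n" "cmod (mexp z (c3 h) l) \<le> M * ?n"
      using l_pos M n n0 by (auto intro!: order_trans[OF mexp_bound[OF i(1)]] order_trans[OF mexp_bound[OF i(2)]] order_trans[OF mexp_bound[OF i(3)]] mult_mono)
    have ac: "acoef z h = (E * (E' / 3 - E / 6) / K z) * mexp z (c1 h) 1 + (E / 2 / K z) * mexp z (c2 h) 1 + (E' / 2 / K z) * mexp z (c3 h) l"
      unfolding acoef_def rcoef_def E_def[symmetric] E'_def[symmetric] by (simp add: add_divide_distrib)
    have "cmod (acoef z h) \<le> cmod ((E * (E' / 3 - E / 6) / K z) * mexp z (c1 h) 1) + cmod ((E / 2 / K z) * mexp z (c2 h) 1) + cmod ((E' / 2 / K z) * mexp z (c3 h) l)"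
      unfolding ac by (rule order_trans[OF norm_triangle_ineq]) (intro add_right_mono norm_triangle_ineq)
    also have "\<dots> \<le> cmod (E * (E' / 3 - E / 6) / K z) * (M * ?n) + cmod (E / 2 / K z) * (M * ?n) + cmod (E' / 2 / K z) * (M * ?n)"
      unfolding norm_mult[of _ "mexp z _ _"] by (intro add_mono mult_left_mono H norm_ge_zero)
    also have "\<dots> = D * M * ?n" by (simp add: D_def algebra_simps)
    finally have a: "cmod (acoef z h) \<le> D * M * ?n" .
    have EH: "cmod (E * mexp z (c1 h) 1) \<le> cmod E * M * ?n"
      unfolding norm_mult using mult_left_mono[OF H(1) norm_ge_zero[of E]] by (simp add: mult.assoc)
    have "cmod (acoef z h - E * mexp z (c1 h) 1 / 3) \<le> cmod (acoef z h) + cmod (E * mexp z (c1 h) 1) / 3"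
      using norm_triangle_ineq4[of "acoef z h" "E * mexp z (c1 h) 1 / 3"] by (simp add: norm_divide)
    then have a2: "cmod (acoef z h - E * mexp z (c1 h) 1 / 3) \<le> (D * M + cmod E * M) * ?n"
      using a EH norm_ge_zero[of "E * mexp z (c1 h) 1"] unfolding distrib_right by linarith
    have "cmod (acoef z h + 2 * E * mexp z (c1 h) 1 / 3) \<le> cmod (acoef z h) + 2 * cmod (E * mexp z (c1 h) 1) / 3"
      using norm_triangle_ineq[of "acoef z h" "2 * E * mexp z (c1 h) 1 / 3"] by (simp add: norm_divide norm_mult)
    then have a3: "cmod (acoef z h + 2 * E * mexp z (c1 h) 1 / 3) \<le> (D * M + cmod E * M) * ?n"
      using a EH norm_ge_zero[of "E * mexp z (c1 h) 1"] unfolding distrib_right by linarith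
    have sb: "itg 0 b (\<lambda>x. cmod (sol z a q x)) \<le> b * (M * (A * ?n + M * ?n))"
      if q: "iable 0 b q" "itg 0 b (\<lambda>s. cmod (q s)) \<le> ?n" and b: "0 \<le> b" "b \<le> max 1 l" and A: "cmod a \<le> A * ?n" for b a q A
    proof -
      have E: "exp (cmod z * b) \<le> M" using b by (intro M_le)
      have pt: "cmod (sol z a q x) \<le> M * (A * ?n + M * ?n)" if "0 \<le> x" "x \<le> b" for x
        using E q(2) A M(1) itg_nonneg[of 0 b "\<lambda>s. cmod (q s)"]
        by (intro order_trans[OF sol_bound[OF q(1) that]] mult_mono add_mono add_nonneg_nonneg mult_nonneg_nonneg) auto
      have "itg 0 b (\<lambda>x. cmod (sol z a q x)) \<le> itg 0 b (\<lambda>x. M * (A * ?n + M * ?n))"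
      proof (rule itg_mono)
        have "continuous_on {0..b} (\<lambda>x. exp (- z * of_real x) * (a + mexp z q x))"
          unfolding mexp_def by (intro continuous_intros itg_continuous_on iable_exp_mult q)
        then show "iable 0 b (\<lambda>x. cmod (sol z a q x))" by (intro iable_norm iable_continuous) (simp add: sol_def[abs_def])
      qed (use pt in auto)
      then show ?thesis using b by (simp add: itg_const algebra_simps)
    qed
    have "nrm l (R z h) \<le> 1 * (M * (0 * ?n + M * ?n)) + 1 * (M * ((D * M + cmod E * M) * ?n + M * ?n)) + l * (M * ((D * M + cmod E * M) * ?n + M * ?n))"
      unfolding R_def E_def[symmetric]
      by (subst nrm_def, unfold c_triple, intro add_mono sb i n a2 a3) (use l_pos in auto)
    also have "\<dots> = C * ?n" by (simp add: C_def algebra_simps)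
    finally show ?thesis .
  qed
  then show ?thesis by (rule that)
qed

text \<open>The eigenfunction when \<open>K z = 0\<close>. For \<open>z = 0\<close> it is the
  equilibrium, constant on the loops, to which the flow converges.\<close>

definition ef :: "complex \<Rightarrow> vec" where
  "ef z = ((\<lambda>_. 0), (\<lambda>x. exp (- z * of_real x)), (\<lambda>x. exp (- z * of_real x)))"

lemma inE_ef: "inE l (ef z)"
  unfolding inE_def ef_def c_triple by (intro conjI iable_continuous continuous_intros)

lemma nrm_ef: "nrm l (ef z) \<noteq> 0"
proof
  assume "nrm l (ef z) = 0"
  then have "dst (ef z) vzero = 0" by simp
  then have "aeq l (ef z) vzero" using nrm_vsub_eq_0[OF inE_ef inE_vzero] by blast
  then have "AE x in lborel. x \<in> {0..1} \<longrightarrow> exp (- z * of_real x) = 0"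
    unfolding aeq_def ef_def vzero_def c_triple by blast
  then have "AE x in lborel. x \<notin> {0..1::real}" by (rule eventually_mono) auto
  then have "{0..1::real} \<in> null_sets lborel" by (subst AE_iff_null_sets) auto
  then have "emeasure lborel {0..1::real} = 0" by (rule null_setsD1)
  then show False by simp
qed

lemma mexp_zero: "mexp z (\<lambda>_. 0) x = 0" by (simp add: mexp_def)

lemma c_vzero: "c1 vzero = (\<lambda>_. 0)" "c2 vzero = (\<lambda>_. 0)" "c3 vzero = (\<lambda>_. 0)" by (simp_all add: vzero_def)

lemma sol_zero: "sol z a (\<lambda>_. 0) = (\<lambda>x. a * exp (- z * of_real x))" by (rule ext) (simp add: sol_def mexp_zero)

lemma ef_graph:
  assumes "K z = 0"
  shows "(ef z, vscale z (ef z)) \<in> graphA l"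
proof -
  have ac: "AC b (\<lambda>x. a * exp (- z * of_real x)) (\<lambda>x. z * (a * exp (- z * of_real x)))" for a b
  proof -
    have "iable 0 b (\<lambda>_. 0::complex)" by simp
    from AC_sol[OF this, of z a] show ?thesis unfolding sol_zero by simp
  qed
  have eq: "c1 (vscale z (ef z)) = (\<lambda>x. z * (0 * exp (- z * of_real x)))" "c2 (vscale z (ef z)) = (\<lambda>x. z * (1 * exp (- z * of_real x)))"
    "c3 (vscale z (ef z)) = (\<lambda>x. z * (1 * exp (- z * of_real x)))" by (auto simp: ef_def)
  have eq': "c1 (ef z) = (\<lambda>x. 0 * exp (- z * of_real x))" "c2 (ef z) = (\<lambda>x. 1 * exp (- z * of_real x))"
    "c3 (ef z) = (\<lambda>x. 1 * exp (- z * of_real x))" by (auto simp: ef_def)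
  have "exp (- z) / 2 + exp (- z * of_real l) / 2 = 1" using assms unfolding K_def by (simp add: add_divide_distrib)
  then have "bc l (ef z)" by (simp add: bc_def ef_def)
  then have "regular l (ef z) (vscale z (ef z))" unfolding regular_def eq eq' by (intro conjI ac)
  then show ?thesis unfolding graphA_iff using inE_ef inE_vscale aeq_refl by blast
qed

text \<open>With right-hand side 0 the first edge stays empty, so the two boundary conditions
  prescribe the same inflow \<open>a\<close> for both loops, and they reduce to
  \<open>a * K z = 0\<close>. Injectivity, the eigenvalue criterion and one-dimensionality all
  follow.\<close>

lemma eigen_solution:
  assumes "(f, vscale z f) \<in> graphA l"
  obtains a where "aeq l f (vscale a (ef z))" "a * K z = 0"
proof -
  have "(f, vsub (vscale z f) vzero) \<in> graphA l" using assms by simp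
  then obtain a2 a3 where a: "aeq l f (sol z 0 (c1 vzero), sol z a2 (c2 vzero), sol z a3 (c3 vzero))"
    "bc l (sol z 0 (c1 vzero), sol z a2 (c2 vzero), sol z a3 (c3 vzero))" by (rule graph_solution[OF _ inE_vzero])
  have e: "sol z a (\<lambda>_. 0) 0 = a" "sol z a (\<lambda>_. 0) 1 = a * exp (- z)" "sol z a (\<lambda>_. 0) l = a * exp (- z * of_real l)"
    "sol z 0 (\<lambda>_. 0) 1 = 0" for a by (simp_all add: sol_zero)
  have b: "a2 = 1/2 * (a2 * exp (- z)) + 1/2 * (a3 * exp (- z * of_real l)) - 1/3 * (0 * exp (- z))" "a3 = 1/2 * (a2 * exp (- z)) + 1/2 * (a3 * exp (- z * of_real l)) + 2/3 * (0 * exp (- z))"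
    using a(2) unfolding bc_def c_triple c_vzero e by blast+
  have 3: "a3 = a2" using trans[OF b(2) trans[OF _ b(1)[symmetric]]] by simp
  show ?thesis
  proof (rule that[of a2])
    have "vscale a2 (ef z) = (sol z 0 (c1 vzero), sol z a2 (c2 vzero), sol z a3 (c3 vzero))"
      unfolding c_vzero sol_zero 3 by (rule vec_eqI) (simp_all add: ef_def)
    then show "aeq l f (vscale a2 (ef z))" using a(1) by simp
    have "a2 * K z = a2 - (1/2 * (a2 * exp (- z)) + 1/2 * (a2 * exp (- z * of_real l)))"
      unfolding K_def by (simp add: algebra_simps add_divide_distrib)
    also have "\<dots> = a2 - (1/2 * (a2 * exp (- z)) + 1/2 * (a3 * exp (- z * of_real l)) - 1/3 * (0 * exp (- z)))" unfolding 3 by simp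
    also have "\<dots> = a2 - a2" unfolding b(1)[symmetric] by simp
    finally show "a2 * K z = 0" by simp
  qed
qed

text \<open>A zero of \<open>K\<close> produces an eigenfunction; otherwise \<open>R z\<close> is a
  bounded inverse. Hence the spectrum consists of eigenvalues.\<close>

lemma resolvent_set_iff: "z \<in> resolvent_set l \<longleftrightarrow> K z \<noteq> 0"
proof
  assume "z \<in> resolvent_set l"
  then have "\<forall>f. (f, vscale z f) \<in> graphA l \<longrightarrow> nrm l f = 0" unfolding resolvent_set_def by blast
  then show "K z \<noteq> 0" using ef_graph nrm_ef by blast
next
  assume K: "K z \<noteq> 0"
  obtain C where C: "\<And>h. inE l h \<Longrightarrow> nrm l (R z h) \<le> C * nrm l h" using R_bound[OF K] by metis
  show "z \<in> resolvent_set l"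
    unfolding resolvent_set_def mem_Collect_eq
  proof (intro conjI allI impI exI)
    show "(R z h, vsub (vscale z (R z h)) h) \<in> graphA l" if "inE l h" for h by (rule R_graph[OF that K])
    show "nrm l f = 0" if f: "(f, vscale z f) \<in> graphA l" for f
    proof -
      obtain a where a: "aeq l f (vscale a (ef z))" "a * K z = 0" by (rule eigen_solution[OF f])
      have "nrm l f = nrm l (vscale a (ef z))"
        by (rule nrm_aeq[OF graphA_inE(1)[OF f] _ a(1)]) (intro inE_vscale inE_ef)
      then show ?thesis using a(2) K by (simp add: nrm_vscale)
    qed
    show "nrm l f \<le> C * dst (vscale z f) g" if "(f, g) \<in> graphA l" for f g
    proof -
      let ?h = "vsub (vscale z f) g"
      have E: "inE l f" "inE l g" using graphA_inE[OF that] by auto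
      have h: "inE l ?h" by (intro inE_vsub inE_vscale E)
      have "vsub (vscale z f) ?h = g" by (rule vec_eqI) simp_all
      then have "aeq l f (R z ?h)" using that h K by (intro R_unique) auto
      then have "nrm l f = nrm l (R z ?h)" by (rule nrm_aeq[OF E(1) R_graph(1)[OF h K]])
      then show ?thesis using C[OF h] by simp
    qed
  qed
qed

lemma eigenvalue_iff: "eigenvalue l z \<longleftrightarrow> K z = 0"
proof
  assume "eigenvalue l z"
  then obtain f where f: "(f, vscale z f) \<in> graphA l" "nrm l f \<noteq> 0" unfolding eigenvalue_def by blast
  obtain a where a: "aeq l f (vscale a (ef z))" "a * K z = 0" by (rule eigen_solution[OF f(1)])
  have "nrm l f = nrm l (vscale a (ef z))"
    by (rule nrm_aeq[OF graphA_inE(1)[OF f(1)] _ a(1)]) (intro inE_vscale inE_ef)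
  then show "K z = 0" using f(2) a(2) by (auto simp: nrm_vscale)
next
  show "K z = 0 \<Longrightarrow> eigenvalue l z" unfolding eigenvalue_def using ef_graph nrm_ef by blast
qed

lemma eigenspace:
  assumes "eigenvalue l z"
  shows "eigenspace_dim1 l z"
  unfolding eigenspace_dim1_def
proof (intro exI[of _ "ef z"] conjI allI impI)
  show "(ef z, vscale z (ef z)) \<in> graphA l" using assms by (simp add: eigenvalue_iff ef_graph)
  show "nrm l (ef z) \<noteq> 0" by (rule nrm_ef)
  fix f assume f: "(f, vscale z f) \<in> graphA l"
  obtain a where "aeq l f (vscale a (ef z))" "a * K z = 0" by (rule eigen_solution[OF f])
  then show "\<exists>c. dst f (vscale c (ef z)) = 0"
    using nrm_vsub_eq_0[OF graphA_inE(1)[OF f] inE_vscale[OF inE_ef]] by blast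
qed

section \<open>Location of the zeros of the characteristic function\<close>

lemma invertible_Smat: "invertible (Smat l z) \<longleftrightarrow> K z \<noteq> 0"
proof -
  have "det (Smat l z) = 4 * K z"
    unfolding Smat_def det_2 K_def by (simp add: algebra_simps)
  then show ?thesis by (simp add: invertible_det_nz)
qed

text \<open>In the open right half-plane both exponentials have modulus below 1 and cannot add up to
  2.\<close>

lemma K_Re_le: "K z = 0 \<Longrightarrow> Re z \<le> 0"
proof (rule ccontr)
  assume K: "K z = 0" and "\<not> Re z \<le> 0"
  then have z: "Re z > 0" by simp
  have "cmod (exp (- z)) < 1" "cmod (exp (- z * of_real l)) < 1"
    using z l_pos by simp_all
  moreover have "exp (- z) + exp (- z * of_real l) = 2" using K by (simp add: K_def)
  then have "2 \<le> cmod (exp (- z)) + cmod (exp (- z * of_real l))"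
    using norm_triangle_ineq[of "exp (- z)" "exp (- z * of_real l)"] by (simp del: norm_exp_eq_Re)
  ultimately show False by linarith
qed

text \<open>On the imaginary axis both exponentials have modulus 1, so a sum of 2 forces both to
  equal 1. Then \<open>Im z\<close> and \<open>l * Im z\<close> are integer multiples of
  \<open>2 * pi\<close>, and a nonzero \<open>Im z\<close> would make \<open>l\<close>
  rational.\<close>

lemma K_imaginary:
  assumes l: "l \<notin> \<rat>" and K: "K z = 0" and z: "Re z = 0"
  shows "z = 0"
proof -
  have n: "cmod (exp (- z)) = 1" "cmod (exp (- z * of_real l)) = 1" using z by simp_all
  have s: "exp (- z) + exp (- z * of_real l) = 2" using K by (simp add: K_def)
  then have "Re (exp (- z)) + Re (exp (- z * of_real l)) = 2" by (metis plus_complex.sel(1) Re_complex_of_real of_real_numeral)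
  then have r: "Re (exp (- z)) = 1" "Re (exp (- z * of_real l)) = 1"
    using complex_Re_le_cmod[of "exp (- z)"] complex_Re_le_cmod[of "exp (- z * of_real l)"] n by linarith+
  have one: "w = 1" if "cmod w = 1" "Re w = 1" for w :: complex
    using that cmod_power2[of w] by (simp add: complex_eq_iff)
  have "exp (- z) = 1" "exp (- z * of_real l) = 1" using one n r by blast+
  then obtain p q :: int where p: "Im (- z) = of_int (2 * p) * pi" and q: "Im (- z * of_real l) = of_int (2 * q) * pi"
    unfolding exp_eq_1 by blast
  have "p = 0"
  proof (rule ccontr)
    assume p0: "p \<noteq> 0"
    have "of_int (2 * q) * pi = of_int (2 * p) * pi * l" unfolding p[symmetric] q[symmetric] by simp
    then have "(2 * pi) * (of_int p * l) = (2 * pi) * of_int q" by (simp add: algebra_simps)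
    then have "of_int p * l = of_int q" by (subst (asm) mult_left_cancel) simp_all
    then have "l = of_int q / of_int p" using p0 by (simp add: field_simps)
    then show False using l by (simp add: Rats_divide)
  qed
  then show ?thesis using p z by (simp add: complex_eq_iff)
qed

lemma K_0: "K 0 = 0" by (simp add: K_def)

lemma K_1: "K 1 \<noteq> 0" using K_Re_le[of 1] by auto

section \<open>Kernel of the operator and of its adjoint\<close>

lemma mass_lin: "inE l f \<Longrightarrow> inE l g \<Longrightarrow> mass (vlin a f b g) = a * mass f + b * mass g"
  unfolding mass_def c_vlin_fun inE_def by (simp add: set_integral_add algebra_simps)

lemma mass_bound: "inE l f \<Longrightarrow> cmod (mass f) \<le> nrm l f"
proof -
  assume f: "inE l f"
  have "cmod (itg 0 1 (c1 f)) \<le> itg 0 1 (\<lambda>x. cmod (c1 f x))" "cmod (itg 0 1 (c2 f)) \<le> itg 0 1 (\<lambda>x. cmod (c2 f x))"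
    "cmod (itg 0 l (c3 f)) \<le> itg 0 l (\<lambda>x. cmod (c3 f x))"
    using f unfolding inE_def by (blast intro: itg_norm_le)+
  moreover have "cmod (mass f) \<le> cmod (1/3 * itg 0 1 (c1 f)) + cmod (itg 0 1 (c2 f)) + cmod (itg 0 l (c3 f))"
    unfolding mass_def by (rule order_trans[OF norm_triangle_ineq]) (intro add_right_mono norm_triangle_ineq)
  moreover have "cmod (1/3 * itg 0 1 (c1 f)) \<le> cmod (itg 0 1 (c1 f))" by (simp add: norm_mult)
  ultimately show ?thesis unfolding nrm_def by linarith
qed

text \<open>The integrals of \<open>g\<close> are differences of end values of the continuous
  representative, and with the weights 1/3, 1, 1 these cancel by the boundary conditions.\<close>

lemma mass_range: "(f, g) \<in> graphA l \<Longrightarrow> mass g = 0"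
proof -
  assume "(f, g) \<in> graphA l"
  then obtain u where u: "regular l u g" unfolding graphA_iff by blast
  have e: "itg 0 1 (c1 g) = c1 u 0 - c1 u 1" "itg 0 1 (c2 g) = c2 u 0 - c2 u 1" "itg 0 l (c3 g) = c3 u 0 - c3 u l"
    using ACD[of 1 "c1 u" "c1 g" 1] ACD[of 1 "c2 u" "c2 g" 1] ACD[of l "c3 u" "c3 g" l] u l_pos unfolding regular_def by simp_all
  have b: "c2 u 0 = 1/2 * c2 u 1 + 1/2 * c3 u l - 1/3 * c1 u 1" "c3 u 0 = 1/2 * c2 u 1 + 1/2 * c3 u l + 2/3 * c1 u 1" "c1 u 0 = 0"
    using u unfolding regular_def bc_def by blast+
  show ?thesis unfolding mass_def e by (simp only: b) (simp add: algebra_simps)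
qed

lemma pairing_mass: "pairing l ((\<lambda>x. 1/3 * indicator {0..1} x), indicator {0..1}, indicator {0..l}) f = mass f"
proof -
  have "itg 0 1 (\<lambda>x. 1/3 * indicator {0..1} x * c1 f x) = itg 0 1 (\<lambda>x. 1/3 * c1 f x)" by (rule itg_cong) simp
  moreover have "itg 0 1 (\<lambda>x. indicator {0..1} x * c2 f x) = itg 0 1 (c2 f)" by (rule itg_cong) simp
  moreover have "itg 0 l (\<lambda>x. indicator {0..l} x * c3 f x) = itg 0 l (c3 f)" by (rule itg_cong) simp
  ultimately show ?thesis unfolding pairing_def mass_def by simp
qed

lemma kernel_adjoint: "in_ker_adjoint l (pairing l ((\<lambda>x. 1/3 * indicator {0..1} x), indicator {0..1}, indicator {0..l}))"
  unfolding in_ker_adjoint_def pairing_mass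
  by (intro conjI allI impI exI[of _ 1]) (auto simp: mass_lin mass_bound mass_range)

lemma kernel: "(((\<lambda>_. 0), indicator {0..1}, indicator {0..l}), vzero) \<in> graphA l"
proof (rule graphA_aeq[OF ef_graph[OF K_0]])
  show "aeq l (ef 0) ((\<lambda>_. 0), indicator {0..1}, indicator {0..l})" by (simp add: aeq_def ef_def)
  show "aeq l (vscale 0 (ef 0)) vzero" by (simp add: aeq_def vzero_def)
  have "inE l (ef 0) \<longleftrightarrow> inE l ((\<lambda>_. 0), indicator {0..1}, indicator {0..l})"
    by (rule inE_cong) (auto simp: ef_def)
  then show "inE l ((\<lambda>_. 0), indicator {0..1}, indicator {0..l})" using inE_ef by simp
qed simp

text \<open>Dissipativity needs only the limit of the difference quotients, not membership in the
  graph. It thus applies to the generator of \<open>S\<close> before that generator has been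
  identified.\<close>

lemma limit_dissipative:
  assumes d: "inE l d" and k: "inE l k" and \<mu>: "0 < (\<mu>::real)"
    and lim: "((\<lambda>t. dst (dquot t (S t d) d) k) \<longlongrightarrow> 0) (at_right 0)"
  shows "\<mu> * nrm l d \<le> dst (vscale (of_real \<mu>) d) k"
proof -
  have *: "\<mu> * nrm l d - dst (vscale (of_real \<mu>) d) k \<le> dst (dquot t (S t d) d) k" if t: "t > 0" for t
  proof -
    let ?Q = "dquot t (S t d) d"
    have QE: "inE l ?Q" by (intro inE_vscale inE_vsub inE_S d)
    \<comment> \<open>With \<open>(\<mu> + 1/t) d\<close> written as \<open>\<mu> d - ?Q\<close>
      plus \<open>S t d\<close> divided by \<open>t\<close>, contractivity makes the norm of
      \<open>d\<close> divided by \<open>t\<close> cancel from both sides.\<close>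
    have "nrm l (vscale (of_real (\<mu> + 1/t)) d) \<le> dst (vscale (of_real (\<mu> + 1/t)) d) (vscale (of_real (1 / t)) (S t d)) + nrm l (vscale (of_real (1 / t)) (S t d))"
      by (rule nrm_triangle2) (intro inE_vscale inE_S d)+
    also have "vsub (vscale (of_real (\<mu> + 1/t)) d) (vscale (of_real (1 / t)) (S t d)) = vsub (vscale (of_real \<mu>) d) ?Q"
      by (rule vec_eqI) (simp_all add: algebra_simps)
    also have "dst (vscale (of_real \<mu>) d) ?Q \<le> dst (vscale (of_real \<mu>) d) k + dst k ?Q"
      by (rule nrm_triangle) (intro inE_vscale d k QE)+
    also have "nrm l (vscale (of_real (1 / t)) (S t d)) \<le> 1/t * nrm l d"
      using S_contractive[OF d, of t] t by (simp add: nrm_vscale norm_divide divide_right_mono)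
    also have "dst k ?Q = dst ?Q k" by (rule nrm_vsub_commute)
    also have "nrm l (vscale (of_real (\<mu> + 1/t)) d) = (\<mu> + 1/t) * nrm l d"
    proof -
      have "0 < \<mu> + 1/t" using \<mu> t by (simp add: add_pos_pos)
      then show ?thesis unfolding nrm_vscale norm_of_real by simp
    qed
    finally show ?thesis by (simp add: distrib_right)
  qed
  have "\<mu> * nrm l d - dst (vscale (of_real \<mu>) d) k \<le> 0"
    by (rule tendsto_lowerbound[OF lim], rule eventually_mono[OF eventually_at_right_less], rule *) simp_all
  then show ?thesis by simp
qed

lemma A_dissipative: "dissipative l"
  unfolding dissipative_def by (auto intro: limit_dissipative generator_if graphA_inE)

lemma vscale_1 [simp]: "vscale 1 f = f" by (rule vec_eqI) simp_all

text \<open>The limit is compared with \<open>f' = R 1 (f - g)\<close>, which is in the graph with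
  image \<open>g + (f' - f)\<close>. Dissipativity at 1 bounds the distance from \<open>fs n\<close>
  to \<open>f'\<close> by quantities tending to 0, so \<open>f' = f\<close>.\<close>

lemma A_closed: "closed_op l"
  unfolding closed_op_def
proof (intro allI impI, elim conjE)
  fix fs gs :: "nat \<Rightarrow> vec" and f g
  assume gr: "\<forall>n. (fs n, gs n) \<in> graphA l" and E: "inE l f" "inE l g"
    and lim: "(\<lambda>n. dst (fs n) f) \<longlonglongrightarrow> 0" "(\<lambda>n. dst (gs n) g) \<longlonglongrightarrow> 0"
  define h f' where "h = vsub f g" and "f' = R 1 h"
  have hE: "inE l h" unfolding h_def by (intro inE_vsub E)
  have f'E: "inE l f'" and f'g: "(f', vsub f' h) \<in> graphA l"
    using R_graph[OF hE K_1] by (simp_all add: f'_def)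
  have "dst f f' \<le> 2 * dst (fs n) f + dst (gs n) g" for n
  proof -
    have nE: "inE l (fs n)" "inE l (gs n)" using gr graphA_inE by blast+
    have "(vsub (fs n) f', vsub (gs n) (vsub f' h)) \<in> graphA l"
      unfolding vsub_def by (rule graphA_lin[OF gr[rule_format] f'g[unfolded vsub_def]])
    then have "dst (fs n) f' \<le> dst (vsub (fs n) f') (vsub (gs n) (vsub f' h))"
      using limit_dissipative[OF _ _ _ generator_if, of "vsub (fs n) f'" "vsub (gs n) (vsub f' h)" 1] graphA_inE by auto
    also have "vsub (vsub (fs n) f') (vsub (gs n) (vsub f' h)) = vsub (vsub (fs n) f) (vsub (gs n) g)"
      by (rule vec_eqI) (simp_all add: h_def)
    also have "dst (vsub (fs n) f) (vsub (gs n) g) \<le> dst (vsub (fs n) f) vzero + dst vzero (vsub (gs n) g)"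
      by (rule nrm_triangle) (intro inE_vsub E nE inE_vzero)+
    also have "dst vzero (vsub (gs n) g) = dst (gs n) g"
      by (subst nrm_vsub_commute) simp
    finally have 1: "dst (fs n) f' \<le> dst (fs n) f + dst (gs n) g" by simp
    have "dst f f' \<le> dst f (fs n) + dst (fs n) f'"
      by (rule nrm_triangle) (intro E nE f'E)+
    then show ?thesis using 1 nrm_vsub_commute[of l f "fs n"] by linarith
  qed
  moreover have "(\<lambda>n. 2 * dst (fs n) f + dst (gs n) g) \<longlonglongrightarrow> 2 * 0 + 0"
    by (intro tendsto_intros lim)
  ultimately have "dst f f' \<le> 0" by (intro LIMSEQ_le_const) auto
  then have z: "dst f' f = 0" using nrm_nonneg[of l "vsub f f'"] nrm_vsub_commute[of l f f'] by simp
  have "vsub (vsub f' h) g = vsub f' f" by (rule vec_eqI) (simp_all add: h_def)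
  then show "(f, g) \<in> graphA l" using z by (intro graphA_eq_arg[OF f'g] E) simp_all
qed

text \<open>The generator extends the operator; since 1 minus the operator is onto and 1 minus the
  generator is injective by dissipativity, the two coincide.\<close>

lemma generator_only_if:
  assumes E: "inE l f" "inE l g"
    and lim: "((\<lambda>t. dst (dquot t (S t f) f) g) \<longlongrightarrow> 0) (at_right 0)"
  shows "(f, g) \<in> graphA l"
proof -
  define h f' where "h = vsub f g" and "f' = R 1 h"
  have hE: "inE l h" unfolding h_def by (intro inE_vsub E)
  have f'E: "inE l f'" and f'g: "(f', vsub f' h) \<in> graphA l"
    using R_graph[OF hE K_1] by (simp_all add: f'_def)
  define d where "d = vsub f f'"
  have dE: "inE l d" unfolding d_def by (intro inE_vsub E f'E)
  \<comment> \<open>The two images differ by \<open>g - (f' - h)\<close>, which is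
    \<open>f - f'\<close> because \<open>h = f - g\<close>. So \<open>d\<close> would be fixed by
    the generator, and dissipativity at 1 makes it vanish.\<close>
  have "((\<lambda>t. dst (dquot t (S t d) d) d) \<longlongrightarrow> 0) (at_right 0)"
  proof (rule tendsto_sandwich[OF _ _ tendsto_const])
    show "((\<lambda>t. dst (dquot t (S t f) f) g
        + dst (dquot t (S t f') f') (vsub f' h)) \<longlongrightarrow> 0) (at_right 0)"
      using tendsto_add[OF lim generator_if[OF f'g]] by simp
    have "dst (dquot t (S t d) d) d \<le> dst (dquot t (S t f) f) g
        + dst (dquot t (S t f') f') (vsub f' h)" if "0 < t" for t
    proof -
      let ?a = "vsub (dquot t (S t f) f) g" and ?b = "vsub (dquot t (S t f') f') (vsub f' h)"
      have aE: "inE l ?a" "inE l ?b" by (intro inE_vsub inE_vscale inE_S E f'E hE)+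
      have "dst (dquot t (S t d) d) d = dst ?a ?b"
        by (rule nrm_cong) (use that in \<open>simp_all add: d_def h_def vsub_def e_lin algebra_simps\<close>)
      also have "\<dots> \<le> dst ?a vzero + dst vzero ?b" by (rule nrm_triangle) (intro aE inE_vzero)+
      also have "dst vzero ?b = nrm l ?b" by (subst nrm_vsub_commute) simp
      finally show ?thesis by simp
    qed
    then show "\<forall>\<^sub>F t in at_right 0. dst (dquot t (S t d) d) d \<le> dst (dquot t (S t f) f) g
        + dst (dquot t (S t f') f') (vsub f' h)"
      unfolding eventually_at_right_field by (intro exI[of _ 1]) auto
  qed (auto intro: always_eventually nrm_nonneg)
  from limit_dissipative[OF dE dE _ this, of 1]
  have "nrm l d \<le> dst d d" by simp
  also have "vsub d d = vzero" by (rule vec_eqI) (simp_all add: vzero_def)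
  finally have z: "dst f' f = 0" using nrm_nonneg[of l d] nrm_vsub_commute[of l f f'] by (simp add: d_def)
  have "vsub (vsub f' h) g = vsub f' f" by (rule vec_eqI) (simp_all add: h_def)
  then show "(f, g) \<in> graphA l" using z by (intro graphA_eq_arg[OF f'g] E) simp_all
qed

lemma S_contr: "contractive l S"
  unfolding contractive_def using S_contractive by blast

lemma S_generated: "generated_semigroup l S"
  unfolding generated_semigroup_def
proof (intro conjI allI impI)
  show "dst (S t f) (S t g) = 0" if "0 \<le> t" "inE l f \<and> inE l g \<and> dst f g = 0" for t f g
    using S_contractive[of "vsub f g" t] S_sub_nrm[of t f g] that nrm_nonneg[of l "vsub (S t f) (S t g)"] by (auto simp: inE_vsub)
  show "\<exists>M. \<forall>f. inE l f \<longrightarrow> nrm l (S t f) \<le> M * nrm l f" if "0 \<le> t" for t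
    using that S_contractive by (intro exI[of _ 1]) simp
  show "(f, g) \<in> graphA l \<longleftrightarrow> (inE l f \<and> inE l g \<and>
         ((\<lambda>t. dst (dquot t (S t f) f) g) \<longlongrightarrow> 0) (at_right 0))" for f g
    using generator_if[of f g] generator_only_if[of f g] graphA_inE[of f g l] by blast
qed (simp_all add: inE_S S_lin S_0 S_add S_continuous)

end

section \<open>Compactness of the resolvent and density of the domain\<close>

text \<open>Primitives of L1-bounded sequences: their monotone parts have convergent subsequences by Helly's theorem.\<close>

definition prim_conv :: "real \<Rightarrow> (nat \<Rightarrow> real \<Rightarrow> 'a::{banach, second_countable_topology}) \<Rightarrow> bool" where
  "prim_conv b g \<longleftrightarrow> (\<exists>W. iable 0 b W \<and> (\<lambda>n. itg 0 b (\<lambda>x. norm (itg 0 x (g n) - W x))) \<longlonglongrightarrow> 0) \<and>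
     convergent (\<lambda>n. itg 0 b (g n))"

lemma prim_conv_subseq:
  assumes "prim_conv b g" "strict_mono r"
  shows "prim_conv b (\<lambda>n. g (r n))"
proof -
  obtain W where W: "iable 0 b W" "(\<lambda>n. itg 0 b (\<lambda>x. norm (itg 0 x (g n) - W x))) \<longlonglongrightarrow> 0" and c: "convergent (\<lambda>n. itg 0 b (g n))"
    using assms(1) unfolding prim_conv_def by blast
  have "convergent (\<lambda>n. itg 0 b (g (r n)))"
    using convergent_subseq_convergent[OF c assms(2)] by (simp add: o_def)
  moreover have "(\<lambda>n. itg 0 b (\<lambda>x. norm (itg 0 x (g (r n)) - W x))) \<longlonglongrightarrow> 0"
    using LIMSEQ_subseq_LIMSEQ[OF W(2) assms(2)] by (simp add: o_def)
  ultimately show ?thesis using W(1) unfolding prim_conv_def by blast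
qed

lemma prim_conv_lin:
  fixes g h :: "nat \<Rightarrow> real \<Rightarrow> complex"
  assumes "prim_conv b g" "prim_conv b h" "\<And>n. iable 0 b (g n)" "\<And>n. iable 0 b (h n)" and b: "0 \<le> b"
  shows "prim_conv b (\<lambda>n x. \<alpha> * g n x + \<beta> * h n x)"
proof -
  obtain W where W: "iable 0 b W" "(\<lambda>n. itg 0 b (\<lambda>x. norm (itg 0 x (g n) - W x))) \<longlonglongrightarrow> 0" and c: "convergent (\<lambda>n. itg 0 b (g n))"
    using assms(1) unfolding prim_conv_def by blast
  obtain W' where W': "iable 0 b W'" "(\<lambda>n. itg 0 b (\<lambda>x. norm (itg 0 x (h n) - W' x))) \<longlonglongrightarrow> 0" and c': "convergent (\<lambda>n. itg 0 b (h n))"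
    using assms(2) unfolding prim_conv_def by blast
  have lin: "itg 0 x (\<lambda>s. \<alpha> * g n s + \<beta> * h n s) = \<alpha> * itg 0 x (g n) + \<beta> * itg 0 x (h n)" if "x \<le> b" for n x
    using iable_sub[OF assms(3), of 0 x n] iable_sub[OF assms(4), of 0 x n] that by (simp add: set_integral_add)
  have "convergent (\<lambda>n. itg 0 b (\<lambda>s. \<alpha> * g n s + \<beta> * h n s))"
    unfolding lin[OF order_refl] by (intro convergent_add convergent_mult convergent_const c c')
  moreover have "iable 0 b (\<lambda>x. \<alpha> * W x + \<beta> * W' x)" using W(1) W'(1) by (intro set_integral_add set_integrable_mult_right)
  moreover have "(\<lambda>n. itg 0 b (\<lambda>x. norm (itg 0 x (\<lambda>s. \<alpha> * g n s + \<beta> * h n s) - (\<alpha> * W x + \<beta> * W' x)))) \<longlonglongrightarrow> 0"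
  proof (rule tendsto_sandwich[OF _ _ tendsto_const])
    have "(\<lambda>n. norm \<alpha> * itg 0 b (\<lambda>x. norm (itg 0 x (g n) - W x)) + norm \<beta> * itg 0 b (\<lambda>x. norm (itg 0 x (h n) - W' x))) \<longlonglongrightarrow> norm \<alpha> * 0 + norm \<beta> * 0"
      by (intro tendsto_intros W W')
    then show "(\<lambda>n. norm \<alpha> * itg 0 b (\<lambda>x. norm (itg 0 x (g n) - W x)) + norm \<beta> * itg 0 b (\<lambda>x. norm (itg 0 x (h n) - W' x))) \<longlonglongrightarrow> 0" by simp
    have "itg 0 b (\<lambda>x. norm (itg 0 x (\<lambda>s. \<alpha> * g n s + \<beta> * h n s) - (\<alpha> * W x + \<beta> * W' x)))
      \<le> norm \<alpha> * itg 0 b (\<lambda>x. norm (itg 0 x (g n) - W x)) + norm \<beta> * itg 0 b (\<lambda>x. norm (itg 0 x (h n) - W' x))" for n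
    proof -
      have pg: "iable 0 b (\<lambda>x. itg 0 x (g n))" "iable 0 b (\<lambda>x. itg 0 x (h n))"
        by (rule iable_continuous, rule itg_continuous_on, rule assms)+
      have d: "iable 0 b (\<lambda>x. itg 0 x (g n) - W x)" "iable 0 b (\<lambda>x. itg 0 x (h n) - W' x)"
        by (rule set_integral_diff(1)[OF pg(1) W(1)], rule set_integral_diff(1)[OF pg(2) W'(1)])
      have eq: "itg 0 x (\<lambda>s. \<alpha> * g n s + \<beta> * h n s) - (\<alpha> * W x + \<beta> * W' x) = \<alpha> * (itg 0 x (g n) - W x) + \<beta> * (itg 0 x (h n) - W' x)" if "x \<le> b" for x
        unfolding lin[OF that] by (simp add: algebra_simps)
      have "itg 0 b (\<lambda>x. norm (itg 0 x (\<lambda>s. \<alpha> * g n s + \<beta> * h n s) - (\<alpha> * W x + \<beta> * W' x)))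
         = itg 0 b (\<lambda>x. norm (\<alpha> * (itg 0 x (g n) - W x) + \<beta> * (itg 0 x (h n) - W' x)))"
        by (rule itg_cong) (simp add: eq)
      also have "\<dots> \<le> itg 0 b (\<lambda>x. norm \<alpha> * norm (itg 0 x (g n) - W x) + norm \<beta> * norm (itg 0 x (h n) - W' x))"
      proof (rule itg_mono)
        show "iable 0 b (\<lambda>x. norm (\<alpha> * (itg 0 x (g n) - W x) + \<beta> * (itg 0 x (h n) - W' x)))"
          by (rule iable_norm, rule set_integral_add(1)) (rule set_integrable_mult_right, rule d)+
        show "iable 0 b (\<lambda>x. norm \<alpha> * norm (itg 0 x (g n) - W x) + norm \<beta> * norm (itg 0 x (h n) - W' x))"
          by (rule set_integral_add(1)) (rule set_integrable_mult_right, rule iable_norm, rule d)+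
        show "norm (\<alpha> * (itg 0 x (g n) - W x) + \<beta> * (itg 0 x (h n) - W' x)) \<le> norm \<alpha> * norm (itg 0 x (g n) - W x) + norm \<beta> * norm (itg 0 x (h n) - W' x)" for x
          unfolding norm_mult[symmetric] by (rule norm_triangle_ineq)
      qed
      also have "\<dots> = norm \<alpha> * itg 0 b (\<lambda>x. norm (itg 0 x (g n) - W x)) + norm \<beta> * itg 0 b (\<lambda>x. norm (itg 0 x (h n) - W' x))"
        by (subst set_integral_add(2)) (rule set_integrable_mult_right, rule iable_norm, rule d | simp)+
      finally show ?thesis .
    qed
    then show "\<forall>\<^sub>F n in sequentially. itg 0 b (\<lambda>x. norm (itg 0 x (\<lambda>s. \<alpha> * g n s + \<beta> * h n s) - (\<alpha> * W x + \<beta> * W' x)))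
      \<le> norm \<alpha> * itg 0 b (\<lambda>x. norm (itg 0 x (g n) - W x)) + norm \<beta> * itg 0 b (\<lambda>x. norm (itg 0 x (h n) - W' x))"
      by (intro always_eventually allI)
    show "\<forall>\<^sub>F n in sequentially. 0 \<le> itg 0 b (\<lambda>x. norm (itg 0 x (\<lambda>s. \<alpha> * g n s + \<beta> * h n s) - (\<alpha> * W x + \<beta> * W' x)))"
      by (intro always_eventually allI itg_nonneg norm_ge_zero)
  qed
  ultimately show ?thesis unfolding prim_conv_def by blast
qed

lemma iable_of_real: "iable a b h \<Longrightarrow> iable a b (\<lambda>x. complex_of_real (h x))"
  unfolding set_integrable_def complex_of_real_integrable_eq[symmetric] by (simp add: scaleR_conv_of_real)

lemma prim_conv_of_real:
  fixes g :: "nat \<Rightarrow> real \<Rightarrow> real"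
  assumes "prim_conv b g"
  shows "prim_conv b (\<lambda>n x. complex_of_real (g n x))"
proof -
  obtain W where W: "iable 0 b W" "(\<lambda>n. itg 0 b (\<lambda>x. norm (itg 0 x (g n) - W x))) \<longlonglongrightarrow> 0" and c: "convergent (\<lambda>n. itg 0 b (g n))"
    using assms(1) unfolding prim_conv_def by blast
  have "iable 0 b (\<lambda>x. complex_of_real (W x))"
    by (rule iable_of_real) (rule W(1))
  moreover have "convergent (\<lambda>n. complex_of_real (itg 0 b (g n)))"
  proof -
    obtain L where "(\<lambda>n. itg 0 b (g n)) \<longlonglongrightarrow> L" using c by (auto simp: convergent_def)
    then have "(\<lambda>n. complex_of_real (itg 0 b (g n))) \<longlonglongrightarrow> complex_of_real L" by (rule tendsto_of_real)
    then show ?thesis by (auto simp: convergent_def)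
  qed
  moreover have "(\<lambda>n. itg 0 b (\<lambda>x. norm (complex_of_real (itg 0 x (g n)) - complex_of_real (W x)))) \<longlonglongrightarrow> 0"
    using W(2) unfolding of_real_diff[symmetric] norm_of_real by simp
  ultimately show ?thesis unfolding prim_conv_def set_integral_complex_of_real by blast
qed

text \<open>Helly's theorem gives convergence at the continuity points of a monotone limit, hence
  off a countable set; the common bound \<open>C\<close> turns this into convergence in L1.\<close>

lemma helly_nonneg:
  fixes g :: "nat \<Rightarrow> real \<Rightarrow> real"
  assumes b: "0 \<le> b" and i: "\<And>n. iable 0 b (g n)" and nn: "\<And>n x. 0 \<le> g n x" and bd: "\<And>n. itg 0 b (g n) \<le> C"
  shows "\<exists>r. strict_mono r \<and> prim_conv b (\<lambda>n. g (r n))"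
proof -
  \<comment> \<open>Clamping the argument continues the primitives constantly to the whole line,
    where Helly's theorem is formulated.\<close>
  define cl where "cl x = max 0 (min b x)" for x
  have cl: "0 \<le> cl x" "cl x \<le> b" for x using b by (auto simp: cl_def)
  define G where "G n x = itg 0 (cl x) (g n)" for n x
  have Gb: "G n x = itg 0 x (g n)" if "0 \<le> x" "x \<le> b" for n x using that by (simp add: G_def cl_def)
  have Gcont: "continuous_on UNIV (G n)" for n
    unfolding G_def
    by (rule continuous_on_compose2[OF itg_continuous_on[OF i]]) (use cl in \<open>auto simp: cl_def intro!: continuous_intros\<close>)
  have Gle: "G n x \<le> G n y" if "x \<le> y" for n x y
    unfolding G_def
    by (rule itg_mono_sub[OF iable_sub[OF i]]) (use that nn cl[of y] in \<open>auto simp: cl_def\<close>)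
  have Gbd: "\<bar>G n x\<bar> \<le> C" for n x
  proof -
    have "0 \<le> G n x" unfolding G_def by (rule itg_nonneg) (rule nn)
    moreover have "G n x \<le> itg 0 b (g n)" unfolding G_def by (rule itg_mono_sub[OF i]) (use nn cl[of x] in auto)
    ultimately show ?thesis using bd[of n] by simp
  qed
  have "continuous (at_right x) (G n)" for n x
    using Gcont[of n] by (simp add: continuous_on_eq_continuous_at continuous_at_imp_continuous_at_within)
  then obtain s F where s: "strict_mono (s :: nat \<Rightarrow> nat)" and F: "mono F" "\<And>x. \<bar>F x\<bar> \<le> C"
    and lim: "\<And>x. isCont F x \<Longrightarrow> (\<lambda>n. G (s n) x) \<longlonglongrightarrow> F x"
    using Helly_selection[of G C] Gle Gbd unfolding mono_def by metis
  have Fm [measurable]: "F \<in> borel_measurable borel" using F(1) by (rule borel_measurable_mono)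
  have Gm [measurable]: "G n \<in> borel_measurable borel" for n using Gcont by (rule borel_measurable_continuous_onI)
  have cnt: "countable {x. \<not> isCont F x}" by (rule mono_ctble_discont[OF F(1)])
  have ae: "AE x in lborel. isCont F x"
    using AE_not_in[OF countable_imp_null_set_lborel[OF cnt]] by simp
  have C2: "iable 0 b (\<lambda>_. 2 * C)" by simp
  have "(\<lambda>n. itg 0 b (\<lambda>x. norm (G (s n) x - F x))) \<longlonglongrightarrow> integral\<^sup>L lborel (\<lambda>x::real. 0::real)"
    unfolding set_lebesgue_integral_def
  proof (rule integral_dominated_convergence[OF _ _ C2[unfolded set_integrable_def]])
    show "AE x in lborel. (\<lambda>n. indicator {0..b} x *\<^sub>R norm (G (s n) x - F x)) \<longlonglongrightarrow> 0"
      using ae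
    proof eventually_elim
      case (elim x)
      have "(\<lambda>n. indicator {0..b} x *\<^sub>R norm (G (s n) x - F x)) \<longlonglongrightarrow> indicator {0..b} x *\<^sub>R norm (F x - F x)"
        by (intro tendsto_intros lim elim)
      then show ?case by simp
    qed
    show "AE x in lborel. norm (indicator {0..b} x *\<^sub>R norm (G (s n) x - F x)) \<le> indicator {0..b} x *\<^sub>R (2 * C)" for n
    proof (rule AE_I2)
      fix x
      have "\<bar>G (s n) x - F x\<bar> \<le> 2 * C" using Gbd[of "s n" x] F(2)[of x] by linarith
      then show "norm (indicator {0..b} x *\<^sub>R norm (G (s n) x - F x)) \<le> indicator {0..b} x *\<^sub>R (2 * C)"
        by (auto simp: indicator_def)
    qed
    show "(\<lambda>x. 0) \<in> borel_measurable lborel" by simp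
    show "(\<lambda>x. indicator {0..b} x *\<^sub>R norm (G (s n) x - F x)) \<in> borel_measurable lborel" for n
      by (intro borel_measurable_scaleR borel_measurable_norm borel_measurable_diff borel_measurable_indicator) (use Fm Gm in auto)
  qed
  moreover have "itg 0 b (\<lambda>x. norm (G n x - F x)) = itg 0 b (\<lambda>x. norm (itg 0 x (g n) - F x))" for n
    by (rule itg_cong) (simp add: Gb)
  ultimately have L: "(\<lambda>n. itg 0 b (\<lambda>x. norm (itg 0 x (g (s n)) - F x))) \<longlonglongrightarrow> 0" by simp
  have Fi: "iable 0 b F"
    unfolding set_integrable_def
  proof (rule Bochner_Integration.integrable_bound)
    show "integrable lborel (\<lambda>x. indicator {0..b} x *\<^sub>R C)" using iable_const[of 0 b C] by (simp add: set_integrable_def)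
    show "AE x in lborel. norm (indicator {0..b} x *\<^sub>R F x) \<le> norm (indicator {0..b} x *\<^sub>R C)"
    proof (rule AE_I2)
      fix x
      have "\<bar>F x\<bar> \<le> \<bar>C\<bar>" using F(2)[of x] by linarith
      then show "norm (indicator {0..b} x *\<^sub>R F x) \<le> norm (indicator {0..b} x *\<^sub>R C)" by (auto simp: indicator_def)
    qed
    show "(\<lambda>x. indicator {0..b} x *\<^sub>R F x) \<in> borel_measurable lborel"
      by (intro borel_measurable_scaleR borel_measurable_indicator) (use Fm in auto)
  qed
  \<comment> \<open>The limit may jump at \<open>b\<close>. Beyond \<open>b\<close> the continued
    primitives are constant, so a continuity point there yields convergence of the full
    integrals.\<close>
  obtain y where y: "b < y" "isCont F y"
    using open_minus_countable[OF cnt, of "{b<..}"] by auto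
  have "(\<lambda>n. G (s n) y) \<longlonglongrightarrow> F y" by (rule lim[OF y(2)])
  moreover have "G n y = itg 0 b (g n)" for n using y b by (simp add: G_def cl_def)
  ultimately have "convergent (\<lambda>n. itg 0 b (g (s n)))" by (auto simp: convergent_def)
  then show ?thesis using s Fi L unfolding prim_conv_def by blast
qed

text \<open>Positive and negative parts have monotone primitives; the second subsequence is taken
  from the first.\<close>

lemma helly_real:
  fixes g :: "nat \<Rightarrow> real \<Rightarrow> real"
  assumes b: "0 \<le> b" and i: "\<And>n. iable 0 b (g n)" and bd: "\<And>n. itg 0 b (\<lambda>x. \<bar>g n x\<bar>) \<le> C"
  shows "\<exists>r. strict_mono r \<and> prim_conv b (\<lambda>n x. complex_of_real (g (r n) x))"
proof -
  define P N where "P n x = max 0 (g n x)" and "N n x = max 0 (- g n x)" for n x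
  have Pi: "iable 0 b (P n)" for n
  proof -
    have "iable 0 b (\<lambda>x. 1/2 * (\<bar>g n x\<bar> + g n x))"
      using iable_norm[OF i[of n]] by (intro set_integrable_mult_right set_integral_add(1) i) simp
    moreover have "(\<lambda>x. 1/2 * (\<bar>g n x\<bar> + g n x)) = P n" by (auto simp: P_def)
    ultimately show ?thesis by (simp only:)
  qed
  have Ni: "iable 0 b (N n)" for n
  proof -
    have "iable 0 b (\<lambda>x. 1/2 * (\<bar>g n x\<bar> - g n x))"
      using iable_norm[OF i[of n]] by (intro set_integrable_mult_right set_integral_diff(1) i) simp
    moreover have "(\<lambda>x. 1/2 * (\<bar>g n x\<bar> - g n x)) = N n" by (auto simp: N_def)
    ultimately show ?thesis by (simp only:)
  qed
  have ai: "iable 0 b (\<lambda>x. \<bar>g n x\<bar>)" for n using iable_norm[OF i[of n]] by simp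
  have "itg 0 b (P n) \<le> C" for n
    by (rule order_trans[OF itg_mono[OF Pi[of n] ai[of n]] bd[of n]]) (simp add: P_def)
  then obtain r where r: "strict_mono r" "prim_conv b (\<lambda>n. P (r n))"
    using helly_nonneg[of b P C] b Pi unfolding P_def by (metis max.cobounded1)
  have "itg 0 b (N n) \<le> C" for n
    by (rule order_trans[OF itg_mono[OF Ni[of n] ai[of n]] bd[of n]]) (simp add: N_def)
  then obtain q where q: "strict_mono q" "prim_conv b (\<lambda>n. N (r (q n)))"
    using helly_nonneg[of b "\<lambda>n. N (r n)" C] b Ni unfolding N_def by (metis max.cobounded1)
  have "prim_conv b (\<lambda>n x. 1 * complex_of_real (P (r (q n)) x) + (-1) * complex_of_real (N (r (q n)) x))"
    by (intro prim_conv_lin prim_conv_of_real iable_of_real Pi Ni b q prim_conv_subseq[OF r(2) q(1)])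
  moreover have "1 * complex_of_real (P n x) + (-1) * complex_of_real (N n x) = complex_of_real (g n x)" for n x
    by (auto simp: P_def N_def max_def)
  ultimately have "prim_conv b (\<lambda>n x. complex_of_real (g ((r \<circ> q) n) x))" by simp
  then show ?thesis using strict_mono_o[OF r(1) q(1)] by blast
qed

lemma helly_complex:
  fixes g :: "nat \<Rightarrow> real \<Rightarrow> complex"
  assumes b: "0 \<le> b" and i: "\<And>n. iable 0 b (g n)" and bd: "\<And>n. itg 0 b (\<lambda>x. cmod (g n x)) \<le> C"
  shows "\<exists>r. strict_mono r \<and> prim_conv b (\<lambda>n. g (r n))"
proof -
  have Ri: "iable 0 b (\<lambda>x. Re (g n x))" and Ii: "iable 0 b (\<lambda>x. Im (g n x))" for n
    using i[of n] unfolding set_integrable_def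
    by (auto dest: integrable_Re integrable_Im)
  have "itg 0 b (\<lambda>x. \<bar>Re (g n x)\<bar>) \<le> C" for n
    by (rule order_trans[OF itg_mono bd]) (use iable_norm[OF Ri[of n]] iable_norm[OF i[of n]] in \<open>auto simp: abs_Re_le_cmod\<close>)
  then obtain r where r: "strict_mono r" "prim_conv b (\<lambda>n x. complex_of_real (Re (g (r n) x)))"
    using helly_real[of b "\<lambda>n x. Re (g n x)" C] b Ri by blast
  have "itg 0 b (\<lambda>x. \<bar>Im (g n x)\<bar>) \<le> C" for n
    by (rule order_trans[OF itg_mono bd]) (use iable_norm[OF Ii[of n]] iable_norm[OF i[of n]] in \<open>auto simp: abs_Im_le_cmod\<close>)
  then obtain q where q: "strict_mono q" "prim_conv b (\<lambda>n x. complex_of_real (Im (g (r (q n)) x)))"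
    using helly_real[of b "\<lambda>n x. Im (g (r n) x)" C] b Ii by blast
  have "prim_conv b (\<lambda>n x. 1 * complex_of_real (Re (g (r (q n)) x)) + \<i> * complex_of_real (Im (g (r (q n)) x)))"
    by (intro prim_conv_lin iable_of_real Ri Ii b q prim_conv_subseq[OF r(2) q(1)])
  moreover have "1 * complex_of_real (Re w) + \<i> * complex_of_real (Im w) = w" for w
    by (simp add: complex_eq_iff)
  ultimately have "prim_conv b (\<lambda>n. g ((r \<circ> q) n))" by simp
  then show ?thesis using strict_mono_o[OF r(1) q(1)] by blast
qed

text \<open>A solution is determined by its initial value and the primitive of
  \<open>exp s * h s\<close>. At \<open>z = 1\<close> the factor \<open>exp (-x)\<close> is at most
  1, so L1 distances carry over.\<close>

lemma sol_limit:
  assumes b: "0 \<le> b" and h: "\<And>n. iable 0 b (h n)" and W: "prim_conv b (\<lambda>n s. exp (1 * of_real s) * h n s)" and a: "a \<longlonglongrightarrow> a'"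
  obtains f where "iable 0 b f" "(\<lambda>n. itg 0 b (\<lambda>x. cmod (sol 1 (a n) (h n) x - f x))) \<longlonglongrightarrow> 0"
proof -
  obtain W where W: "iable 0 b W" "(\<lambda>n. itg 0 b (\<lambda>x. cmod (mexp 1 (h n) x - W x))) \<longlonglongrightarrow> 0"
    using W unfolding prim_conv_def mexp_def by blast
  define f where "f x = (a' + W x) * exp (- 1 * of_real x)" for x
  have fi: "iable 0 b f"
    unfolding f_def by (rule iable_mult_continuous, rule set_integral_add(1), rule iable_const, rule W) (intro continuous_intros)
  have "(\<lambda>n. itg 0 b (\<lambda>x. cmod (sol 1 (a n) (h n) x - f x))) \<longlonglongrightarrow> 0"
  proof (rule tendsto_sandwich[OF _ _ tendsto_const])
    have "(\<lambda>n. b * cmod (a n - a') + itg 0 b (\<lambda>x. cmod (mexp 1 (h n) x - W x))) \<longlonglongrightarrow> b * cmod (a' - a') + 0"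
      by (intro tendsto_intros W a)
    then show "(\<lambda>n. b * cmod (a n - a') + itg 0 b (\<lambda>x. cmod (mexp 1 (h n) x - W x))) \<longlonglongrightarrow> 0" by simp
    have "itg 0 b (\<lambda>x. cmod (sol 1 (a n) (h n) x - f x)) \<le> b * cmod (a n - a') + itg 0 b (\<lambda>x. cmod (mexp 1 (h n) x - W x))" for n
    proof -
      have m: "continuous_on {0..b} (mexp 1 (h n))"
        unfolding mexp_def by (intro itg_continuous_on iable_exp_mult h)
      have mi: "iable 0 b (\<lambda>x. mexp 1 (h n) x - W x)" by (rule set_integral_diff(1)[OF iable_continuous[OF m] W(1)])
      have si: "iable 0 b (sol 1 (a n) (h n))"
        unfolding sol_def[abs_def] by (rule iable_continuous) (intro continuous_intros m)
      have "itg 0 b (\<lambda>x. cmod (sol 1 (a n) (h n) x - f x)) \<le> itg 0 b (\<lambda>x. cmod (a n - a') + cmod (mexp 1 (h n) x - W x))"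
      proof (rule itg_mono)
        show "iable 0 b (\<lambda>x. cmod (sol 1 (a n) (h n) x - f x))" by (rule iable_norm, rule set_integral_diff(1)[OF si fi])
        show "iable 0 b (\<lambda>x. cmod (a n - a') + cmod (mexp 1 (h n) x - W x))"
          by (rule set_integral_add(1)[OF iable_const iable_norm[OF mi]])
        fix x assume x: "0 \<le> x" "x \<le> b"
        have "sol 1 (a n) (h n) x - f x = exp (- 1 * of_real x) * ((a n - a') + (mexp 1 (h n) x - W x))"
          by (simp add: sol_def f_def algebra_simps)
        then have "cmod (sol 1 (a n) (h n) x - f x) = exp (- x) * cmod ((a n - a') + (mexp 1 (h n) x - W x))"
          by (simp add: norm_mult)
        also have "\<dots> \<le> 1 * cmod ((a n - a') + (mexp 1 (h n) x - W x))"
          by (rule mult_right_mono) (use x in auto)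
        also have "\<dots> \<le> cmod (a n - a') + cmod (mexp 1 (h n) x - W x)" using norm_triangle_ineq by simp
        finally show "cmod (sol 1 (a n) (h n) x - f x) \<le> cmod (a n - a') + cmod (mexp 1 (h n) x - W x)" .
      qed
      also have "\<dots> = itg 0 b (\<lambda>x. cmod (a n - a')) + itg 0 b (\<lambda>x. cmod (mexp 1 (h n) x - W x))"
        by (rule set_integral_add(2)[OF iable_const iable_norm[OF mi]])
      also have "itg 0 b (\<lambda>x. cmod (a n - a')) = b * cmod (a n - a')" using b by (simp add: itg_const)
      finally show ?thesis .
    qed
    then show "\<forall>\<^sub>F n in sequentially. itg 0 b (\<lambda>x. cmod (sol 1 (a n) (h n) x - f x)) \<le> b * cmod (a n - a') + itg 0 b (\<lambda>x. cmod (mexp 1 (h n) x - W x))"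
      by (intro always_eventually allI)
    show "\<forall>\<^sub>F n in sequentially. 0 \<le> itg 0 b (\<lambda>x. cmod (sol 1 (a n) (h n) x - f x))"
      by (intro always_eventually allI itg_nonneg norm_ge_zero)
  qed
  with fi show ?thesis by (rule that)
qed

lemma exp_mult_L1_bound:
  assumes "iable 0 b h" "0 \<le> b"
  shows "itg 0 b (\<lambda>s. cmod (exp (1 * of_real s) * h s)) \<le> exp b * itg 0 b (\<lambda>s. cmod (h s))"
proof -
  have "itg 0 b (\<lambda>s. cmod (exp (1 * of_real s) * h s)) \<le> itg 0 b (\<lambda>s. exp b * cmod (h s))"
  proof (rule itg_mono)
    show "iable 0 b (\<lambda>s. cmod (exp (1 * of_real s) * h s))" by (rule iable_norm, rule iable_exp_mult) fact
    show "iable 0 b (\<lambda>s. exp b * cmod (h s))" using assms(1) by (intro set_integrable_mult_right iable_norm)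
    show "cmod (exp (1 * of_real s) * h s) \<le> exp b * cmod (h s)" if "s \<le> b" for s
      using that by (simp add: norm_mult mult_right_mono)
  qed
  then show ?thesis by simp
qed

section \<open>Compactness of the resolvent on the network\<close>

context network
begin

lemma nrm_parts:
  "itg 0 1 (\<lambda>x. cmod (c1 f x)) \<le> nrm l f" "itg 0 1 (\<lambda>x. cmod (c2 f x)) \<le> nrm l f" "itg 0 l (\<lambda>x. cmod (c3 f x)) \<le> nrm l f"
  using itg_nonneg[of 0 1 "\<lambda>s. cmod (c1 f s)"] itg_nonneg[of 0 1 "\<lambda>s. cmod (c2 f s)"] itg_nonneg[of 0 l "\<lambda>s. cmod (c3 f s)"]
  by (simp_all add: nrm_def)

lemma A_compact_resolvent: "compact_resolvent l"
  unfolding compact_resolvent_def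
proof (intro bexI[of _ 1] allI impI)
  show "1 \<in> resolvent_set l" using K_1 by (simp add: resolvent_set_iff)
  fix hs fs
  assume "\<forall>n::nat. inE l (hs n) \<and> nrm l (hs n) \<le> 1 \<and> (fs n, vsub (vscale 1 (fs n)) (hs n)) \<in> graphA l"
  then have hE: "inE l (hs n)" and h1: "nrm l (hs n) \<le> 1" and gr: "(fs n, vsub (vscale 1 (fs n)) (hs n)) \<in> graphA l" for n by auto
  have i: "iable 0 1 (c1 (hs n))" "iable 0 1 (c2 (hs n))" "iable 0 l (c3 (hs n))" for n
    using hE[of n] unfolding inE_def by blast+
  have n: "itg 0 1 (\<lambda>x. cmod (c1 (hs n) x)) \<le> 1" "itg 0 1 (\<lambda>x. cmod (c2 (hs n) x)) \<le> 1" "itg 0 l (\<lambda>x. cmod (c3 (hs n) x)) \<le> 1" for n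
    using h1[of n] nrm_parts[of "hs n"] by linarith+
  let ?q = "\<lambda>h s. exp (1 * of_real s) * h s :: complex"
  have bd: "itg 0 b (\<lambda>s. cmod (?q h s)) \<le> exp b" if "iable 0 b h" "0 \<le> b" "itg 0 b (\<lambda>x. cmod (h x)) \<le> 1" for b h
  proof -
    have "exp b * itg 0 b (\<lambda>s. cmod (h s)) \<le> exp b * 1" using that by (intro mult_left_mono) auto
    then show ?thesis using exp_mult_L1_bound[OF that(1,2)] by linarith
  qed
  have "\<exists>r. strict_mono r \<and> prim_conv 1 (\<lambda>n. ?q (c1 (hs (r n))))"
    by (rule helly_complex[where C="exp 1"]) (rule zero_le_one iable_exp_mult[OF i(1)] bd[OF i(1) zero_le_one n(1)])+
  then obtain r1 where r1: "strict_mono r1" "prim_conv 1 (\<lambda>n. ?q (c1 (hs (r1 n))))" by blast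
  have "\<exists>r. strict_mono r \<and> prim_conv 1 (\<lambda>n. ?q (c2 (hs (r1 (r n)))))"
    by (rule helly_complex[where C="exp 1" and g="\<lambda>n. ?q (c2 (hs (r1 n)))"]) (rule zero_le_one iable_exp_mult[OF i(2)] bd[OF i(2) zero_le_one n(2)])+
  then obtain r2 where r2: "strict_mono r2" "prim_conv 1 (\<lambda>n. ?q (c2 (hs (r1 (r2 n)))))" by blast
  have "\<exists>r. strict_mono r \<and> prim_conv l (\<lambda>n. ?q (c3 (hs (r1 (r2 (r n))))))"
    by (rule helly_complex[where C="exp l" and g="\<lambda>n. ?q (c3 (hs (r1 (r2 n))))"]) (rule less_imp_le[OF l_pos] iable_exp_mult[OF i(3)] bd[OF i(3) less_imp_le[OF l_pos] n(3)])+
  then obtain r3 where r3: "strict_mono r3" "prim_conv l (\<lambda>n. ?q (c3 (hs (r1 (r2 (r3 n))))))" by blast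
  define r where "r n = r1 (r2 (r3 n))" for n
  have r: "strict_mono r" unfolding r_def using strict_mono_o[OF r1(1) strict_mono_o[OF r2(1) r3(1)]] by (simp add: o_def)
  have p1: "prim_conv 1 (\<lambda>n. ?q (c1 (hs (r n))))"
    using prim_conv_subseq[OF prim_conv_subseq[OF r1(2) r2(1)] r3(1)] by (simp add: r_def)
  have p2: "prim_conv 1 (\<lambda>n. ?q (c2 (hs (r n))))"
    using prim_conv_subseq[OF r2(2) r3(1)] by (simp add: r_def)
  have p3: "prim_conv l (\<lambda>n. ?q (c3 (hs (r n))))" using r3(2) by (simp add: r_def)
  obtain H1 where H1: "(\<lambda>n. mexp 1 (c1 (hs (r n))) 1) \<longlonglongrightarrow> H1" using p1 unfolding prim_conv_def convergent_def mexp_def by blast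
  obtain H2 where H2: "(\<lambda>n. mexp 1 (c2 (hs (r n))) 1) \<longlonglongrightarrow> H2" using p2 unfolding prim_conv_def convergent_def mexp_def by blast
  obtain H3 where H3: "(\<lambda>n. mexp 1 (c3 (hs (r n))) l) \<longlonglongrightarrow> H3" using p3 unfolding prim_conv_def convergent_def mexp_def by blast
  \<comment> \<open>The inflows depend on the data only through three integrals over whole edges. L1
    convergence of the primitives does not control their end values, which is why
    \<open>prim_conv\<close> demands this convergence separately.\<close>
  have ac: "(\<lambda>n. acoef 1 (hs (r n))) \<longlonglongrightarrow> rcoef 1 H1 H2 H3"
    unfolding acoef_def rcoef_def by (intro tendsto_intros H1 H2 H3 K_1) simp
  obtain f1 where f1: "iable 0 1 f1" "(\<lambda>n. itg 0 1 (\<lambda>x. cmod (sol 1 0 (c1 (hs (r n))) x - f1 x))) \<longlonglongrightarrow> 0"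
    by (rule sol_limit[OF _ i(1) p1 tendsto_const]) simp
  have a2: "(\<lambda>n. acoef 1 (hs (r n)) - exp (- 1) * mexp 1 (c1 (hs (r n))) 1 / 3) \<longlonglongrightarrow> rcoef 1 H1 H2 H3 - exp (- 1) * H1 / 3"
    by (intro tendsto_intros ac H1) simp
  obtain f2 where f2: "iable 0 1 f2" "(\<lambda>n. itg 0 1 (\<lambda>x. cmod (sol 1 (acoef 1 (hs (r n)) - exp (- 1) * mexp 1 (c1 (hs (r n))) 1 / 3) (c2 (hs (r n))) x - f2 x))) \<longlonglongrightarrow> 0"
    by (rule sol_limit[OF _ i(2) p2 a2]) simp
  have a3: "(\<lambda>n. acoef 1 (hs (r n)) + 2 * exp (- 1) * mexp 1 (c1 (hs (r n))) 1 / 3) \<longlonglongrightarrow> rcoef 1 H1 H2 H3 + 2 * exp (- 1) * H1 / 3"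
    by (intro tendsto_intros ac H1) simp
  obtain f3 where f3: "iable 0 l f3" "(\<lambda>n. itg 0 l (\<lambda>x. cmod (sol 1 (acoef 1 (hs (r n)) + 2 * exp (- 1) * mexp 1 (c1 (hs (r n))) 1 / 3) (c3 (hs (r n))) x - f3 x))) \<longlonglongrightarrow> 0"
    by (rule sol_limit[OF _ i(3) p3 a3]) (use l_pos in simp)
  have fE: "inE l (f1, f2, f3)" using f1 f2 f3 by (simp add: inE_def)
  have "dst (fs n) (f1, f2, f3) = dst (R 1 (hs n)) (f1, f2, f3)" for n
    by (rule nrm_vsub_aeq) (use graphA_inE[OF gr] R_graph[OF hE K_1] R_unique[OF gr hE K_1] fE in auto)
  moreover have "(\<lambda>n. dst (R 1 (hs (r n))) (f1, f2, f3)) \<longlonglongrightarrow> 0 + 0 + 0"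
    unfolding nrm_def c_vsub c_triple R_def by (intro tendsto_add f1 f2 f3)
  ultimately have "(\<lambda>n. dst (fs (r n)) (f1, f2, f3)) \<longlonglongrightarrow> 0" by simp
  then show "\<exists>r f. strict_mono r \<and> inE l f \<and> (\<lambda>n. dst (fs (r n)) f) \<longlonglongrightarrow> 0"
    using r fE by blast
qed

section \<open>Averages of the extended profiles and density of the domain\<close>

definition sav :: "real \<Rightarrow> (real \<Rightarrow> complex) \<Rightarrow> real \<Rightarrow> complex" where
  "sav t G y = (1/t) *\<^sub>R itg (y - t) y G"

text \<open>The mean of \<open>S s f\<close> over times \<open>s\<close> from 0 to \<open>t\<close>,
  computed pointwise. Averaging the extended profiles rather than the components respects the
  boundary conditions.\<close>

definition avg :: "real \<Rightarrow> vec \<Rightarrow> vec" where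
  "avg t f = (sav t (e1 f), sav t (e2 f), sav t (e3 f))"

lemma sav_e1_neg: "y \<le> 0 \<Longrightarrow> sav t (e1 f) y = 0"
proof -
  assume y: "y \<le> 0"
  have "itg (y - t) y (e1 f) = itg (y - t) y (\<lambda>_. 0)"
    by (rule itg_spike[of _ _ 0]) (use y in \<open>simp add: e1_neg\<close>)
  then show ?thesis by (simp add: sav_def)
qed

text \<open>Averaging preserves the linear recursion and extends it to \<open>y = 0\<close>, since
  one point does not affect an integral; at \<open>y = 0\<close> it is the boundary
  condition.\<close>

lemma sav_rec:
  assumes f: "inE l f" and y: "y \<le> 0"
  shows "sav t (e2 f) y = 1/2 * sav t (e2 f) (y + 1) + 1/2 * sav t (e3 f) (y + l) - 1/3 * sav t (e1 f) (y + 1)"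
    "sav t (e3 f) y = 1/2 * sav t (e2 f) (y + 1) + 1/2 * sav t (e3 f) (y + l) + 2/3 * sav t (e1 f) (y + 1)"
proof -
  note ii = iable_e1[OF f] iable_e23(1)[OF f] iable_e23(2)[OF f]
  have sh: "iable (y - t) y (\<lambda>x. e1 f (x + 1))" "iable (y - t) y (\<lambda>x. e2 f (x + 1))" "iable (y - t) y (\<lambda>x. e3 f (x + l))"
    unfolding iable_shift by (rule ii)+
  have eq: "y - t + 1 = y + 1 - t" "y - t + l = y + l - t" by auto
  have "itg (y - t) y (e2 f) = itg (y - t) y (\<lambda>x. 1/2 * e2 f (x + 1) + 1/2 * e3 f (x + l) - 1/3 * e1 f (x + 1))"
    by (rule itg_spike[of _ _ 0]) (use y in \<open>simp add: e2_neg\<close>)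
  also have "\<dots> = 1/2 * itg (y - t) y (\<lambda>s. e2 f (s + 1)) + 1/2 * itg (y - t) y (\<lambda>s. e3 f (s + l)) - 1/3 * itg (y - t) y (\<lambda>s. e1 f (s + 1))"
    by (subst set_integral_diff(2), (intro set_integral_add set_integrable_mult_right sh)+, subst set_integral_add(2), (intro set_integrable_mult_right sh)+) simp
  finally show "sav t (e2 f) y = 1/2 * sav t (e2 f) (y + 1) + 1/2 * sav t (e3 f) (y + l) - 1/3 * sav t (e1 f) (y + 1)"
    unfolding sav_def itg_shift eq by (simp add: scaleR_add_right scaleR_diff_right)
  have "itg (y - t) y (e3 f) = itg (y - t) y (\<lambda>x. 1/2 * e2 f (x + 1) + 1/2 * e3 f (x + l) + 2/3 * e1 f (x + 1))"
    by (rule itg_spike[of _ _ 0]) (use y in \<open>simp add: e3_neg\<close>)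
  also have "\<dots> = 1/2 * itg (y - t) y (\<lambda>s. e2 f (s + 1)) + 1/2 * itg (y - t) y (\<lambda>s. e3 f (s + l)) + 2/3 * itg (y - t) y (\<lambda>s. e1 f (s + 1))"
    by (subst set_integral_add(2), (intro set_integral_add set_integrable_mult_right sh)+, subst set_integral_add(2), (intro set_integrable_mult_right sh)+) simp
  finally show "sav t (e3 f) y = 1/2 * sav t (e2 f) (y + 1) + 1/2 * sav t (e3 f) (y + l) + 2/3 * sav t (e1 f) (y + 1)"
    unfolding sav_def itg_shift eq by (simp add: scaleR_add_right)
qed

lemma e_avg:
  assumes f: "inE l f"
  shows "y \<le> 1 \<Longrightarrow> e1 (avg t f) y = sav t (e1 f) y" "y \<le> 1 \<Longrightarrow> e2 (avg t f) y = sav t (e2 f) y" "y \<le> l \<Longrightarrow> e3 (avg t f) y = sav t (e3 f) y"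
  by (rule ext_unique[where ?G1.0="sav t (e1 f)" and ?G2.0="sav t (e2 f)" and ?G3.0="sav t (e3 f)"];
    (simp add: avg_def sav_e1_neg; fail)?, (rule sav_rec[OF f]; simp; fail)?)+

text \<open>For positive \<open>t\<close> the derivative of a moving average is
  \<open>(G x - G (x - t)) / t\<close>; the sign follows the convention of
  \<open>AC\<close>.\<close>

lemma AC_sav:
  assumes G: "\<And>a b. iable a b G" and t: "0 \<le> t"
  shows "AC b (sav t G) (\<lambda>x. - (1/t) *\<^sub>R (G x - G (x - t)))"
  unfolding AC_def
proof
  fix x assume x: "x \<in> {0..b}"
  have Gt: "iable a b (\<lambda>x. G (x - t))" for a b using G iable_shift[of a b G "-t"] by simp
  have 1: "itg (-t) x G = itg (-t) 0 G + itg 0 x G" by (rule itg_combine) (use x t G in auto)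
  have 2: "itg (-t) x G = itg (-t) (x - t) G + itg (x - t) x G" by (rule itg_combine) (use x t G in auto)
  have 3: "itg 0 x (\<lambda>s. G (s - t)) = itg (-t) (x - t) G" using itg_shift[of 0 x G "-t"] by simp
  have "itg 0 x (\<lambda>x. - (1/t) *\<^sub>R (G x - G (x - t))) = - (1/t) *\<^sub>R itg 0 x (\<lambda>x. G x - G (x - t))"
    by (rule set_integral_scaleR_right)
  also have "itg 0 x (\<lambda>x. G x - G (x - t)) = itg 0 x G - itg (-t) (x - t) G"
    unfolding 3[symmetric] by (rule set_integral_diff(2)[OF G Gt])
  also have "itg 0 x G - itg (-t) (x - t) G = itg (x - t) x G - itg (-t) 0 G"
    using 1 2 by (simp add: algebra_simps)
  finally show "sav t G x = sav t G 0 - itg 0 x (\<lambda>x. - (1/t) *\<^sub>R (G x - G (x - t)))"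
    by (simp only: sav_def) (simp add: scaleR_diff_right)
qed

lemma inE_avg:
  assumes f: "inE l f" and t: "0 \<le> t"
  shows "inE l (avg t f)"
proof -
  have "iable 0 b (sav t G)" if "\<And>a b. iable a b G" for b G
    unfolding sav_def[abs_def]
    by (rule set_integrable_scaleR_right, rule iable_continuous, rule iable_average[OF that t])
  then show ?thesis unfolding inE_def avg_def c_triple using iable_e[OF f] by blast
qed

lemma avg_domain:
  assumes f: "inE l f" and t: "0 \<le> t"
  shows "avg t f \<in> domA l"
proof -
  let ?h = "\<lambda>G x. - (1/t) *\<^sub>R (G x - G (x - t)) :: complex"
  have Gt: "iable a b (?h G)" if "\<And>a b. iable a b G" for a b G
  proof -
    have "iable a b (\<lambda>x. G (x - t))" using that iable_shift[of a b G "-t"] by simp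
    then show ?thesis by (intro set_integrable_scaleR_right set_integral_diff that)
  qed
  have hE: "inE l (?h (e1 f), ?h (e2 f), ?h (e3 f))"
    unfolding inE_def c_triple by (intro conjI Gt iable_e f)
  have "regular l (avg t f) (?h (e1 f), ?h (e2 f), ?h (e3 f))"
    unfolding regular_def avg_def c_triple bc_def
    using sav_rec[OF f, of 0 t] by (intro conjI AC_sav iable_e f t) (simp_all add: sav_e1_neg)
  then have "(avg t f, (?h (e1 f), ?h (e2 f), ?h (e3 f))) \<in> graphA l"
    unfolding graphA_iff using hE inE_avg[OF f t] aeq_refl by blast
  then show ?thesis unfolding domA_def by force
qed

lemma avg_tendsto:
  assumes f: "inE l f"
  shows "((\<lambda>t. dst f (avg t f)) \<longlongrightarrow> 0) (at_right 0)"
proof -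
  have "((\<lambda>t. itg 0 1 (\<lambda>x. cmod ((1/t) *\<^sub>R itg (x - t) x (e1 f) - e1 f x)) + itg 0 1 (\<lambda>x. cmod ((1/t) *\<^sub>R itg (x - t) x (e2 f) - e2 f x))
     + itg 0 l (\<lambda>x. cmod ((1/t) *\<^sub>R itg (x - t) x (e3 f) - e3 f x))) \<longlongrightarrow> 0 + 0 + 0) (at_right 0)"
    using l_pos by (intro tendsto_add L1_average iable_e f) auto
  moreover have "dst f (avg t f) = itg 0 1 (\<lambda>x. cmod ((1/t) *\<^sub>R itg (x - t) x (e1 f) - e1 f x)) + itg 0 1 (\<lambda>x. cmod ((1/t) *\<^sub>R itg (x - t) x (e2 f) - e2 f x))
     + itg 0 l (\<lambda>x. cmod ((1/t) *\<^sub>R itg (x - t) x (e3 f) - e3 f x))" for t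
    unfolding nrm_vsub_commute[of l f] nrm_def c_vsub avg_def c_triple sav_def
    by (intro arg_cong2[where f="(+)"] itg_cong) (auto simp: e1_base e2_base e3_base norm_minus_commute)
  ultimately show ?thesis by simp
qed

lemma avg_approx:
  assumes f: "inE l f" and e: "0 < e"
  obtains t where "0 < t" "dst f (avg t f) < e"
proof -
  have "\<forall>\<^sub>F t in at_right 0. dst f (avg t f) < e"
    using order_tendstoD(2)[OF avg_tendsto[OF f]] e by simp
  then obtain b where b: "0 < b" "\<And>t. 0 < t \<Longrightarrow> t < b \<Longrightarrow> dst f (avg t f) < e"
    unfolding eventually_at_right_field by auto
  show ?thesis by (rule that[of "b/2"]) (use b in auto)
qed

lemma A_dense: "densely_defined l"
  unfolding densely_defined_def
proof (intro allI impI)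
  fix f and e :: real assume f: "inE l f" and e: "0 < e"
  obtain t where "0 < t" "dst f (avg t f) < e" by (rule avg_approx[OF f e])
  then show "\<exists>g\<in>domA l. dst f g < e" by (intro bexI[of _ "avg t f"] avg_domain f) auto
qed

end

section \<open>Long-term behaviour\<close>

text \<open>Finitely many multiples of \<open>l\<close> approximate a fine grid modulo 1, by
  Kronecker's theorem. Beyond the largest of them a natural number \<open>m\<close> corrects the
  integer part. On a window of fixed length the number of summands is bounded by one
  \<open>N\<close>, needed because each step of the delay equation costs a factor 2.\<close>

lemma irrational_semigroup_dense:
  fixes l \<delta> L :: real
  assumes l: "0 < l" "l \<notin> \<rat>" and \<delta>: "0 < \<delta>"
  obtains B :: real and N :: nat where "0 \<le> B"
    "\<And>s. B \<le> s \<Longrightarrow> s \<le> B + L \<Longrightarrow> \<exists>m n::nat. m + n \<le> N \<and> \<bar>s - (real m + real n * l)\<bar> < \<delta>"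
proof -
  obtain q :: nat where q: "q > 0" "1 / real q < \<delta> / 2"
    by (metis \<delta> half_gt_zero inverse_eq_divide real_arch_inverse neq0_conv)
  have "\<exists>k::nat. \<bar>frac (real k * l) - real i / real q\<bar> < \<delta> / 2" if "i \<le> q" for i
  proof -
    have "0 \<le> real i / real q" "real i / real q \<le> 1" using that q by auto
    from Kronecker_approx_1_explicit[OF l(2) this, of "\<delta>/2"] show ?thesis using \<delta> by (metis half_gt_zero)
  qed
  then obtain k :: "nat \<Rightarrow> nat" where k: "\<And>i. i \<le> q \<Longrightarrow> \<bar>frac (real (k i) * l) - real i / real q\<bar> < \<delta> / 2" by metis
  define M where "M = Max (k ` {..q})"
  have kM: "k i \<le> M" if "i \<le> q" for i unfolding M_def using that by (intro Max_ge) auto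
  define B where "B = real M * l + 1"
  define N where "N = M + nat \<lceil>B + L\<rceil>"
  show ?thesis
  proof (rule that[of B N])
    show "0 \<le> B" using l by (simp add: B_def)
    fix s assume s: "B \<le> s" "s \<le> B + L"
    have s0: "0 \<le> s" using s l unfolding B_def by (smt (verit) mult_nonneg_nonneg of_nat_0_le_iff)
    define i where "i = nat \<lfloor>frac s * real q\<rfloor>"
    have fl: "0 \<le> frac s * real q" "frac s * real q < real q" using frac_lt_1[of s] q by auto
    have "real i = of_int \<lfloor>frac s * real q\<rfloor>" unfolding i_def using fl(1) by simp
    then have i1: "real i \<le> frac s * real q" "frac s * real q < real i + 1" by linarith+
    then have iq: "i \<le> q" using fl(2) by linarith
    have "real i / real q \<le> frac s" using i1(1) q by (simp add: pos_divide_le_eq)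
    moreover have "frac s < real i / real q + 1 / real q"
      using i1(2) q by (simp add: add_divide_distrib[symmetric] pos_less_divide_eq)
    ultimately have f: "\<bar>frac s - frac (real (k i) * l)\<bar> < \<delta>" using k[OF iq] q(2) by linarith
    \<comment> \<open>Nonnegative because \<open>s\<close> lies beyond \<open>B\<close>, hence
      beyond \<open>k i * l\<close>.\<close>
    define m where "m = nat (\<lfloor>s\<rfloor> - \<lfloor>real (k i) * l\<rfloor>)"
    have "real (k i) * l \<le> real M * l" using kM[OF iq] l by (intro mult_right_mono) auto
    then have "real (k i) * l \<le> s" using s(1) unfolding B_def by linarith
    then have "\<lfloor>real (k i) * l\<rfloor> \<le> \<lfloor>s\<rfloor>" by (rule floor_mono)
    then have m: "real m = of_int \<lfloor>s\<rfloor> - of_int \<lfloor>real (k i) * l\<rfloor>" by (simp add: m_def)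
    have "s - (real m + real (k i) * l) = frac s - frac (real (k i) * l)"
      unfolding m frac_def by simp
    then have 1: "\<bar>s - (real m + real (k i) * l)\<bar> < \<delta>" using f by simp
    have "0 \<le> \<lfloor>real (k i) * l\<rfloor>" using l by simp
    then have "int m \<le> \<lfloor>s\<rfloor>" using \<open>\<lfloor>real (k i) * l\<rfloor> \<le> \<lfloor>s\<rfloor>\<close> by (simp add: m_def)
    also have "\<dots> \<le> \<lceil>B + L\<rceil>" using s(2) by linarith
    finally have "m \<le> nat \<lceil>B + L\<rceil>" by linarith
    then have "m + k i \<le> N" using kM[OF iq] by (simp add: N_def)
    then show "\<exists>m n::nat. m + n \<le> N \<and> \<bar>s - (real m + real n * l)\<bar> < \<delta>" using 1 by blast
  qed
qed

text \<open>Method of steps: the known range grows by \<open>min 1 l\<close> at a time, and there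
  both delayed arguments fall into the part already covered.\<close>

lemma delay_induct:
  fixes l a s :: real
  assumes l: "0 < l" and s: "a \<le> s"
    and base: "\<And>s. a \<le> s \<Longrightarrow> s \<le> a + max 1 l \<Longrightarrow> P s"
    and step: "\<And>s. a + max 1 l \<le> s \<Longrightarrow> P (s - 1) \<Longrightarrow> P (s - l) \<Longrightarrow> P s"
  shows "P s"
proof -
  define d where "d = min 1 l"
  have d: "0 < d" "d \<le> 1" "d \<le> l" using l by (auto simp: d_def)
  have "\<forall>s. a \<le> s \<and> s \<le> a + max 1 l + real n * d \<longrightarrow> P s" for n
  proof (induction n)
    case 0
    then show ?case using base by simp
  next
    case (Suc n)
    show ?case
    proof (intro allI impI, elim conjE)
      fix s assume s: "a \<le> s" "s \<le> a + max 1 l + real (Suc n) * d"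
      show "P s"
      proof (cases "a + max 1 l \<le> s")
        case True
        have "a \<le> s - 1" "s - 1 \<le> a + max 1 l + real n * d" "a \<le> s - l" "s - l \<le> a + max 1 l + real n * d"
          using True s d by (auto simp: algebra_simps max_def split: if_splits)
        then show ?thesis using Suc step[OF True] by blast
      qed (use base s in auto)
    qed
  qed
  moreover obtain n :: nat where "(s - a) / d \<le> real n" using real_arch_simple by blast
  then have "s \<le> a + max 1 l + real n * d" using d l by (simp add: field_simps)
  ultimately show ?thesis using s by blast
qed

text \<open>Solutions of the averaging delay equation converge: a value close to the lower limit is
  propagated by the equation to all \<open>x + m + n l\<close>, a set which becomes arbitrarily dense when \<open>l\<close> is
  irrational, and so pushes down the upper limit.\<close>

lemma delay_average_converges:
  fixes V :: "real \<Rightarrow> real" and l a :: real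
  assumes l: "0 < l" "l \<notin> \<rat>" and cont: "\<And>b. continuous_on {a..b} V"
    and eq: "\<And>t. a + max 1 l \<le> t \<Longrightarrow> V t = (V (t - 1) + V (t - l)) / 2"
  shows "\<exists>c. (V \<longlongrightarrow> c) at_top"
proof -
  define L where "L = max 1 l"
  have L: "1 \<le> L" "l \<le> L" "0 < L" by (auto simp: L_def)
  \<comment> \<open>Averages respect bounds, so a bound on one window of length \<open>L\<close>
    holds for ever after.\<close>
  have prop_le: "V s \<le> C" if "a \<le> t" "\<And>s. t \<le> s \<Longrightarrow> s \<le> t + L \<Longrightarrow> V s \<le> C" "t \<le> s" for t C s
  proof (rule delay_induct[OF l(1) that(3)])
    show "V s \<le> C" if "t \<le> s" "s \<le> t + max 1 l" for s using \<open>\<And>s. t \<le> s \<Longrightarrow> s \<le> t + L \<Longrightarrow> V s \<le> C\<close> that by (simp add: L_def)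
    show "V s \<le> C" if "t + max 1 l \<le> s" "V (s - 1) \<le> C" "V (s - l) \<le> C" for s
      using eq[of s] that \<open>a \<le> t\<close> by simp
  qed
  have prop_ge: "C \<le> V s" if "a \<le> t" "\<And>s. t \<le> s \<Longrightarrow> s \<le> t + L \<Longrightarrow> C \<le> V s" "t \<le> s" for t C s
  proof (rule delay_induct[OF l(1) that(3)])
    show "C \<le> V s" if "t \<le> s" "s \<le> t + max 1 l" for s using \<open>\<And>s. t \<le> s \<Longrightarrow> s \<le> t + L \<Longrightarrow> C \<le> V s\<close> that by (simp add: L_def)
    show "C \<le> V s" if "t + max 1 l \<le> s" "C \<le> V (s - 1)" "C \<le> V (s - l)" for s
      using eq[of s] that \<open>a \<le> t\<close> by simp
  qed
  \<comment> \<open>The modulus of continuity on the initial window is inherited, since differences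
    of \<open>V\<close> are averages of earlier differences. The extra length 1 covers pairs that
    straddle the end of that window.\<close>
  have unif: "\<exists>\<delta>>0. \<delta> \<le> 1 \<and> (\<forall>s\<ge>a. \<forall>t\<ge>a. \<bar>s - t\<bar> < \<delta> \<longrightarrow> \<bar>V s - V t\<bar> \<le> \<epsilon>)" if "\<epsilon> > 0" for \<epsilon>
  proof -
    have "uniformly_continuous_on {a..a + L + 1} V"
      by (rule compact_uniformly_continuous[OF cont]) simp
    note uc = this[unfolded uniformly_continuous_on_def, THEN spec, THEN mp, OF that]
    obtain d where d: "d > 0" "\<forall>x\<in>{a..a + L + 1}. \<forall>y\<in>{a..a + L + 1}. dist y x < d \<longrightarrow> dist (V y) (V x) < \<epsilon>"
      by (rule exE[OF uc], elim conjE) (rule that)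
    have loc: "\<bar>V s - V t\<bar> \<le> \<epsilon>" if "a \<le> s" "s \<le> a + L + 1" "a \<le> t" "t \<le> a + L + 1" "\<bar>s - t\<bar> < d" for s t
      using bspec[OF bspec[OF d(2), of t], of s] that by (simp add: dist_real_def)
    have "\<forall>t\<ge>a. \<bar>s - t\<bar> < min d 1 \<longrightarrow> \<bar>V s - V t\<bar> \<le> \<epsilon>" if "a \<le> s" for s
    proof (rule delay_induct[OF l(1) that])
      show "\<forall>t\<ge>a. \<bar>s - t\<bar> < min d 1 \<longrightarrow> \<bar>V s - V t\<bar> \<le> \<epsilon>" if "a \<le> s" "s \<le> a + max 1 l" for s
        using that L unfolding L_def[symmetric] by (intro allI impI loc) auto
      show "\<forall>t\<ge>a. \<bar>s - t\<bar> < min d 1 \<longrightarrow> \<bar>V s - V t\<bar> \<le> \<epsilon>"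
        if s: "a + max 1 l \<le> s" and 1: "\<forall>t\<ge>a. \<bar>(s - 1) - t\<bar> < min d 1 \<longrightarrow> \<bar>V (s - 1) - V t\<bar> \<le> \<epsilon>"
          and 2: "\<forall>t\<ge>a. \<bar>(s - l) - t\<bar> < min d 1 \<longrightarrow> \<bar>V (s - l) - V t\<bar> \<le> \<epsilon>" for s
      proof (intro allI impI)
        fix t assume t: "a \<le> t" "\<bar>s - t\<bar> < min d 1"
        show "\<bar>V s - V t\<bar> \<le> \<epsilon>"
        proof (cases "a + max 1 l \<le> t")
          case True
          have "a \<le> t - 1" "a \<le> t - l" using True by auto
          then have "\<bar>V (s - 1) - V (t - 1)\<bar> \<le> \<epsilon>" "\<bar>V (s - l) - V (t - l)\<bar> \<le> \<epsilon>"
            using 1 2 t by auto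
          moreover have "V s - V t = ((V (s - 1) - V (t - 1)) + (V (s - l) - V (t - l))) / 2"
            unfolding eq[OF s] eq[OF True] by (simp add: field_simps)
          ultimately show ?thesis unfolding abs_le_iff by simp
        next
          case False
          then show ?thesis using t s L unfolding L_def[symmetric] by (intro loc) auto
        qed
      qed
    qed
    then show ?thesis using d(1) by (intro exI[of _ "min d 1"]) auto
  qed
  have cimg: "compact (V ` {a..a + L})" by (rule compact_continuous_image[OF cont compact_Icc])
  obtain b where b: "\<And>s. s \<in> {a..a + L} \<Longrightarrow> \<bar>V s\<bar> \<le> b"
    using compact_imp_bounded[OF cimg] unfolding bounded_iff by (metis imageI real_norm_def)
  have V_le: "V s \<le> b" and V_ge: "- b \<le> V s" if "a \<le> s" for s
    using prop_le[of a b s] prop_ge[of a "-b" s] b that by (force simp: abs_le_iff)+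
  \<comment> \<open>Eventual upper and lower bounds, so that \<open>Inf X\<close> and
    \<open>Sup Y\<close> are the limits superior and inferior at infinity.\<close>
  define X where "X = {C. \<exists>t\<ge>a. \<forall>s\<ge>t. V s \<le> C}"
  define Y where "Y = {C. \<exists>t\<ge>a. \<forall>s\<ge>t. C \<le> V s}"
  have XY: "y \<le> x" if xy: "x \<in> X" "y \<in> Y" for x y
  proof -
    obtain t t' where "\<forall>s\<ge>t. V s \<le> x" "\<forall>s\<ge>t'. y \<le> V s" using xy unfolding X_def Y_def by blast
    then have "V (max t t') \<le> x" "y \<le> V (max t t')" by auto
    then show ?thesis by linarith
  qed
  have bX: "b \<in> X" and bY: "- b \<in> Y" unfolding X_def Y_def using V_le V_ge by auto
  have bdX: "bdd_below X" and bdY: "bdd_above Y"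
    using XY bX bY unfolding bdd_below_def bdd_above_def by blast+
  define M m where "M = Inf X" and "m = Sup Y"
  have mx: "m \<le> x" if "x \<in> X" for x unfolding m_def using bY XY[OF that] by (intro cSup_least) auto
  have mM: "m \<le> M" unfolding M_def using bX mx by (intro cInf_greatest) auto
  have upper: "\<exists>t\<ge>a. \<forall>s\<ge>t. V s \<le> M + \<epsilon>" if "\<epsilon> > 0" for \<epsilon>
  proof -
    have "Inf X < M + \<epsilon>" using that by (simp add: M_def)
    then obtain x where "x \<in> X" "x < M + \<epsilon>" using cInf_lessD bX by blast
    then obtain t where "t \<ge> a" "\<forall>s\<ge>t. V s \<le> x" unfolding X_def by blast
    then show ?thesis using \<open>x < M + \<epsilon>\<close> by (intro exI[of _ t]) force
  qed
  have lower: "\<exists>t\<ge>a. \<forall>s\<ge>t. m - \<epsilon> \<le> V s" if "\<epsilon> > 0" for \<epsilon>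
  proof -
    have "m - \<epsilon> < Sup Y" using that by (simp add: m_def)
    then obtain y where "y \<in> Y" "m - \<epsilon> < y" using less_cSupD bY by blast
    then obtain t where "t \<ge> a" "\<forall>s\<ge>t. y \<le> V s" unfolding Y_def by blast
    then show ?thesis using \<open>m - \<epsilon> < y\<close> by (intro exI[of _ t]) force
  qed
  have "m = M"
  proof (rule ccontr)
    assume "m \<noteq> M"
    define D where "D = M - m"
    have D: "D > 0" using mM \<open>m \<noteq> M\<close> by (simp add: D_def)
    obtain \<delta> where \<delta>: "\<delta> > 0" "\<delta> \<le> 1" "\<And>s t. a \<le> s \<Longrightarrow> a \<le> t \<Longrightarrow> \<bar>s - t\<bar> < \<delta> \<Longrightarrow> \<bar>V s - V t\<bar> \<le> D/4"
      using unif[of "D/4"] D by auto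
    obtain B N where B: "0 \<le> B" "\<And>s. B \<le> s \<Longrightarrow> s \<le> B + L \<Longrightarrow> \<exists>m n::nat. m + n \<le> N \<and> \<bar>s - (real m + real n * l)\<bar> < \<delta>"
      using irrational_semigroup_dense[OF l \<delta>(1), of L] by metis
    \<comment> \<open>The overshoot above \<open>M\<close> that is tolerated: after \<open>N\<close>
      halvings the deficit \<open>D * 3/4\<close> is still three times \<open>\<eta>\<close>, which
      pushes the eventual bound below \<open>M\<close>.\<close>
    define \<eta> where "\<eta> = D/4 / 2^N"
    have \<eta>: "\<eta> > 0" "\<eta> \<le> D/4" using D by (auto simp: \<eta>_def field_simps)
    obtain t0 where t0: "a \<le> t0" "\<And>s. t0 \<le> s \<Longrightarrow> V s \<le> M + \<eta>" using upper[OF \<eta>(1)] by blast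
    \<comment> \<open>Points within \<open>\<delta> \<le> 1\<close> of a later \<open>x\<close> then
      have both predecessors beyond \<open>t0\<close>.\<close>
    define t1 where "t1 = t0 + L + 1"
    have "\<exists>x\<ge>t1. V x < m + \<eta>"
    proof (rule ccontr)
      assume "\<not> ?thesis"
      then have "m + \<eta> \<in> Y" unfolding Y_def using t0(1) L by (intro CollectI exI[of _ t1]) (auto simp: t1_def)
      then have "m + \<eta> \<le> m" unfolding m_def by (rule cSup_upper[OF _ bdY])
      then show False using \<eta> by simp
    qed
    then obtain x where x: "t1 \<le> x" "V x < m + \<eta>" by blast
    \<comment> \<open>Near \<open>x\<close> the value is below \<open>m + \<eta> + D/4\<close>, that
      is, \<open>D * 3/4\<close> below \<open>M + \<eta>\<close>.\<close>
    define C where "C = D * 3/4"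
    have start: "V y \<le> M + \<eta> - C" if "\<bar>y - x\<bar> < \<delta>" for y
    proof -
      have "\<bar>V y - V x\<bar> \<le> D/4" by (rule \<delta>(3)) (use that x \<delta> t0 L in \<open>auto simp: t1_def\<close>)
      then have "V y \<le> V x + D/4" by linarith
      moreover have "C = D * 3/4" "M = D + m" by (simp_all add: C_def D_def)
      ultimately show ?thesis using x(2) by linarith
    qed
    \<comment> \<open>One predecessor has deficit \<open>c\<close>, the other is at most
      \<open>M + \<eta>\<close>: averaging halves the deficit.\<close>
    have step1: "V y \<le> M + \<eta> - c/2" if "V (y - 1) \<le> M + \<eta> - c" "t0 + L \<le> y" for y c
    proof -
      have "V (y - l) \<le> M + \<eta>" by (rule t0(2)) (use that L in auto)
      moreover have "V y = (V (y - 1) + V (y - l)) / 2" by (rule eq) (use that t0 in \<open>auto simp: L_def\<close>)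
      ultimately show ?thesis using that(1) by argo
    qed
    have step2: "V y \<le> M + \<eta> - c/2" if "V (y - l) \<le> M + \<eta> - c" "t0 + L \<le> y" for y c
    proof -
      have "V (y - 1) \<le> M + \<eta>" by (rule t0(2)) (use that L in auto)
      moreover have "V y = (V (y - 1) + V (y - l)) / 2" by (rule eq) (use that t0 in \<open>auto simp: L_def\<close>)
      ultimately show ?thesis using that(1) by argo
    qed
    have it1: "V y \<le> M + \<eta> - C / 2^i" if "\<bar>y - (x + real i)\<bar> < \<delta>" for y and i :: nat
      using that
    proof (induction i arbitrary: y)
      case 0
      then show ?case using start by simp
    next
      case (Suc i)
      have "V y \<le> M + \<eta> - (C / 2^i) / 2"
      proof (rule step1)
        show "V (y - 1) \<le> M + \<eta> - C / 2^i" by (rule Suc.IH) (use Suc.prems in \<open>simp add: algebra_simps\<close>)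
        show "t0 + L \<le> y" using Suc.prems x(1) \<delta>(2) by (simp add: t1_def)
      qed
      then show ?case by (simp add: field_simps)
    qed
    have it2: "V y \<le> M + \<eta> - C / 2^(i + j)" if "\<bar>y - (x + real i + real j * l)\<bar> < \<delta>" for y and i j :: nat
      using that
    proof (induction j arbitrary: y)
      case 0
      then show ?case using it1 by simp
    next
      case (Suc j)
      have "V y \<le> M + \<eta> - (C / 2^(i + j)) / 2"
      proof (rule step2)
        show "V (y - l) \<le> M + \<eta> - C / 2^(i + j)" by (rule Suc.IH) (use Suc.prems in \<open>simp add: algebra_simps\<close>)
        have "0 \<le> real (Suc j) * l" using l(1) by simp
        then show "t0 + L \<le> y" using Suc.prems x(1) \<delta>(2) unfolding t1_def by linarith
      qed
      then show ?case by (simp add: field_simps)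
    qed
    \<comment> \<open>On a full window of length \<open>L\<close> every point is close to some
      \<open>x + i + j * l\<close> with at most \<open>N\<close> steps, so one deficit holds on the
      whole window and persists by \<open>prop_le\<close>.\<close>
    have "V y \<le> M + \<eta> - C / 2^N" if y: "x + B \<le> y" "y \<le> x + B + L" for y
    proof -
      obtain i j :: nat where ij: "i + j \<le> N" "\<bar>(y - x) - (real i + real j * l)\<bar> < \<delta>" using B(2)[of "y - x"] y by auto
      have "V y \<le> M + \<eta> - C / 2^(i + j)" by (rule it2) (use ij(2) in \<open>simp add: algebra_simps\<close>)
      moreover have "C / 2^N \<le> C / 2^(i + j)"
        using ij(1) D by (intro divide_left_mono power_increasing mult_pos_pos zero_less_power) (auto simp: C_def)
      ultimately show ?thesis by linarith
    qed
    then have "\<forall>s\<ge>x + B. V s \<le> M + \<eta> - C / 2^N"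
      using prop_le[of "x + B" "M + \<eta> - C / 2^N"] x(1) t0(1) L B(1) by (auto simp: t1_def)
    then have "M + \<eta> - C / 2^N \<in> X"
      unfolding X_def using x(1) t0(1) L B(1) by (intro CollectI exI[of _ "x + B"]) (auto simp: t1_def)
    then have "M \<le> M + \<eta> - C / 2^N" unfolding M_def by (rule cInf_lower[OF _ bdX])
    then show False using D by (simp add: \<eta>_def C_def divide_simps)
  qed
  have "(V \<longlongrightarrow> M) at_top"
  proof (rule tendstoI)
    fix e :: real assume e: "e > 0"
    obtain t t' where "\<forall>s\<ge>t. V s \<le> M + e/2" "\<forall>s\<ge>t'. m - e/2 \<le> V s" using upper[of "e/2"] lower[of "e/2"] e by auto
    then have "\<forall>s\<ge>max t t'. dist (V s) M < e" using e \<open>m = M\<close> by (auto simp: dist_real_def abs_less_iff)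
    then show "\<forall>\<^sub>F s in at_top. dist (V s) M < e" unfolding eventually_at_top_linorder by blast
  qed
  then show ?thesis by blast
qed

section \<open>Convergence of the flow to equilibrium\<close>

context network
begin

text \<open>From time 1 on the averaged outflow of the first edge vanishes, so both loops receive
  the same inflow and the two recursions become the scalar delay equation. The averages are
  continuous, as \<open>delay_average_converges\<close> requires; real and imaginary parts are
  treated separately.\<close>

lemma avg_boundary_converges:
  assumes f: "inE l f" and t: "0 \<le> t" and irr: "l \<notin> \<rat>"
  obtains c where "((\<lambda>s. sav t (e2 f) (- s)) \<longlongrightarrow> c) at_top"
proof -
  define V where "V s = sav t (e2 f) (- s)" for s
  have same: "sav t (e3 f) y = sav t (e2 f) y" if "y \<le> - 1" for y
    using sav_rec[OF f, of y t] sav_e1_neg[of "y + 1" t f] that by simp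
  have eq: "V s = (V (s - 1) + V (s - l)) / 2" if "1 + max 1 l \<le> s" for s
  proof -
    have "sav t (e2 f) (- s) = 1/2 * sav t (e2 f) (- s + 1) + 1/2 * sav t (e3 f) (- s + l) - 1/3 * sav t (e1 f) (- s + 1)"
      by (rule sav_rec(1)[OF f]) (use that in auto)
    moreover have "sav t (e1 f) (- s + 1) = 0" by (rule sav_e1_neg) (use that in auto)
    moreover have "sav t (e3 f) (- s + l) = sav t (e2 f) (- s + l)" by (rule same) (use that in auto)
    moreover have "- (s - 1) = - s + 1" "- (s - l) = - s + l" by auto
    ultimately show ?thesis unfolding V_def by (simp only:) (simp add: field_simps)
  qed
  have cont: "continuous_on {1..b} V" for b
  proof -
    have "continuous_on {- b.. - 1} (sav t (e2 f))"
      unfolding sav_def[abs_def] by (intro continuous_intros iable_average iable_e f t)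
    then show ?thesis unfolding V_def by (rule continuous_on_compose2) (auto intro!: continuous_intros)
  qed
  have "\<exists>c. ((\<lambda>s. Re (V s)) \<longlongrightarrow> c) at_top"
    by (rule delay_average_converges[OF l_pos irr, of 1]) (intro continuous_intros cont, simp add: eq)
  moreover have "\<exists>c. ((\<lambda>s. Im (V s)) \<longlongrightarrow> c) at_top"
    by (rule delay_average_converges[OF l_pos irr, of 1]) (intro continuous_intros cont, simp add: eq)
  ultimately obtain c d where c: "((\<lambda>s. Re (V s)) \<longlongrightarrow> c) at_top" and d: "((\<lambda>s. Im (V s)) \<longlongrightarrow> d) at_top" by blast
  have "((\<lambda>s. Complex (Re (V s)) (Im (V s))) \<longlongrightarrow> Complex c d) at_top"
    by (intro tendsto_Complex c d)
  then show ?thesis by (intro that[of "Complex c d"]) (simp add: V_def)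
qed

lemma mass_ef: "mass (ef 0) = of_real (1 + l)"
  using l_pos by (simp add: mass_def ef_def itg_const scaleR_conv_of_real)

text \<open>Late profiles are recent values of the inflow, so its convergence is uniform along the
  edges. The limit constant is read off from the mass, which is conserved and continuous.\<close>

lemma avg_converges:
  assumes f: "inE l f" and t: "0 \<le> t" and irr: "l \<notin> \<rat>"
  shows "((\<lambda>s. dst (S s (avg t f)) (vscale (mass (avg t f) / of_real (1 + l)) (ef 0))) \<longlongrightarrow> 0) at_top"
proof -
  obtain c where c: "((\<lambda>s. sav t (e2 f) (- s)) \<longlongrightarrow> c) at_top" by (rule avg_boundary_converges[OF assms])
  have gE: "inE l (avg t f)" by (rule inE_avg[OF f t])
  have lim: "((\<lambda>s. dst (S s (avg t f)) (vscale c (ef 0))) \<longlongrightarrow> 0) at_top"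
  proof (rule tendstoI)
    fix e :: real assume e: "e > 0"
    \<comment> \<open>The loops have total length \<open>1 + l\<close>; the additional 1 makes the
      final inequality strict.\<close>
    define e' where "e' = e / (2 + l)"
    have e': "e' > 0" using e l_pos by (simp add: e'_def)
    obtain T where T: "\<And>s. T \<le> s \<Longrightarrow> dist (sav t (e2 f) (- s)) c < e'"
      using tendstoD[OF c e'] unfolding eventually_at_top_linorder by blast
    \<comment> \<open>The margin makes \<open>s - x\<close> at least \<open>T\<close> on both loops
      and, on the second, puts \<open>x - s\<close> below -1, where the two inflows
      coincide.\<close>
    have "dist (dst (S s (avg t f)) (vscale c (ef 0))) 0 < e" if s: "max T 1 + 1 + l \<le> s" for s
    proof -
      have eqs: "c1 (S s (avg t f)) x = 0" "cmod (c2 (S s (avg t f)) x - c) \<le> e'" if "0 \<le> x" "x \<le> 1" for x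
      proof -
        have le: "x - s \<le> 0" "x - s \<le> 1" using that s l_pos by auto
        show "c1 (S s (avg t f)) x = 0" using e_avg(1)[OF f le(2)] sav_e1_neg[OF le(1)] by simp
        have "dist (sav t (e2 f) (- (s - x))) c < e'" by (rule T) (use that s l_pos in auto)
        then show "cmod (c2 (S s (avg t f)) x - c) \<le> e'" using e_avg(2)[OF f le(2), of t] by (simp add: dist_norm)
      qed
      have eq3: "cmod (c3 (S s (avg t f)) x - c) \<le> e'" if "0 \<le> x" "x \<le> l" for x
      proof -
        have le: "x - s \<le> - 1" "x - s \<le> l" using that s l_pos by auto
        have "sav t (e3 f) (x - s) = sav t (e2 f) (x - s)"
          using sav_rec[OF f, of "x - s" t] sav_e1_neg[of "x - s + 1" t f] le by simp
        moreover have "dist (sav t (e2 f) (- (s - x))) c < e'" by (rule T) (use that s in auto)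
        ultimately show ?thesis using e_avg(3)[OF f le(2), of t] by (simp add: dist_norm)
      qed
      have SE: "inE l (vsub (S s (avg t f)) (vscale c (ef 0)))" by (intro inE_vsub inE_vscale inE_S gE inE_ef)
      then have i: "iable 0 1 (c2 (vsub (S s (avg t f)) (vscale c (ef 0))))" "iable 0 l (c3 (vsub (S s (avg t f)) (vscale c (ef 0))))"
        unfolding inE_def by blast+
      have "itg 0 1 (\<lambda>x. cmod (c1 (vsub (S s (avg t f)) (vscale c (ef 0))) x)) = itg 0 1 (\<lambda>x. 0)"
        by (rule itg_cong) (use eqs(1) in \<open>simp add: ef_def\<close>)
      moreover have "itg 0 1 (\<lambda>x. cmod (c2 (vsub (S s (avg t f)) (vscale c (ef 0))) x)) \<le> itg 0 1 (\<lambda>x. e')"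
        by (rule itg_mono[OF iable_norm[OF i(1)] iable_const]) (use eqs(2) in \<open>simp add: ef_def\<close>)
      moreover have "itg 0 l (\<lambda>x. cmod (c3 (vsub (S s (avg t f)) (vscale c (ef 0))) x)) \<le> itg 0 l (\<lambda>x. e')"
        by (rule itg_mono[OF iable_norm[OF i(2)] iable_const]) (use eq3 in \<open>simp add: ef_def\<close>)
      ultimately have "dst (S s (avg t f)) (vscale c (ef 0)) \<le> e' + l * e'"
        unfolding nrm_def using l_pos by (simp add: itg_const)
      also have "\<dots> < (2 + l) * e'" using e' by (simp add: algebra_simps)
      also have "\<dots> = e" using l_pos by (simp add: e'_def)
      finally show ?thesis using nrm_nonneg[of l "vsub (S s (avg t f)) (vscale c (ef 0))"] by (simp add: dist_real_def)
    qed
    then show "\<forall>\<^sub>F s in at_top. dist (dst (S s (avg t f)) (vscale c (ef 0))) 0 < e"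
      unfolding eventually_at_top_linorder by blast
  qed
  \<comment> \<open>The mass difference does not depend on \<open>s\<close> and is bounded by a
    distance that tends to 0.\<close>
  have "cmod (mass (avg t f) - c * of_real (1 + l)) \<le> 0"
  proof (rule tendsto_lowerbound[OF lim])
    show "\<forall>\<^sub>F s in at_top. cmod (mass (avg t f) - c * of_real (1 + l)) \<le> dst (S s (avg t f)) (vscale c (ef 0))"
      unfolding eventually_at_top_linorder
    proof (intro exI[of _ 0] allI impI)
      fix s :: real assume s: "0 \<le> s"
      have "mass (vsub (S s (avg t f)) (vscale c (ef 0))) = mass (S s (avg t f)) - mass (vscale c (ef 0))"
        unfolding vsub_def by (subst mass_lin) (auto intro: inE_S gE inE_ef)
      also have "mass (vscale c (ef 0)) = c * of_real (1 + l)"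
        unfolding vscale_def by (subst mass_lin[OF inE_ef inE_ef]) (simp add: mass_ef)
      also have "mass (S s (avg t f)) = mass (avg t f)" by (rule mass_S[OF gE s])
      finally show "cmod (mass (avg t f) - c * of_real (1 + l)) \<le> dst (S s (avg t f)) (vscale c (ef 0))"
        using mass_bound[of "vsub (S s (avg t f)) (vscale c (ef 0))"] by (simp add: inE_vsub inE_vscale inE_S gE inE_ef)
    qed
  qed simp
  then have "mass (avg t f) = c * of_real (1 + l)" by simp
  moreover have "complex_of_real (1 + l) \<noteq> 0" using l_pos by (simp only: of_real_eq_0_iff)
  ultimately have "mass (avg t f) / of_real (1 + l) = c" by simp
  then show ?thesis using lim by simp
qed

lemma nrm_vscale_ef: "nrm l (vscale c (ef 0)) = cmod c * (1 + l)"
  using l_pos by (simp add: nrm_vscale nrm_def ef_def itg_const algebra_simps)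

text \<open>Both the flow and the candidate limit are nonexpansive in the initial vector, the latter
  because the mass is bounded by the norm and \<open>ef 0\<close> has norm \<open>1 + l\<close>.
  Hence approximation by averages is enough.\<close>

lemma S_converges:
  assumes f: "inE l f" and irr: "l \<notin> \<rat>"
  shows "((\<lambda>s. dst (S s f) (vscale (mass f / of_real (1 + l)) (ef 0))) \<longlongrightarrow> 0) at_top"
proof (rule tendstoI)
  fix e :: real assume e: "e > 0"
  obtain t where t: "0 < t" "dst f (avg t f) < e / 3" by (rule avg_approx[OF f, of "e/3"]) (use e in auto)
  let ?g = "avg t f"
  let ?P = "\<lambda>f. vscale (mass f / of_real (1 + l)) (ef 0)"
  have gE: "inE l ?g" by (rule inE_avg[OF f]) (use t in simp)
  have PE: "inE l (?P f)" for f by (intro inE_vscale inE_ef)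
  have "\<forall>\<^sub>F s in at_top. dist (dst (S s ?g) (?P ?g)) 0 < e / 3"
    using tendstoD[OF avg_converges[OF f _ irr], of t "e/3"] t e by simp
  moreover have "\<forall>\<^sub>F s in at_top. (0::real) \<le> s" by (rule eventually_ge_at_top)
  ultimately show "\<forall>\<^sub>F s in at_top. dist (dst (S s f) (?P f)) 0 < e"
  proof eventually_elim
    case (elim s)
    have 1: "dst (S s f) (S s ?g) \<le> dst f ?g"
      using S_contractive[of "vsub f ?g" s] S_sub_nrm[of s f ?g] elim f gE by (simp add: inE_vsub)
    have "vsub (?P ?g) (?P f) = vscale ((mass ?g - mass f) / of_real (1 + l)) (ef 0)"
      by (rule vec_eqI) (simp_all add: algebra_simps diff_divide_distrib)
    then have "dst (?P ?g) (?P f) = cmod ((mass ?g - mass f) / of_real (1 + l)) * (1 + l)"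
      by (simp only: nrm_vscale_ef)
    also have "\<dots> = cmod (mass ?g - mass f)"
    proof -
      have "cmod (of_real (1 + l)) = 1 + l" using l_pos by (simp only: norm_of_real)
      then show ?thesis using l_pos by (simp add: norm_divide)
    qed
    also have "mass ?g - mass f = mass (vsub ?g f)" by (simp add: vsub_def mass_lin gE f)
    also have "cmod (mass (vsub ?g f)) \<le> dst ?g f" by (rule mass_bound) (intro inE_vsub gE f)
    finally have 2: "dst (?P ?g) (?P f) \<le> dst f ?g" by (simp only: nrm_vsub_commute[of l ?g f])
    have "dst (S s f) (?P f) \<le> dst (S s f) (S s ?g) + dst (S s ?g) (?P f)"
      by (rule nrm_triangle) (intro inE_S f gE PE)+
    also have "dst (S s ?g) (?P f) \<le> dst (S s ?g) (?P ?g) + dst (?P ?g) (?P f)"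
      by (rule nrm_triangle) (intro inE_S f gE PE)+
    finally have "dst (S s f) (?P f) < e" using 1 2 t(2) elim(1) by (simp add: dist_real_def)
    then show ?case using nrm_nonneg[of l "vsub (S s f) (?P f)"] by (simp add: dist_real_def)
  qed
qed

lemma mass_positive:
  assumes f: "positive_vec l f"
  obtains m where "0 \<le> m" "mass f = of_real m"
proof -
  have r: "\<exists>m\<ge>0. itg 0 b h = complex_of_real m"
    if "iable 0 b h" "AE x in lborel. x \<in> {0..b} \<longrightarrow> Im (h x) = 0 \<and> Re (h x) \<ge> 0" for b h
  proof -
    have "itg 0 b h = itg 0 b (\<lambda>x. complex_of_real (cmod (h x)))"
    proof (rule itg_cong_AE'[OF that(1)])
      show "iable 0 b (\<lambda>x. complex_of_real (cmod (h x)))" by (rule iable_of_real, rule iable_norm, rule that)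
      show "AE x in lborel. x \<in> {0..b} \<longrightarrow> h x = complex_of_real (cmod (h x))"
        using that(2) by eventually_elim (auto simp: complex_eq_iff cmod_eq_Re)
    qed
    also have "\<dots> = complex_of_real (itg 0 b (\<lambda>x. cmod (h x)))" by (rule set_integral_complex_of_real)
    finally show ?thesis using itg_nonneg[of 0 b "\<lambda>x. cmod (h x)"] by auto
  qed
  have E: "inE l f" using f by (simp add: positive_vec_def)
  obtain m1 where 1: "0 \<le> m1" "itg 0 1 (c1 f) = complex_of_real m1" using r[of 1 "c1 f"] f E unfolding positive_vec_def inE_def by blast
  obtain m2 where 2: "0 \<le> m2" "itg 0 1 (c2 f) = complex_of_real m2" using r[of 1 "c2 f"] f E unfolding positive_vec_def inE_def by blast
  obtain m3 where 3: "0 \<le> m3" "itg 0 l (c3 f) = complex_of_real m3" using r[of l "c3 f"] f E unfolding positive_vec_def inE_def by blast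
  show ?thesis
    by (rule that[of "m1/3 + m2 + m3"]) (use 1 2 3 in \<open>simp_all add: mass_def\<close>)
qed

lemma dist_pos_cone_le: "positive_vec l p \<Longrightarrow> dist_pos_cone l f \<le> dst f p"
  unfolding dist_pos_cone_def
  by (rule cINF_lower) (auto intro!: bdd_belowI[of _ 0] nrm_nonneg)

lemma dist_pos_cone_nonneg: "0 \<le> dist_pos_cone l f"
proof -
  have "positive_vec l vzero" by (simp add: positive_vec_def c_vzero)
  then show ?thesis unfolding dist_pos_cone_def by (intro cINF_greatest nrm_nonneg) blast
qed

lemma positive_limit:
  assumes "positive_vec l f"
  shows "positive_vec l (vscale (mass f / of_real (1 + l)) (ef 0))"
proof -
  obtain m where m: "0 \<le> m" "mass f = of_real m" by (rule mass_positive[OF assms])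
  have "mass f / of_real (1 + l) = complex_of_real (m / (1 + l))" unfolding m by simp
  moreover have "0 \<le> m / (1 + l)" using m l_pos by simp
  moreover have "positive_vec l (vscale (complex_of_real a) (ef 0))" if "0 \<le> a" for a
    unfolding positive_vec_def by (intro conjI inE_vscale inE_ef) (use that in \<open>simp_all add: ef_def\<close>)
  ultimately show ?thesis by (simp only:)
qed

text \<open>Nonnegative data have nonnegative mass, so the limit lies in the cone and its distance
  from the orbit dominates the distance to the cone.\<close>

lemma dist_tendsto:
  assumes "positive_vec l f" "l \<notin> \<rat>" and Tf: "\<And>t. 0 \<le> t \<Longrightarrow> inE l (T t f) \<and> dst (T t f) (S t f) = 0"
  shows "((\<lambda>t. dist_pos_cone l (T t f)) \<longlongrightarrow> 0) at_top"
proof (rule tendsto_sandwich[OF _ _ tendsto_const])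
  let ?P = "vscale (mass f / of_real (1 + l)) (ef 0)"
  have f: "inE l f" using assms by (simp add: positive_vec_def)
  show "((\<lambda>s. dst (S s f) ?P) \<longlongrightarrow> 0) at_top" by (rule S_converges[OF f assms(2)])
  have "dist_pos_cone l (T t f) \<le> dst (S t f) ?P" if t: "0 \<le> t" for t
  proof -
    have "dist_pos_cone l (T t f) \<le> dst (T t f) ?P" by (rule dist_pos_cone_le[OF positive_limit[OF assms(1)]])
    also have "\<dots> \<le> dst (T t f) (S t f) + dst (S t f) ?P"
      by (rule nrm_triangle) (use Tf[OF t] in \<open>auto intro: inE_S f inE_ef\<close>)
    finally show ?thesis using Tf[OF t] by simp
  qed
  then show "\<forall>\<^sub>F t in at_top. dist_pos_cone l (T t f) \<le> dst (S t f) ?P"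
    unfolding eventually_at_top_linorder by blast
qed (simp add: dist_pos_cone_nonneg)

text \<open>Unit density on the first edge alone immediately sends the value -1/3 into the first
  loop.\<close>

lemma S_not_positive:
  assumes T: "\<And>t f. 0 \<le> t \<Longrightarrow> inE l f \<Longrightarrow> inE l (T t f) \<and> dst (T t f) (S t f) = 0"
  shows "\<not> positive_semigroup l T"
proof
  assume pos: "positive_semigroup l T"
  define f :: vec where "f = ((\<lambda>_. 1), (\<lambda>_. 0), (\<lambda>_. 0))"
  have fE: "inE l f" by (simp add: inE_def f_def)
  have fp: "positive_vec l f" using fE by (simp add: positive_vec_def f_def)
  \<comment> \<open>Below 1 and \<open>l\<close>, so that one recursion step leads from
    \<open>x - t\<close> back to the initial data.\<close>
  define t where "t = min 1 l / 2"
  have t: "0 < t" "t < 1" "t < l" using l_pos by (auto simp: t_def)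
  have "positive_vec l (T t f)" using pos fp t unfolding positive_semigroup_def by (meson less_imp_le)
  then have "AE x in lborel. x \<in> {0..1} \<longrightarrow> Im (c2 (T t f) x) = 0 \<and> Re (c2 (T t f) x) \<ge> 0"
    unfolding positive_vec_def by blast
  moreover have "AE x in lborel. x \<in> {0..1} \<longrightarrow> c2 (T t f) x = c2 (S t f) x"
    using T[of t f] t fE nrm_vsub_eq_0[of l "T t f" "S t f"] inE_S[OF fE] by (auto simp: aeq_def)
  ultimately have "AE x in lborel. x \<notin> {0..t/2}"
  proof eventually_elim
    case (elim x)
    show ?case
    proof
      assume x: "x \<in> {0..t/2}"
      have y: "x - t < 0" "0 \<le> x - t + 1" "x - t + 1 \<le> 1" "0 \<le> x - t + l" "x - t + l \<le> l" using x t by auto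
      have "e2 f (x - t) = - 1/3"
        unfolding e2_neg[OF y(1)] e1_base[OF y(2,3)] e2_base[OF y(2,3)] e3_base[OF y(4,5)] by (simp add: f_def)
      then show False using elim x t by simp
    qed
  qed
  then have "{0..t/2} \<in> null_sets lborel" by (subst AE_iff_null_sets) auto
  then have "emeasure lborel {0..t/2} = 0" by (rule null_setsD1)
  then show False using t by simp
qed

end

section \<open>Uniqueness of the generated semigroup\<close>

text \<open>Completeness of L1 in the form needed to sum the humps: an absolutely convergent series
  has a sum, with remainders bounded by the tail of the norms.\<close>

lemma L1_series:
  fixes d :: "nat \<Rightarrow> real \<Rightarrow> complex"
  assumes d: "\<And>k. iable 0 b (d k)" and s: "summable (\<lambda>k. itg 0 b (\<lambda>x. cmod (d k x)))"
  obtains y where "iable 0 b y" "\<And>n. itg 0 b (\<lambda>x. cmod (y x - (\<Sum>k<n. d k x))) \<le> (\<Sum>k. itg 0 b (\<lambda>x. cmod (d (k + n) x)))"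
proof -
  define f where "f k x = indicator {0..b} x *\<^sub>R d k x" for k x
  have fi: "integrable lborel (f k)" for k using d by (simp add: f_def[abs_def] set_integrable_def)
  have fm [measurable]: "f k \<in> borel_measurable borel" for k using borel_measurable_integrable[OF fi] by simp
  have nf: "itg 0 b (\<lambda>x. cmod (d k x)) = (\<integral>x. norm (f k x) \<partial>lborel)" for k
    by (simp add: set_lebesgue_integral_def f_def)
  have s': "summable (\<lambda>k. \<integral>x. norm (f k x) \<partial>lborel)" using s by (simp add: nf)
  have "(\<integral>\<^sup>+x. (\<Sum>k. ennreal (norm (f k x))) \<partial>lborel) = (\<Sum>k. \<integral>\<^sup>+x. ennreal (norm (f k x)) \<partial>lborel)"
    by (rule nn_integral_suminf) simp
  also have "\<dots> = (\<Sum>k. ennreal (\<integral>x. norm (f k x) \<partial>lborel))"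
    by (intro suminf_cong nn_integral_eq_integral integrable_norm fi) auto
  also have "\<dots> = ennreal (\<Sum>k. \<integral>x. norm (f k x) \<partial>lborel)" by (rule suminf_ennreal2[OF _ s']) simp
  finally have "(\<integral>\<^sup>+x. (\<Sum>k. ennreal (norm (f k x))) \<partial>lborel) \<noteq> \<infinity>" by simp
  then have "AE x in lborel. (\<Sum>k. ennreal (norm (f k x))) \<noteq> \<infinity>"
    by (intro nn_integral_PInf_AE) simp
  then have ae: "AE x in lborel. summable (\<lambda>k. norm (f k x))"
    by eventually_elim (auto intro: summable_suminf_not_top)
  have yi: "integrable lborel (\<lambda>x. \<Sum>k. f k x)" by (rule integrable_suminf[OF fi ae s'])
  define y where "y x = (\<Sum>k. f k x)" for x
  show ?thesis
  proof (rule that[of y])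
    show "iable 0 b y" unfolding set_integrable_def y_def by (rule integrable_mult_indicator[OF _ yi]) simp
    fix n
    have sn: "summable (\<lambda>k. \<integral>x. norm (f (k + n) x) \<partial>lborel)" using s' by (rule summable_ignore_initial_segment)
    have aen: "AE x in lborel. summable (\<lambda>k. norm (norm (f (k + n) x)))"
      using ae by eventually_elim (auto intro: summable_ignore_initial_segment)
    have ni: "integrable lborel (\<lambda>x. norm (f (k + n) x))" for k by (rule integrable_norm[OF fi])
    have sni: "integrable lborel (\<lambda>x. \<Sum>k. norm (f (k + n) x))"
      by (rule integrable_suminf[OF ni aen]) (use sn in simp)
    have eq: "itg 0 b (\<lambda>x. cmod (y x - (\<Sum>k<n. d k x))) = (\<integral>x. norm (y x - (\<Sum>k<n. f k x)) \<partial>lborel)"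
      unfolding set_lebesgue_integral_def
      by (intro Bochner_Integration.integral_cong refl) (auto simp: indicator_def f_def y_def)
    also have "\<dots> \<le> (\<integral>x. (\<Sum>k. norm (f (k + n) x)) \<partial>lborel)"
    proof (rule integral_mono_AE)
      show "integrable lborel (\<lambda>x. norm (y x - (\<Sum>k<n. f k x)))"
        unfolding y_def by (intro integrable_norm Bochner_Integration.integrable_diff Bochner_Integration.integrable_sum yi fi)
      show "AE x in lborel. norm (y x - (\<Sum>k<n. f k x)) \<le> (\<Sum>k. norm (f (k + n) x))"
        using ae
      proof eventually_elim
        case (elim x)
        have "y x - (\<Sum>k<n. f k x) = (\<Sum>k. f (k + n) x)"
          unfolding y_def by (rule suminf_minus_initial_segment[symmetric, OF summable_norm_cancel[OF elim]])
        also have "norm \<dots> \<le> (\<Sum>k. norm (f (k + n) x))"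
          by (rule summable_norm, rule summable_ignore_initial_segment[OF elim])
        finally show ?case .
      qed
    qed (rule sni)
    also have "\<dots> = (\<Sum>k. \<integral>x. norm (f (k + n) x) \<partial>lborel)"
      by (rule integral_suminf[OF ni aen]) (use sn in simp)
    finally show "itg 0 b (\<lambda>x. cmod (y x - (\<Sum>k<n. d k x))) \<le> (\<Sum>k. itg 0 b (\<lambda>x. cmod (d (k + n) x)))"
      unfolding nf .
  qed
qed

text \<open>A positive slope \<open>e\<close> is conceded. If \<open>w\<close> exceeded the line,
  the infimum of the times where it does would still satisfy the bound by continuity, and the Dini
  condition would carry the bound beyond it. Then \<open>e\<close> tends to 0.\<close>

lemma right_Dini_nonincreasing:
  fixes w :: "real \<Rightarrow> real"
  assumes t: "0 \<le> t" and cont: "continuous_on {0..t} w"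
    and dini: "\<And>s e. 0 \<le> s \<Longrightarrow> s < t \<Longrightarrow> 0 < e \<Longrightarrow> \<exists>\<delta>>0. \<forall>h. 0 < h \<and> h < \<delta> \<and> s + h \<le> t \<longrightarrow> w (s + h) \<le> w s + e * h"
  shows "w t \<le> w 0"
proof -
  have "w t \<le> w 0 + e * t" if e: "e > 0" for e
  proof (rule ccontr)
    assume not: "\<not> w t \<le> w 0 + e * t"
    define B where "B = {r. 0 \<le> r \<and> r \<le> t \<and> w 0 + e * r < w r}"
    define c where "c = Inf B"
    have tB: "t \<in> B" using not t by (simp add: B_def)
    have bdd: "bdd_below B" by (rule bdd_belowI[of _ 0]) (simp add: B_def)
    have c: "0 \<le> c" "c \<le> t" unfolding c_def
      using tB by (auto intro!: cInf_greatest cInf_lower bdd simp: B_def)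
    define G where "G = {r \<in> {0..t}. w r \<le> w 0 + e * r}"
    have "closed G"
      unfolding G_def by (rule continuous_on_closed_Collect_le) (auto intro!: continuous_intros cont)
    have below: "r \<in> G" if "0 \<le> r" "r < c" for r
    proof -
      have "r \<notin> B" using that cInf_lower[OF _ bdd, of r] by (auto simp: c_def)
      then show ?thesis using that c by (auto simp: B_def G_def)
    qed
    have cG: "w c \<le> w 0 + e * c"
    proof (cases "c = 0")
      case False
      then have c0: "0 < c" using c by simp
      have "closure {0..<c} \<subseteq> G" by (rule closure_minimal[OF _ \<open>closed G\<close>]) (use below in auto)
      then have "c \<in> G" using c0 by auto
      then show ?thesis by (simp add: G_def)
    qed simp
    have "c \<noteq> t" using cG not by auto
    then have ct: "c < t" using c by simp
    obtain \<delta> where \<delta>: "\<delta> > 0" "\<And>h. 0 < h \<Longrightarrow> h < \<delta> \<Longrightarrow> c + h \<le> t \<Longrightarrow> w (c + h) \<le> w c + e * h"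
      using dini[OF c(1) ct e] by blast
    have "c + \<delta> \<le> r" if "r \<in> B" for r
    proof (rule ccontr)
      assume r: "\<not> c + \<delta> \<le> r"
      have "c \<le> r" unfolding c_def by (rule cInf_lower[OF that bdd])
      moreover have "r \<noteq> c" using that cG by (auto simp: B_def)
      ultimately have "w (c + (r - c)) \<le> w c + e * (r - c)" by (intro \<delta>) (use r that in \<open>auto simp: B_def\<close>)
      then have "w r \<le> w 0 + e * r" using cG by (simp add: algebra_simps)
      then show False using that by (simp add: B_def)
    qed
    then have "c + \<delta> \<le> c" unfolding c_def using tB by (intro cInf_greatest) auto
    then show False using \<delta>(1) by simp
  qed
  then have "w t \<le> w 0 + e" if "e > 0" for e
  proof (cases "t = 0")
    case False
    then show ?thesis using that t \<open>\<And>e. e > 0 \<Longrightarrow> w t \<le> w 0 + e * t\<close>[of "e / t"] by simp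
  qed (use that in simp)
  then show ?thesis by (rule field_le_epsilon)
qed

section \<open>Uniform boundedness by a gliding hump\<close>

context network
begin

text \<open>Linearity is expressed through norms, because the operators of a generated semigroup are
  linear only up to null sets.\<close>

definition bounded_op :: "(vec \<Rightarrow> vec) \<Rightarrow> bool" where
  "bounded_op B \<longleftrightarrow> (\<forall>f. inE l f \<longrightarrow> inE l (B f)) \<and>
     (\<forall>f g. inE l f \<longrightarrow> inE l g \<longrightarrow> nrm l (B (vsub f g)) = dst (B f) (B g)) \<and>
     (\<forall>c f. inE l f \<longrightarrow> nrm l (B (vscale c f)) = cmod c * nrm l (B f)) \<and>
     (\<exists>M. \<forall>f. inE l f \<longrightarrow> nrm l (B f) \<le> M * nrm l f)"

text \<open>\<open>M\<close> is the operator norm, attained up to a factor 2 on the unit ball;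
  homogeneity rescales the vector to norm at most \<open>e\<close>. Positivity of \<open>C\<close>
  gives \<open>M / 2 < M\<close>.\<close>

lemma nearly_maximal:
  assumes B: "bounded_op B" and g: "inE l g" "C * nrm l g < nrm l (B g)" and C: "0 < C" and e: "0 < e"
  obtains M f where "C \<le> M" "\<And>f. inE l f \<Longrightarrow> nrm l (B f) \<le> M * nrm l f" "inE l f" "nrm l f \<le> e" "M * e / 2 \<le> nrm l (B f)"
proof -
  obtain M0 where M0: "\<And>f. inE l f \<Longrightarrow> nrm l (B f) \<le> M0 * nrm l f" using B unfolding bounded_op_def by blast
  have sc: "nrm l (B (vscale c f)) = cmod c * nrm l (B f)" if "inE l f" for c f using B that unfolding bounded_op_def by blast
  define X where "X = (\<lambda>f. nrm l (B f)) ` {f. inE l f \<and> nrm l f \<le> 1}"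
  define M where "M = Sup X"
  have bdd: "bdd_above X"
  proof (rule bdd_aboveI[of _ "\<bar>M0\<bar>"])
    fix x assume "x \<in> X"
    then obtain f where f: "inE l f" "nrm l f \<le> 1" "x = nrm l (B f)" unfolding X_def by blast
    have "x \<le> M0 * nrm l f" using M0 f by simp
    also have "\<dots> \<le> \<bar>M0\<bar> * nrm l f" by (rule mult_right_mono) (use nrm_nonneg in auto)
    also have "\<dots> \<le> \<bar>M0\<bar> * 1" by (rule mult_left_mono) (use f in auto)
    finally show "x \<le> \<bar>M0\<bar>" by simp
  qed
  have bound: "nrm l (B f) \<le> M * nrm l f" if f: "inE l f" for f
  proof (cases "nrm l f = 0")
    case True
    then show ?thesis using M0[OF f] by simp
  next
    case False
    then have p: "0 < nrm l f" using nrm_nonneg[of l f] by simp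
    let ?f = "vscale (of_real (1 / nrm l f)) f"
    have n1: "cmod (of_real (1 / nrm l f)) = 1 / nrm l f" using p by (simp only: norm_of_real) simp
    have "nrm l ?f = 1" unfolding nrm_vscale n1 using p by simp
    then have "nrm l (B ?f) \<in> X" unfolding X_def using f by (intro imageI) (simp add: inE_vscale)
    then have "nrm l (B ?f) \<le> M" unfolding M_def by (rule cSup_upper[OF _ bdd])
    then show ?thesis unfolding sc[OF f] n1 using p by (simp add: field_simps)
  qed
  have ng: "0 < nrm l g"
  proof (rule ccontr)
    assume "\<not> 0 < nrm l g"
    then have "nrm l g = 0" using nrm_nonneg[of l g] by simp
    then show False using g M0[OF g(1)] by simp
  qed
  have "C * nrm l g < M * nrm l g" using g bound[OF g(1)] by linarith
  then have CM: "C \<le> M" using ng by simp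
  then have "M / 2 < Sup X" using C by (simp add: M_def)
  moreover have "X \<noteq> {}" unfolding X_def using inE_vzero nrm_vzero by (metis (mono_tags, lifting) empty_iff imageI mem_Collect_eq zero_le_one)
  ultimately obtain x where "x \<in> X" "M / 2 < x" using less_cSupD by blast
  then obtain f where f: "inE l f" "nrm l f \<le> 1" "M / 2 < nrm l (B f)" unfolding X_def by blast
  have ce: "cmod (of_real e) = e" using e by simp
  show ?thesis
  proof (rule that[OF CM bound])
    show "inE l (vscale (of_real e) f)" by (rule inE_vscale[OF f(1)])
    show "nrm l (vscale (of_real e) f) \<le> e" unfolding nrm_vscale ce using mult_left_mono[OF f(2), of e] e by simp
    show "M * e / 2 \<le> nrm l (B (vscale (of_real e) f))"
      unfolding sc[OF f(1)] ce using mult_left_mono[OF less_imp_le[OF f(3)], of e] e by (simp add: algebra_simps)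
  qed
qed

text \<open>Gliding hump: \<open>f k\<close>, on which \<open>B k\<close> is nearly maximal, is added unless the partial sum is already large under \<open>B k\<close>.\<close>

primrec hump :: "(nat \<Rightarrow> vec \<Rightarrow> vec) \<Rightarrow> (nat \<Rightarrow> real) \<Rightarrow> (nat \<Rightarrow> vec) \<Rightarrow> nat \<Rightarrow> vec" where
  "hump B c f 0 = vzero"
| "hump B c f (Suc k) = vlin 1 (hump B c f k) (if c k \<le> nrm l (B k (hump B c f k)) then 0 else 1) (f k)"

lemma uniform_boundedness:
  fixes B :: "nat \<Rightarrow> vec \<Rightarrow> vec"
  assumes B: "\<And>n. bounded_op (B n)"
    and pt: "\<And>f. inE l f \<Longrightarrow> \<exists>C N. \<forall>n\<ge>N. nrm l (B n f) \<le> C"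
  shows "\<exists>M N. \<forall>n\<ge>N. \<forall>f. inE l f \<longrightarrow> nrm l (B n f) \<le> M * nrm l f"
proof (rule ccontr)
  assume unb: "\<not> ?thesis"
  note BE = B[unfolded bounded_op_def, THEN conjunct1, rule_format]
  note Bsub = B[unfolded bounded_op_def, THEN conjunct2, THEN conjunct1, rule_format]
  \<comment> \<open>The humps shrink like \<open>8^-k\<close> and are summable, while the norms
    \<open>M\<close> grow at least like \<open>16^k\<close>, so the images still grow like
    \<open>2^k\<close>. The condition \<open>k \<le> n\<close> lets the indices pass the
    \<open>N\<close> of the pointwise bound.\<close>
  define Q where "Q k n M f \<longleftrightarrow> k \<le> n \<and> 16^k \<le> M \<and> (\<forall>f. inE l f \<longrightarrow> nrm l (B n f) \<le> M * nrm l f) \<and> inE l f \<and> nrm l f \<le> (1/8)^k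
    \<and> M * (1/8)^k / 2 \<le> nrm l (B n f)" for k n :: nat and M :: real and f :: vec
  have "\<exists>n M f. Q k n M f" for k
  proof -
    obtain n g where n: "k \<le> n" "inE l g" "16^k * nrm l g < nrm l (B n g)" using unb by (meson not_le)
    obtain M f where "16^k \<le> M" "\<And>f. inE l f \<Longrightarrow> nrm l (B n f) \<le> M * nrm l f" "inE l f" "nrm l f \<le> (1/8)^k" "M * (1/8)^k / 2 \<le> nrm l (B n f)"
      by (rule nearly_maximal[OF B n(2,3), of "(1/8)^k"]) simp_all
    then have "Q k n M f" using n(1) unfolding Q_def by blast
    then show ?thesis by blast
  qed
  then obtain n M f where Q: "\<And>k. Q k (n k) (M k) (f k)" by metis
  have n: "k \<le> n k" and M: "16^k \<le> M k" and bd: "\<forall>g. inE l g \<longrightarrow> nrm l (B (n k) g) \<le> M k * nrm l g"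
    and f: "inE l (f k)" "nrm l (f k) \<le> (1/8)^k" "M k * (1/8)^k / 2 \<le> nrm l (B (n k) (f k))" for k
    using Q[of k] unfolding Q_def by simp_all
  \<comment> \<open>Half of the image size guaranteed for \<open>f k\<close>. If the image of
    \<open>x k\<close> is smaller, adding \<open>f k\<close> makes the image of the next partial sum
    at least this large.\<close>
  define c where "c k = M k * (1/8)^k / 4" for k
  define x where "x = hump (\<lambda>k. B (n k)) c f"
  define \<sigma> where "\<sigma> k = (if c k \<le> nrm l (B (n k) (x k)) then 0 else 1 :: complex)" for k
  have xS: "x (Suc k) = vlin 1 (x k) (\<sigma> k) (f k)" for k by (simp add: x_def \<sigma>_def)
  have xE: "inE l (x k)" for k
  proof (induction k)
    case (Suc k)
    then show ?case unfolding xS by (intro inE_vlin f)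
  qed (simp add: x_def)
  have big: "c k \<le> nrm l (B (n k) (x (Suc k)))" for k
  proof (cases "c k \<le> nrm l (B (n k) (x k))")
    case True
    then have "x (Suc k) = x k" unfolding xS \<sigma>_def by (intro vec_eqI) auto
    then show ?thesis using True by simp
  next
    case False
    have "f k = vsub (x (Suc k)) (x k)" unfolding xS \<sigma>_def using False by (intro vec_eqI) auto
    then have "nrm l (B (n k) (f k)) = dst (B (n k) (x (Suc k))) (B (n k) (x k))"
      by (simp only: Bsub[OF xE xE])
    also have "\<dots> \<le> dst (B (n k) (x (Suc k))) vzero + dst vzero (B (n k) (x k))"
      by (intro nrm_triangle BE xE inE_vzero)
    also have "dst vzero (B (n k) (x k)) = nrm l (B (n k) (x k))" by (subst nrm_vsub_commute) simp
    finally show ?thesis using f(3)[of k] False unfolding c_def by simp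
  qed
  define d where "d k = vscale (\<sigma> k) (f k)" for k
  have dE: "inE l (d k)" for k unfolding d_def by (intro inE_vscale f)
  have dn: "nrm l (d k) \<le> (1/8)^k" for k
  proof -
    have "cmod (\<sigma> k) \<le> 1" by (simp add: \<sigma>_def)
    then have "cmod (\<sigma> k) * nrm l (f k) \<le> 1 * nrm l (f k)" by (rule mult_right_mono) (rule nrm_nonneg)
    then show ?thesis unfolding d_def nrm_vscale using f(2)[of k] by linarith
  qed
  have xsum: "c1 (x k) y = (\<Sum>j<k. c1 (d j) y)" "c2 (x k) y = (\<Sum>j<k. c2 (d j) y)" "c3 (x k) y = (\<Sum>j<k. c3 (d j) y)" for k y
    by (induction k) (simp_all add: xS d_def, simp_all add: x_def c_vzero)
  have geo: "summable (\<lambda>k. (1/8)^k :: real)" by (rule summable_geometric) simp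
  have comp: "summable q" if "\<And>k. 0 \<le> q k" "\<And>k. q k \<le> nrm l (d k)" for q
    by (rule summable_comparison_test'[OF geo, of 0]) (use that(1) order_trans[OF that(2) dn] in simp)
  have dc: "iable 0 1 (c1 (d k))" "iable 0 1 (c2 (d k))" "iable 0 l (c3 (d k))" for k
    using dE[of k] unfolding inE_def by blast+
  have sm: "summable (\<lambda>k. itg 0 1 (\<lambda>x. cmod (c1 (d k) x)))" "summable (\<lambda>k. itg 0 1 (\<lambda>x. cmod (c2 (d k) x)))" "summable (\<lambda>k. itg 0 l (\<lambda>x. cmod (c3 (d k) x)))"
    by (rule comp, rule itg_nonneg, rule norm_ge_zero, rule nrm_parts)+
  obtain y1 where y1: "iable 0 1 y1" "\<And>n. itg 0 1 (\<lambda>x. cmod (y1 x - (\<Sum>k<n. c1 (d k) x))) \<le> (\<Sum>k. itg 0 1 (\<lambda>x. cmod (c1 (d (k + n)) x)))"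
    by (rule L1_series[OF dc(1) sm(1)]) blast
  obtain y2 where y2: "iable 0 1 y2" "\<And>n. itg 0 1 (\<lambda>x. cmod (y2 x - (\<Sum>k<n. c2 (d k) x))) \<le> (\<Sum>k. itg 0 1 (\<lambda>x. cmod (c2 (d (k + n)) x)))"
    by (rule L1_series[OF dc(2) sm(2)]) blast
  obtain y3 where y3: "iable 0 l y3" "\<And>n. itg 0 l (\<lambda>x. cmod (y3 x - (\<Sum>k<n. c3 (d k) x))) \<le> (\<Sum>k. itg 0 l (\<lambda>x. cmod (c3 (d (k + n)) x)))"
    by (rule L1_series[OF dc(3) sm(3)]) blast
  define y where "y = (y1, y2, y3)"
  have yE: "inE l y" using y1 y2 y3 by (simp add: y_def inE_def)
  have dist: "dst y (x (Suc k)) \<le> (1/8)^k / 7" for k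
  proof -
    let ?n = "Suc k"
    have sh: "summable (\<lambda>k. itg 0 1 (\<lambda>x. cmod (c1 (d (k + ?n)) x)))" "summable (\<lambda>k. itg 0 1 (\<lambda>x. cmod (c2 (d (k + ?n)) x)))"
      "summable (\<lambda>k. itg 0 l (\<lambda>x. cmod (c3 (d (k + ?n)) x)))"
      using sm by (auto intro: summable_ignore_initial_segment simp del: add_Suc_right)
    have "dst y (x ?n) \<le> (\<Sum>k. itg 0 1 (\<lambda>x. cmod (c1 (d (k + ?n)) x))) + (\<Sum>k. itg 0 1 (\<lambda>x. cmod (c2 (d (k + ?n)) x))) + (\<Sum>k. itg 0 l (\<lambda>x. cmod (c3 (d (k + ?n)) x)))"
      unfolding nrm_def c_vsub xsum y_def c_triple by (intro add_mono y1 y2 y3)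
    also have "\<dots> = (\<Sum>k. itg 0 1 (\<lambda>x. cmod (c1 (d (k + ?n)) x)) + itg 0 1 (\<lambda>x. cmod (c2 (d (k + ?n)) x)) + itg 0 l (\<lambda>x. cmod (c3 (d (k + ?n)) x)))"
      by (simp only: suminf_add[OF sh(1,2)] suminf_add[OF summable_add[OF sh(1,2)] sh(3)])
    also have "\<dots> = (\<Sum>k. nrm l (d (k + ?n)))" by (simp only: nrm_def)
    also have "\<dots> \<le> (\<Sum>k. (1/8)^(k + ?n))"
    proof (rule suminf_le)
      show "summable (\<lambda>k. nrm l (d (k + ?n)))" unfolding nrm_def by (intro summable_add sh)
      show "summable (\<lambda>k. (1/8)^(k + ?n) :: real)" by (rule summable_ignore_initial_segment[OF geo])
    qed (rule dn)
    also have "\<dots> = (\<Sum>k. (1/8)^?n * (1/8)^k)" by (simp only: power_add mult.commute)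
    also have "\<dots> = (1/8)^?n * (\<Sum>k. (1/8)^k)" by (rule suminf_mult[OF geo])
    also have "\<dots> = (1/8)^k / 7" by (subst suminf_geometric) simp_all
    finally show ?thesis .
  qed
  \<comment> \<open>The partial sum contributes 1/4 and the tail, a geometric series with sum
    \<open>(1/8)^k / 7\<close>, removes at most 1/7, in units of \<open>M k * (1/8)^k\<close>; the
    difference is 3/28.\<close>
  have low: "3/28 * 2^k \<le> nrm l (B (n k) y)" for k
  proof -
    have E: "inE l (B (n k) y)" "inE l (B (n k) (x (Suc k)))" by (intro BE yE xE)+
    have "dst (B (n k) y) (B (n k) (x (Suc k))) = nrm l (B (n k) (vsub y (x (Suc k))))"
      by (rule Bsub[symmetric, OF yE xE])
    also have "\<dots> \<le> M k * dst y (x (Suc k))" by (rule bd[rule_format]) (intro inE_vsub yE xE)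
    also have "\<dots> \<le> M k * ((1/8)^k / 7)"
      by (rule mult_left_mono[OF dist]) (rule order_trans[OF _ M], simp)
    finally have 1: "dst (B (n k) y) (B (n k) (x (Suc k))) \<le> M k * (1/8)^k / 7" by simp
    have "nrm l (B (n k) (x (Suc k))) \<le> dst (B (n k) (x (Suc k))) (B (n k) y) + nrm l (B (n k) y)"
      by (rule nrm_triangle2[OF E(2,1)])
    then have 2: "M k * (1/8)^k * (3/28) \<le> nrm l (B (n k) y)"
      using big[of k] 1 nrm_vsub_commute[of l "B (n k) y" "B (n k) (x (Suc k))"] unfolding c_def by linarith
    have "(2::real)^k = 16^k * (1/8)^k" unfolding power_mult_distrib[symmetric] by simp
    also have "\<dots> \<le> M k * (1/8)^k" by (rule mult_right_mono[OF M]) simp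
    finally show ?thesis using 2 by linarith
  qed
  obtain C N where C: "\<And>m. N \<le> m \<Longrightarrow> nrm l (B m y) \<le> C" using pt[OF yE] by blast
  obtain k0 where "C * (28/3) < (2::real)^k0" using real_arch_pow[of 2 "C * (28/3)"] by auto
  moreover have "(2::real)^k0 \<le> 2^(max k0 N)" by (rule power_increasing) auto
  ultimately have "C < 3/28 * 2^(max k0 N)" by linarith
  also have "\<dots> \<le> nrm l (B (n (max k0 N)) y)" by (rule low)
  also have "\<dots> \<le> C" by (rule C) (use n[of "max k0 N"] in simp)
  finally show False by simp
qed

lemma nrm_triangle4:
  assumes "inE l a" "inE l b" "inE l c" "inE l d"
  shows "dst a d \<le> dst a b + dst b c + dst c d"
  using nrm_triangle[OF assms(1,2,4)] nrm_triangle[OF assms(2,3,4)] by linarith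

lemma S_diff: "0 \<le> t \<Longrightarrow> inE l f \<Longrightarrow> inE l g \<Longrightarrow> dst (S t f) (S t g) \<le> dst f g"
  using S_contractive[of "vsub f g" t] S_sub_nrm[of t f g] by (simp add: inE_vsub)

section \<open>Comparison with an arbitrary generated semigroup\<close>

context
  fixes T :: "real \<Rightarrow> vec \<Rightarrow> vec"
  assumes gen: "generated_semigroup l T"
begin

lemma gen_parts:
  "\<forall>t\<ge>0. \<forall>f. inE l f \<longrightarrow> inE l (T t f)"
  "\<forall>t\<ge>0. \<forall>a b f g. inE l f \<and> inE l g \<longrightarrow> dst (T t (vlin a f b g)) (vlin a (T t f) b (T t g)) = 0"
  "\<forall>t\<ge>0. \<exists>M. \<forall>f. inE l f \<longrightarrow> nrm l (T t f) \<le> M * nrm l f"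
  "\<forall>f. inE l f \<longrightarrow> dst (T 0 f) f = 0"
  "\<forall>t\<ge>0. \<forall>s\<ge>0. \<forall>f. inE l f \<longrightarrow> dst (T (t + s) f) (T t (T s f)) = 0"
  "\<forall>f. inE l f \<longrightarrow> ((\<lambda>t. dst (T t f) f) \<longlongrightarrow> 0) (at_right 0)"
  "\<forall>f g. (f, g) \<in> graphA l \<longleftrightarrow> (inE l f \<and> inE l g \<and>
         ((\<lambda>t. dst (dquot t (T t f) f) g) \<longlongrightarrow> 0) (at_right 0))"
  by (insert gen, unfold generated_semigroup_def, (elim conjE, assumption)+)

lemmas T_inE = gen_parts(1)[rule_format]
lemmas T_0 = gen_parts(4)[rule_format]
lemmas T_tendsto = gen_parts(6)[rule_format]
lemmas T_generator = gen_parts(7)[rule_format]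

lemma T_lin: "0 \<le> t \<Longrightarrow> inE l f \<Longrightarrow> inE l g \<Longrightarrow> aeq l (T t (vlin a f b g)) (vlin a (T t f) b (T t g))"
proof -
  assume *: "0 \<le> t" "inE l f" "inE l g"
  from gen_parts(2)[rule_format, OF *(1) conjI[OF *(2,3)]] have "dst (T t (vlin a f b g)) (vlin a (T t f) b (T t g)) = 0" .
  then show ?thesis using * by (subst (asm) nrm_vsub_eq_0) (auto intro: T_inE inE_vlin)
qed

lemma T_add: "0 \<le> t \<Longrightarrow> 0 \<le> s \<Longrightarrow> inE l f \<Longrightarrow> aeq l (T (t + s) f) (T t (T s f))"
proof -
  assume *: "0 \<le> t" "0 \<le> s" "inE l f"
  from gen_parts(5)[rule_format, OF *] have "dst (T (t + s) f) (T t (T s f)) = 0" .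
  then show ?thesis using * by (subst (asm) nrm_vsub_eq_0) (auto intro: T_inE)
qed

lemma T_sub: "0 \<le> t \<Longrightarrow> inE l f \<Longrightarrow> inE l g \<Longrightarrow> nrm l (T t (vsub f g)) = dst (T t f) (T t g)"
  unfolding vsub_def by (intro nrm_aeq T_lin T_inE inE_vlin)

lemma T_bounded_op: "0 \<le> t \<Longrightarrow> bounded_op (T t)"
proof -
  assume t: "0 \<le> t"
  have "nrm l (T t (vscale c f)) = cmod c * nrm l (T t f)" if "inE l f" for c f
  proof -
    have "nrm l (T t (vscale c f)) = nrm l (vscale c (T t f))"
      unfolding vscale_def using that t by (intro nrm_aeq T_lin T_inE inE_vlin)
    then show ?thesis by (simp add: nrm_vscale)
  qed
  moreover have "\<exists>M. \<forall>f. inE l f \<longrightarrow> nrm l (T t f) \<le> M * nrm l f"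
    using gen_parts(3) t by blast
  ultimately show ?thesis unfolding bounded_op_def by (intro conjI allI impI T_inE[OF t] T_sub[OF t]) simp_all
qed

text \<open>The bounds in \<open>generated_semigroup\<close> could a priori blow up as time tends to
  0. Then some times \<open>t n\<close> tending to 0 would have unbounded operator norms, although
  every orbit stays bounded along them by strong continuity, against
  \<open>uniform_boundedness\<close>.\<close>

lemma T_bounded_near_0: "\<exists>\<delta> M. 0 < \<delta> \<and> (\<forall>t f. 0 \<le> t \<and> t \<le> \<delta> \<and> inE l f \<longrightarrow> nrm l (T t f) \<le> M * nrm l f)"
proof (rule ccontr)
  assume "\<not> ?thesis"
  then have neg: "\<exists>t f. 0 \<le> t \<and> t \<le> \<delta> \<and> inE l f \<and> M * nrm l f < nrm l (T t f)" if "0 < \<delta>" for \<delta> M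
    using that by (meson not_le)
  have "\<exists>t f. 0 \<le> t \<and> t \<le> 1 / real (Suc n) \<and> inE l f \<and> real n * nrm l f < nrm l (T t f)" for n
    by (rule neg) simp
  then obtain t f where t: "\<And>n. 0 \<le> t n" "\<And>n. t n \<le> 1 / real (Suc n)" and f: "\<And>n. inE l (f n)" "\<And>n. real n * nrm l (f n) < nrm l (T (t n) (f n))"
    by metis
  have "\<exists>C N. \<forall>n\<ge>N. nrm l (T (t n) g) \<le> C" if g: "inE l g" for g
  proof -
    have "\<forall>\<^sub>F s in at_right 0. dst (T s g) g < 1" using order_tendstoD(2)[OF T_tendsto[OF g]] by simp
    then obtain b where b: "0 < b" "\<And>s. 0 < s \<Longrightarrow> s < b \<Longrightarrow> dst (T s g) g < 1"
      unfolding eventually_at_right_field by auto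
    obtain N :: nat where N: "inverse (real (Suc N)) < b" using reals_Archimedean[OF b(1)] by blast
    have "nrm l (T (t n) g) \<le> 1 + nrm l g" if "N \<le> n" for n
    proof -
      have "1 / real (Suc n) \<le> 1 / real (Suc N)" using that by (simp add: frac_le)
      then have "t n < b" using t(2)[of n] N by (simp add: inverse_eq_divide)
      then have "dst (T (t n) g) g \<le> 1"
        using b(2)[of "t n"] t(1)[of n] T_0[OF g] by (cases "t n = 0") auto
      then show ?thesis using nrm_triangle2[OF T_inE[OF t(1)[of n] g] g] by linarith
    qed
    then show ?thesis by blast
  qed
  then have "\<exists>M N. \<forall>n\<ge>N. \<forall>f. inE l f \<longrightarrow> nrm l (T (t n) f) \<le> M * nrm l f"
    by (rule uniform_boundedness[OF T_bounded_op[OF t(1)]])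
  then obtain M N where MN: "\<And>n f. N \<le> n \<Longrightarrow> inE l f \<Longrightarrow> nrm l (T (t n) f) \<le> M * nrm l f"
    by blast
  obtain k :: nat where k: "M \<le> real k" using real_arch_simple by blast
  let ?n = "max k N"
  have "M * nrm l (f ?n) \<le> real ?n * nrm l (f ?n)" by (rule mult_right_mono) (use k nrm_nonneg in auto)
  then show False using MN[of ?n "f ?n"] f[of ?n] by simp
qed

text \<open>The semigroup law multiplies the bound once for each step of length
  \<open>\<delta>\<close>; enlarging the constant to at least 1 makes its powers increase.\<close>

lemma T_bounded: "\<exists>M\<ge>0. \<forall>t f. 0 \<le> t \<and> t \<le> r \<and> inE l f \<longrightarrow> nrm l (T t f) \<le> M * nrm l f"
proof -
  obtain \<delta> M where \<delta>: "0 < \<delta>" and M: "\<And>t f. 0 \<le> t \<Longrightarrow> t \<le> \<delta> \<Longrightarrow> inE l f \<Longrightarrow> nrm l (T t f) \<le> M * nrm l f"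
    using T_bounded_near_0 by blast
  define M' where "M' = max 1 M"
  have M': "1 \<le> M'" and M'b: "\<And>t f. 0 \<le> t \<Longrightarrow> t \<le> \<delta> \<Longrightarrow> inE l f \<Longrightarrow> nrm l (T t f) \<le> M' * nrm l f"
  proof -
    show "1 \<le> M'" by (simp add: M'_def)
    fix t f assume "0 \<le> t" "t \<le> \<delta>" "inE l f"
    then have "nrm l (T t f) \<le> M * nrm l f" by (rule M)
    also have "\<dots> \<le> M' * nrm l f" by (rule mult_right_mono) (simp_all add: M'_def nrm_nonneg)
    finally show "nrm l (T t f) \<le> M' * nrm l f" .
  qed
  have "\<forall>t f. 0 \<le> t \<and> t \<le> real n * \<delta> \<and> inE l f \<longrightarrow> nrm l (T t f) \<le> M'^Suc n * nrm l f" for n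
  proof (induction n)
    case 0
    then show ?case using M'b \<delta> by auto
  next
    case (Suc n)
    show ?case
    proof (intro allI impI, elim conjE)
      fix t f assume t: "0 \<le> t" "t \<le> real (Suc n) * \<delta>" and f: "inE l f"
      have p: "M' ^ Suc n * nrm l f \<le> M' ^ Suc (Suc n) * nrm l f"
        by (rule mult_right_mono[OF power_increasing nrm_nonneg]) (use M' in auto)
      show "nrm l (T t f) \<le> M'^Suc (Suc n) * nrm l f"
      proof (cases "t \<le> real n * \<delta>")
        case True
        then show ?thesis using Suc t f p by (meson order_trans)
      next
        case False
        then have s: "t - \<delta> \<le> real n * \<delta>" using t by (simp add: algebra_simps)
        show ?thesis
        proof (cases "0 \<le> t - \<delta>")
          case True
          have "nrm l (T (\<delta> + (t - \<delta>)) f) = nrm l (T \<delta> (T (t - \<delta>) f))"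
            using T_add[of \<delta> "t - \<delta>" f] True \<delta> f by (intro nrm_aeq T_inE) auto
          also have "\<dots> \<le> M' * nrm l (T (t - \<delta>) f)" by (rule M'b) (use \<delta> True f in \<open>auto intro: T_inE\<close>)
          also have "\<dots> \<le> M' * (M'^Suc n * nrm l f)" by (rule mult_left_mono, rule Suc[rule_format]) (use True s f M' in auto)
          finally show ?thesis by (simp add: mult.assoc)
        next
          case False
          then have "nrm l (T t f) \<le> M'^1 * nrm l f" using M'b t f by simp
          also have "\<dots> \<le> M'^Suc (Suc n) * nrm l f"
            by (rule mult_right_mono[OF power_increasing nrm_nonneg]) (use M' in auto)
          finally show ?thesis .
        qed
      qed
    qed
  qed
  moreover obtain n :: nat where "r / \<delta> \<le> real n" using real_arch_simple by blast
  then have "r \<le> real n * \<delta>" using \<delta> by (simp add: field_simps)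
  ultimately show ?thesis using M' by (intro exI[of _ "M'^Suc n"]) (auto intro: order_trans)
qed

text \<open>\<open>T s\<close> commutes up to null sets with the difference quotients, and its
  boundedness carries their limit over.\<close>

lemma T_graph:
  assumes g: "(x, g) \<in> graphA l" and s: "0 \<le> s"
  shows "(T s x, T s g) \<in> graphA l"
proof -
  have E: "inE l x" "inE l g" using graphA_inE[OF g] by auto
  obtain M where M: "0 \<le> M" "\<And>f. inE l f \<Longrightarrow> nrm l (T s f) \<le> M * nrm l f" using T_bounded[of s] s by auto
  have le: "dst (dquot h (T h (T s x)) (T s x)) (T s g) \<le> M * dst (dquot h (T h x) x) g" if h: "0 < h" for h
  proof -
    have a: "aeq l (T h (T s x)) (T s (T h x))"
      using T_add[of h s x] T_add[of s h x] s h E by (auto simp: add.commute intro: aeq_trans aeq_sym)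
    let ?q = "dquot h (T h x) x"
    have qE: "inE l ?q" by (intro inE_vscale inE_vsub T_inE E) (use h in auto)
    have dE: "inE l (vsub (T h x) x)" by (intro inE_vsub T_inE E) (use h in auto)
    have 1: "aeq l (vsub (T h (T s x)) (T s x)) (vsub (T s (T h x)) (T s x))"
      unfolding vsub_def by (rule aeq_vlin[OF a aeq_refl])
    have 2: "aeq l (vsub (T s (T h x)) (T s x)) (T s (vsub (T h x) x))"
      unfolding vsub_def by (rule aeq_sym, rule T_lin) (use s h E in \<open>auto intro: T_inE\<close>)
    have 3: "aeq l (vscale (of_real (1/h)) (T s (vsub (T h x) x))) (T s ?q)"
      unfolding vscale_def by (rule aeq_sym, rule T_lin) (use s dE in auto)
    have "aeq l (dquot h (T h (T s x)) (T s x)) (T s ?q)"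
      by (rule aeq_trans[OF _ 3]) (unfold vscale_def, intro aeq_vlin aeq_trans[OF 1 2])
    then have "dst (dquot h (T h (T s x)) (T s x)) (T s g) = dst (T s ?q) (T s g)"
      by (intro nrm_vsub_aeq inE_vscale inE_vsub T_inE E qE) (use s h in auto)
    also have "\<dots> = nrm l (T s (vsub ?q g))" using T_sub[OF s qE E(2)] by simp
    also have "\<dots> \<le> M * dst ?q g" by (rule M(2)) (intro inE_vsub qE E)
    finally show ?thesis .
  qed
  have lim: "((\<lambda>h. dst (dquot h (T h x) x) g) \<longlongrightarrow> 0) (at_right 0)"
    using g T_generator by blast
  have "((\<lambda>h. dst (dquot h (T h (T s x)) (T s x)) (T s g)) \<longlongrightarrow> 0) (at_right 0)"
  proof (rule tendsto_sandwich[OF _ _ tendsto_const])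
    show "((\<lambda>h. M * dst (dquot h (T h x) x) g) \<longlongrightarrow> 0) (at_right 0)"
      using tendsto_mult[OF tendsto_const[of M] lim] by simp
    show "\<forall>\<^sub>F h in at_right 0. dst (dquot h (T h (T s x)) (T s x)) (T s g) \<le> M * dst (dquot h (T h x) x) g"
      by (rule eventually_mono[OF eventually_at_right_less]) (rule le)
  qed (simp add: nrm_nonneg)
  then show ?thesis using T_generator[of "T s x" "T s g"] T_inE s E by blast
qed

text \<open>Instead of differentiating the vector-valued path \<open>S (t - s) (T s x)\<close> in
  \<open>s\<close>, its distance \<open>w\<close> from \<open>S t x\<close> is studied.
  \<open>w\<close> is 0 at the start, has nonpositive upper right Dini derivative because both
  semigroups have the same generator, and ends at the distance in question.\<close>

lemma T_eq_S_domain: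
  assumes g: "(x, g) \<in> graphA l" and t: "0 \<le> t"
  shows "dst (T t x) (S t x) = 0"
proof -
  have E: "inE l x" "inE l g" using graphA_inE[OF g] by auto
  obtain M where M: "0 \<le> M" "\<And>s f. 0 \<le> s \<Longrightarrow> s \<le> t \<Longrightarrow> inE l f \<Longrightarrow> nrm l (T s f) \<le> M * nrm l f" using T_bounded[of t] by auto
  define w where "w s = dst (S (t - s) (T s x)) (S t x)" for s
  have wE: "inE l (S (t - s) (T s x))" if "0 \<le> s" for s by (intro inE_S T_inE E that)
  have Tdiff: "dst (T (s + h) x) (T s x) \<le> M * dst (T h x) x" if "0 \<le> s" "s \<le> t" "0 \<le> h" for s h
  proof -
    have "dst (T (s + h) x) (T s x) = dst (T s (T h x)) (T s x)"
      by (rule nrm_vsub_aeq) (use that T_add[of s h x] E in \<open>auto intro: T_inE\<close>)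
    also have "\<dots> = nrm l (T s (vsub (T h x) x))" using T_sub[of s "T h x" x] that E T_inE by simp
    also have "\<dots> \<le> M * dst (T h x) x" by (rule M(2)) (use that E in \<open>auto intro: T_inE\<close>)
    finally show ?thesis .
  qed
  \<comment> \<open>Both terms share the contraction \<open>S (t - (s + h))\<close>, which can be
    removed.\<close>
  have step: "\<bar>w (s + h) - w s\<bar> \<le> dst (T h (T s x)) (S h (T s x))" if "0 \<le> s" "0 \<le> h" "s + h \<le> t" for s h
  proof -
    have TE: "inE l (T (s + h) x)" "inE l (T s x)" "inE l (T h (T s x))" by (intro T_inE E; use that in simp)+
    have "dst (S (t - (s + h)) (T (s + h) x)) (S (t - s) (T s x))
       = dst (S (t - (s + h)) (T (s + h) x)) (S (t - (s + h)) (S h (T s x)))"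
    proof (rule nrm_vsub_aeq)
      have "dst (S ((t - (s + h)) + h) (T s x)) (S (t - (s + h)) (S h (T s x))) = 0"
        by (rule S_add) (use that in auto)
      then show "aeq l (S (t - s) (T s x)) (S (t - (s + h)) (S h (T s x)))"
        using nrm_vsub_eq_0[of l "S (t - s) (T s x)" "S (t - (s + h)) (S h (T s x))"] that E by (simp add: inE_S T_inE)
    qed (use that E in \<open>auto intro: inE_S TE\<close>)
    also have "\<dots> \<le> dst (T (s + h) x) (S h (T s x))"
      by (rule S_diff) (use that E in \<open>auto intro: inE_S TE\<close>)
    also have "\<dots> = dst (T h (T s x)) (S h (T s x))"
    proof (rule nrm_vsub_aeq)
      show "aeq l (T (s + h) x) (T h (T s x))" using T_add[of h s x] that E by (simp add: add.commute)
    qed (intro inE_S TE aeq_refl)+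
    finally have 1: "dst (S (t - (s + h)) (T (s + h) x)) (S (t - s) (T s x)) \<le> dst (T h (T s x)) (S h (T s x))" .
    have "w (s + h) \<le> dst (S (t - (s + h)) (T (s + h) x)) (S (t - s) (T s x)) + w s"
      unfolding w_def by (rule nrm_triangle) (use that E in \<open>auto intro: inE_S wE TE\<close>)
    moreover have "w s \<le> dst (S (t - s) (T s x)) (S (t - (s + h)) (T (s + h) x)) + w (s + h)"
      unfolding w_def by (rule nrm_triangle) (use that E in \<open>auto intro: inE_S wE TE\<close>)
    ultimately show ?thesis using 1 nrm_vsub_commute[of l "S (t - s) (T s x)" "S (t - (s + h)) (T (s + h) x)"] by linarith
  qed
  \<comment> \<open>Letting \<open>s'\<close> be either end keeps the vector \<open>T s' x\<close>
    fixed while the other end approaches it, so continuity of \<open>S\<close> at time 0 yields left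
    and right continuity of \<open>w\<close> alike.\<close>
  have close: "\<bar>w (s + h) - w s\<bar> \<le> 3 * M * dst (T h x) x + dst (S h (T s' x)) (T s' x)"
    if "0 \<le> s" "0 \<le> h" "s + h \<le> t" "s' = s \<or> s' = s + h" for s h s'
  proof -
    have s': "0 \<le> s'" using that by auto
    have TE: "inE l (T h (T s x))" "inE l (T s x)" "inE l (T s' x)" "inE l (S h (T s' x))" "inE l (S h (T s x))"
      by (intro inE_S T_inE E that s')+
    have 1: "dst (T h (T s x)) (T s x) \<le> M * dst (T h x) x"
    proof -
      have "dst (T h (T s x)) (T s x) = dst (T (s + h) x) (T s x)"
      proof (rule nrm_vsub_aeq[OF TE(1) _ TE(2,2) _ aeq_refl])
        show "aeq l (T h (T s x)) (T (s + h) x)" using T_add[of h s x] that E by (simp add: add.commute aeq_sym)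
        show "inE l (T (s + h) x)" by (intro T_inE E) (use that in simp)
      qed
      then show ?thesis using Tdiff[of s h] that by simp
    qed
    have 2: "dst (T s' x) (T s x) \<le> M * dst (T h x) x"
    proof (cases "s' = s")
      case True
      have "vsub (T s x) (T s x) = vzero" by (rule vec_eqI) (simp_all add: c_vzero)
      then show ?thesis using True M(1) nrm_nonneg[of l "vsub (T h x) x"] by simp
    next
      case False
      then show ?thesis using Tdiff[of s h] that by auto
    qed
    have 3: "dst (S h (T s' x)) (S h (T s x)) \<le> dst (T s' x) (T s x)" by (rule S_diff) (use that TE in auto)
    have "dst (T h (T s x)) (S h (T s x)) \<le> dst (T h (T s x)) (T s x) + dst (T s x) (T s' x) + dst (T s' x) (S h (T s x))"
      by (rule nrm_triangle4) (rule TE)+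
    moreover have "dst (T s' x) (S h (T s x)) \<le> dst (T s' x) (S h (T s' x)) + dst (S h (T s' x)) (S h (T s x))"
      by (rule nrm_triangle) (rule TE)+
    ultimately show ?thesis using step[OF that(1-3)] 1 2 3
        nrm_vsub_commute[of l "T s x" "T s' x"] nrm_vsub_commute[of l "T s' x" "S h (T s' x)"] by linarith
  qed
  have cont: "continuous_on {0..t} w"
    unfolding continuous_on_iff
  proof (intro ballI allI impI)
    fix s' e :: real assume s': "s' \<in> {0..t}" and e: "0 < e"
    have yE: "inE l (T s' x)" using s' by (intro T_inE E) auto
    define \<rho> where "\<rho> h = 3 * M * dst (T h x) x + dst (S h (T s' x)) (T s' x)" for h
    have "(\<rho> \<longlongrightarrow> 3 * M * 0 + 0) (at_right 0)"
      unfolding \<rho>_def by (intro tendsto_intros T_tendsto S_continuous E yE)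
    then have "\<forall>\<^sub>F h in at_right 0. \<rho> h < e" using e by (intro order_tendstoD(2)) auto
    then obtain b where b: "0 < b" "\<And>h. 0 < h \<Longrightarrow> h < b \<Longrightarrow> \<rho> h < e"
      unfolding eventually_at_right_field by auto
    show "\<exists>d>0. \<forall>r\<in>{0..t}. dist r s' < d \<longrightarrow> dist (w r) (w s') < e"
    proof (intro exI[of _ b] conjI b ballI impI)
      fix r assume r: "r \<in> {0..t}" "dist r s' < b"
      consider "r = s'" | "r < s'" | "s' < r" by linarith
      then show "dist (w r) (w s') < e"
      proof cases
        case 2
        have "\<bar>w (r + (s' - r)) - w r\<bar> \<le> \<rho> (s' - r)" unfolding \<rho>_def by (rule close) (use 2 r s' in auto)
        then show ?thesis using b(2)[of "s' - r"] 2 r by (simp add: dist_real_def abs_minus_commute)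
      next
        case 3
        have "\<bar>w (s' + (r - s')) - w s'\<bar> \<le> \<rho> (r - s')" unfolding \<rho>_def by (rule close) (use 3 r s' in auto)
        then show ?thesis using b(2)[of "r - s'"] 3 r by (simp add: dist_real_def)
      qed (use e in simp)
    qed
  qed
  \<comment> \<open>By \<open>T_graph\<close> the vector \<open>T s x\<close> stays in the domain.
    Both difference quotients there have the same limit, so the two semigroups separate only to
    order \<open>o(h)\<close>.\<close>
  have dini: "\<exists>\<delta>>0. \<forall>h. 0 < h \<and> h < \<delta> \<and> s + h \<le> t \<longrightarrow> w (s + h) \<le> w s + e * h" if s: "0 \<le> s" "s < t" and e: "0 < e" for s e
  proof -
    let ?y = "T s x" and ?g = "T s g"
    have yg: "(?y, ?g) \<in> graphA l" by (rule T_graph[OF g s(1)])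
    have yE: "inE l ?y" "inE l ?g" using graphA_inE[OF yg] by auto
    let ?q = "\<lambda>T h. dquot h (T h ?y) ?y :: vec"
    have "((\<lambda>h. dst (?q T h) ?g + dst (?q S h) ?g) \<longlongrightarrow> 0 + 0) (at_right 0)"
      using T_generator[of ?y ?g] yg generator_if[OF yg] by (intro tendsto_add) blast+
    then have "\<forall>\<^sub>F h in at_right 0. dst (?q T h) ?g + dst (?q S h) ?g < e"
      using e by (intro order_tendstoD(2)) auto
    then obtain b where b: "0 < b" "\<And>h. 0 < h \<Longrightarrow> h < b \<Longrightarrow> dst (?q T h) ?g + dst (?q S h) ?g < e"
      unfolding eventually_at_right_field by auto
    have "w (s + h) \<le> w s + e * h" if h: "0 < h" "h < b" "s + h \<le> t" for h
    proof -
      have qE: "inE l (?q T h)" "inE l (?q S h)" by (intro inE_vscale inE_vsub T_inE inE_S yE; use h in simp)+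
      have "vsub (T h ?y) (S h ?y) = vscale (of_real h) (vsub (?q T h) (?q S h))"
        using h by (intro vec_eqI) (simp_all add: field_simps)
      then have "dst (T h ?y) (S h ?y) = h * dst (?q T h) (?q S h)"
        using h by (simp add: nrm_vscale)
      also have "\<dots> \<le> h * e"
      proof (rule mult_left_mono)
        have "dst (?q T h) (?q S h) \<le> dst (?q T h) ?g + dst ?g (?q S h)"
          by (rule nrm_triangle[OF qE(1) yE(2) qE(2)])
        then show "dst (?q T h) (?q S h) \<le> e"
          using b(2)[OF h(1,2)] nrm_vsub_commute[of l ?g "?q S h"] by linarith
      qed (use h in simp)
      finally have "dst (T h ?y) (S h ?y) \<le> e * h" by (simp add: mult.commute)
      then show ?thesis using step[of s h] s h by linarith
    qed
    then show ?thesis using b(1) by blast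
  qed
  have "w t \<le> w 0" by (rule right_Dini_nonincreasing[OF t cont dini])
  also have "w 0 \<le> dst (T 0 x) x" unfolding w_def by (simp, rule S_diff[OF t T_inE[OF order_refl E(1)] E(1)])
  also have "\<dots> = 0" by (rule T_0[OF E(1)])
  finally have "w t = 0" using nrm_nonneg[of l "vsub (S (t - t) (T t x)) (S t x)"] unfolding w_def by simp
  moreover have "w t = dst (T t x) (S t x)"
    unfolding w_def using S_0[of "T t x"] nrm_vsub_eq_0[of l "S 0 (T t x)" "T t x"] t E
    by (intro nrm_vsub_aeq) (auto intro: inE_S T_inE)
  ultimately show ?thesis by simp
qed

lemma T_eq_S:
  assumes t: "0 \<le> t" and f: "inE l f"
  shows "dst (T t f) (S t f) = 0"
proof -
  obtain M where M: "\<And>f. inE l f \<Longrightarrow> nrm l (T t f) \<le> M * nrm l f" using T_bounded_op[OF t] unfolding bounded_op_def by blast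
  have le: "dst (T t f) (S t f) \<le> (\<bar>M\<bar> + 1) * e" if e: "0 < e" for e
  proof -
    obtain x where x: "x \<in> domA l" "dst f x < e" using A_dense f e unfolding densely_defined_def by blast
    obtain g where g: "(x, g) \<in> graphA l" using x(1) unfolding domA_def by auto
    have xE: "inE l x" using graphA_inE[OF g] by auto
    have "dst (T t f) (T t x) = nrm l (T t (vsub f x))" using T_sub[OF t f xE] by simp
    also have "\<dots> \<le> M * dst f x" by (rule M) (intro inE_vsub f xE)
    also have "\<dots> \<le> \<bar>M\<bar> * e" by (rule mult_mono) (use x nrm_nonneg in auto)
    finally have 1: "dst (T t f) (T t x) \<le> \<bar>M\<bar> * e" .
    have 2: "dst (S t x) (S t f) \<le> e"
      using S_diff[OF t xE f] x(2) nrm_vsub_commute[of l x f] by linarith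
    have "dst (T t f) (S t f) \<le> dst (T t f) (T t x) + dst (T t x) (S t x) + dst (S t x) (S t f)"
      by (rule nrm_triangle4) (intro T_inE inE_S t f xE)+
    then show ?thesis using 1 2 T_eq_S_domain[OF g t] by (simp add: distrib_right)
  qed
  have "dst (T t f) (S t f) \<le> 0 + e" if "0 < e" for e
    using le[of "e / (\<bar>M\<bar> + 1)"] that by (simp add: add_nonneg_pos)
  then have "dst (T t f) (S t f) \<le> 0" by (rule field_le_epsilon)
  then show ?thesis using nrm_nonneg[of l "vsub (T t f) (S t f)"] by simp
qed

lemma T_asymptotics:
  assumes irr: "l \<notin> \<rat>"
  shows "indiv_asymp_positive l T" "\<not> positive_semigroup l T"
proof -
  have T: "inE l (T t f) \<and> dst (T t f) (S t f) = 0" if "0 \<le> t" "inE l f" for t f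
    using that T_inE T_eq_S by blast
  have "nrm l (T t f) \<le> 1 * nrm l f" if "0 \<le> t" "inE l f" for t f
    using nrm_triangle2[of l "T t f" "S t f"] T[OF that] inE_S[OF that(2)] S_contractive[OF that(2,1)] by simp
  moreover have "((\<lambda>t. dist_pos_cone l (T t f)) \<longlongrightarrow> 0) at_top" if "positive_vec l f" for f
    using T that by (intro dist_tendsto irr) (auto simp: positive_vec_def)
  ultimately show "indiv_asymp_positive l T" unfolding indiv_asymp_positive_def by blast
  show "\<not> positive_semigroup l T" by (rule S_not_positive) (use T in blast)
qed

end

section \<open>Spectral bound and dominance\<close>

lemma spectrum_iff: "z \<in> spectrumA l \<longleftrightarrow> K z = 0"
  by (simp add: spectrumA_def resolvent_set_iff)

lemma bdd_spectrum: "bdd_above (Re ` spectrumA l)"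
  by (rule bdd_aboveI[of _ 0]) (auto simp: spectrum_iff K_Re_le)

lemma spectral_bound_0: "spectral_bound l = 0"
  unfolding spectral_bound_def
proof (rule antisym)
  have 0: "0 \<in> spectrumA l" by (simp add: spectrum_iff K_0)
  show "(SUP z\<in>spectrumA l. Re z) \<le> 0"
    using 0 by (intro cSUP_least) (auto simp: spectrum_iff K_Re_le)
  show "0 \<le> (SUP z\<in>spectrumA l. Re z)"
    using cSUP_upper[OF 0 bdd_spectrum] by simp
qed

lemma dominant: "l \<notin> \<rat> \<Longrightarrow> {z \<in> spectrumA l. Re z = spectral_bound l} = {complex_of_real (spectral_bound l)}"
  by (auto simp: spectral_bound_0 spectrum_iff K_0 intro: K_imaginary)

end

theorem theorem9p7:
  fixes l :: real
  assumes "l > 0" and "l \<notin> \<rat>"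
  shows "closed_op l \<and> densely_defined l
    \<and> (\<forall>z. (eigenvalue l z \<longleftrightarrow> z \<in> spectrumA l) \<and> (z \<in> spectrumA l \<longleftrightarrow> \<not> invertible (Smat l z)))
    \<and> (\<forall>z. eigenvalue l z \<longrightarrow> eigenspace_dim1 l z)
    \<and> dissipative l \<and> (\<exists>T. generated_semigroup l T \<and> contractive l T)
    \<and> compact_resolvent l
    \<and> (((\<lambda>_. 0), indicator {0..1}, indicator {0..l}), vzero) \<in> graphA l
    \<and> in_ker_adjoint l (pairing l ((\<lambda>x. 1/3 * indicator {0..1} x), indicator {0..1}, indicator {0..l}))
    \<and> bdd_above (Re ` spectrumA l) \<and> spectral_bound l = 0
    \<and> {z \<in> spectrumA l. Re z = spectral_bound l} = {complex_of_real (spectral_bound l)}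
    \<and> (\<forall>T. generated_semigroup l T \<longrightarrow> indiv_asymp_positive l T \<and> \<not> positive_semigroup l T)"
proof -
  interpret network l by unfold_locales (rule assms(1))
  have spec: "\<forall>z. (eigenvalue l z \<longleftrightarrow> z \<in> spectrumA l) \<and> (z \<in> spectrumA l \<longleftrightarrow> \<not> invertible (Smat l z))"
    by (simp add: eigenvalue_iff spectrum_iff invertible_Smat)
  have dim: "\<forall>z. eigenvalue l z \<longrightarrow> eigenspace_dim1 l z" using eigenspace by blast
  have ex: "\<exists>T. generated_semigroup l T \<and> contractive l T" using S_generated S_contr by blast
  have asymp: "\<forall>T. generated_semigroup l T \<longrightarrow> indiv_asymp_positive l T \<and> \<not> positive_semigroup l T"
    using T_asymptotics[OF _ assms(2)] by blast
  show ?thesis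
    by (intro conjI A_closed A_dense spec dim A_dissipative ex A_compact_resolvent kernel kernel_adjoint
        bdd_spectrum spectral_bound_0 dominant[OF assms(2)] asymp)
qed

end
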